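(* Let $\mathbf v\in\mathbb R_{>0}^m$ and assume $\mathcal P_{\mathbf v}(m,\mathbf k,d)\neq\emptyset$. There exists a vector $\lambda_{\mathbf v}=\lambda_{\mathbf v}(m,\mathbf k,d)\in\mathbb R_{>0}^d$ with decreasing entries such that for every pair $(\mathcal V,\mathcal W)\in\mathcal{DRS}_{\mathbf v}$ the following are equivalent: (1) $(\mathcal V,\mathcal W)$ is a local $d_S$-minimizer of the joint potential $\mathrm{FP}$ on $\mathcal{DRS}_{\mathbf v}$; (2) $(\mathcal V,\mathcal W)$ is a global minimizer of $\mathrm{FP}$ on $\mathcal{DRS}_{\mathbf v}$; (3) $\lambda(S_{\mathcal V})=\lambda_{\mathbf v}$ and $\mathcal W=\mathcal V^\#$.
   Context: Fix integers $m,d\ge1$ and $\mathbf k=(k_1,\dots,k_m)\in\mathbb N^m$ with each $k_i\le d$. A system is an $m$-tuple $\mathcal V=(V_i)_{i=1}^m$ with $V_i\in L(\mathbb C^d,\mathbb C^{k_i})$; its RS operator is $S_{\mathcal V}=\sum_iV_i^*V_i$, and $\mathcal V$ is a reconstruction system (RS) if $S_{\mathcal V}$ is invertible; $\mathcal{RS}(m,\mathbf k,d)$ is the set of RS's. Given weights $\mathbf v\in\mathbb R_{>0}^m$, $\mathcal P_{\mathbf v}(m,\mathbf k,d)$ is the set of RS's with $V_iV_i^*=v_i^2I_{k_i}$ for all $i$. The canonical dual is $\mathcal V^\#=(V_iS_{\mathcal V}^{-1})_i$; $\mathcal W\in\mathcal{RS}$ is a dual of $\mathcal V$ if $\sum_iW_i^*V_i=I_d$,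 and $\mathcal D(\mathcal V)$ is the set of duals. $\mathcal{DRS}_{\mathbf v}=\{(\mathcal V,\mathcal W)\in\mathcal P_{\mathbf v}\times\mathcal{RS}(m,\mathbf k,d):\mathcal W\in\mathcal D(\mathcal V)\}$, joint potential $\mathrm{FP}(\mathcal V,\mathcal W)=\operatorname{tr}S_{\mathcal V}^2+\operatorname{tr}S_{\mathcal W}^2$. The pseudometric $d_S(\mathcal V,\mathcal W)=\|S_{\mathcal V}-S_{\mathcal W}\|$ uses the spectral norm. A pair $(\mathcal V,\mathcal W)\in\mathcal{DRS}_{\mathbf v}$ is a local $d_S$-minimizer of FP if there is $\varepsilon>0$ with $\mathrm{FP}(\mathcal V',\mathcal W')\ge\mathrm{FP}(\mathcal V,\mathcal W)$ for all $(\mathcal V',\mathcal W')\in\mathcal{DRS}_{\mathbf v}$ with $d_S(\mathcal V,\mathcal V')+d_S(\mathcal W,\mathcal W')<\varepsilon$; a global minimizer satisfies $\mathrm{FP}(\mathcal V,\mathcal W)\le\mathrm{FP}(\mathcal V',\mathcal W')$ for all pairs in $\mathcal{DRS}_{\mathbf v}$. $\lambda(S)$ denotes the eigenvalues of $S$ in decreasing order with multiplicity. *)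

theory Defs
  imports "Jordan_Normal_Form.Schur_Decomposition" "Jordan_Normal_Form.Gauss_Jordan_Elimination"
    "Jordan_Normal_Form.Char_Poly"
begin

(* A system (V_i)_{i<m} with V_i : C^d -> C^{k_i}, represented as a function
   nat => complex mat, extensional (zero 0x0 matrix) outside {0..<m}. *)
definition systems :: "nat \<Rightarrow> (nat \<Rightarrow> nat) \<Rightarrow> nat \<Rightarrow> (nat \<Rightarrow> complex mat) set" where
  "systems m k d = {V. (\<forall>i<m. V i \<in> carrier_mat (k i) d) \<and> (\<forall>i\<ge>m. V i = 0\<^sub>m 0 0)}"

definition rs_op :: "nat \<Rightarrow> nat \<Rightarrow> (nat \<Rightarrow> complex mat) \<Rightarrow> complex mat" where
  "rs_op m d V = mat d d (\<lambda>(a,b). \<Sum>i<m. (mat_adjoint (V i) * V i) $$ (a,b))"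

definition RS :: "nat \<Rightarrow> (nat \<Rightarrow> nat) \<Rightarrow> nat \<Rightarrow> (nat \<Rightarrow> complex mat) set" where
  "RS m k d = {V \<in> systems m k d. invertible_mat (rs_op m d V)}"

definition Pv :: "(nat \<Rightarrow> real) \<Rightarrow> nat \<Rightarrow> (nat \<Rightarrow> nat) \<Rightarrow> nat \<Rightarrow> (nat \<Rightarrow> complex mat) set" where
  "Pv v m k d = {V \<in> RS m k d. \<forall>i<m. V i * mat_adjoint (V i) = complex_of_real ((v i)\<^sup>2) \<cdot>\<^sub>m 1\<^sub>m (k i)}"

definition canon_dual :: "nat \<Rightarrow> nat \<Rightarrow> (nat \<Rightarrow> complex mat) \<Rightarrow> (nat \<Rightarrow> complex mat)" where
  "canon_dual m d V = (\<lambda>i. if i < m then V i * the (mat_inverse (rs_op m d V)) else 0\<^sub>m 0 0)"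

definition is_dual :: "nat \<Rightarrow> nat \<Rightarrow> (nat \<Rightarrow> complex mat) \<Rightarrow> (nat \<Rightarrow> complex mat) \<Rightarrow> bool" where
  "is_dual m d V W \<longleftrightarrow> mat d d (\<lambda>(a,b). \<Sum>i<m. (mat_adjoint (W i) * V i) $$ (a,b)) = 1\<^sub>m d"

definition DRS :: "(nat \<Rightarrow> real) \<Rightarrow> nat \<Rightarrow> (nat \<Rightarrow> nat) \<Rightarrow> nat
    \<Rightarrow> ((nat \<Rightarrow> complex mat) \<times> (nat \<Rightarrow> complex mat)) set" where
  "DRS v m k d = {(V, W). V \<in> Pv v m k d \<and> W \<in> RS m k d \<and> is_dual m d V W}"

definition mtrace :: "complex mat \<Rightarrow> complex" where
  "mtrace A = (\<Sum>i<dim_row A. A $$ (i,i))"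

(* joint frame potential FP(V,W) = tr S_V^2 + tr S_W^2 (real for Hermitian S) *)
definition FP :: "nat \<Rightarrow> nat \<Rightarrow> (nat \<Rightarrow> complex mat) \<Rightarrow> (nat \<Rightarrow> complex mat) \<Rightarrow> real" where
  "FP m d V W = Re (mtrace (rs_op m d V * rs_op m d V) + mtrace (rs_op m d W * rs_op m d W))"

definition vnorm :: "complex vec \<Rightarrow> real" where
  "vnorm x = sqrt (\<Sum>i<dim_vec x. (cmod (x $ i))\<^sup>2)"

definition spec_norm :: "complex mat \<Rightarrow> real" where
  "spec_norm A = Sup {vnorm (A *\<^sub>v x) | x. x \<in> carrier_vec (dim_col A) \<and> vnorm x \<le> 1}"

definition dS :: "nat \<Rightarrow> nat \<Rightarrow> (nat \<Rightarrow> complex mat) \<Rightarrow> (nat \<Rightarrow> complex mat) \<Rightarrow> real" where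
  "dS m d V W = spec_norm (rs_op m d V - rs_op m d W)"

definition local_dS_min :: "(nat \<Rightarrow> real) \<Rightarrow> nat \<Rightarrow> (nat \<Rightarrow> nat) \<Rightarrow> nat
    \<Rightarrow> (nat \<Rightarrow> complex mat) \<Rightarrow> (nat \<Rightarrow> complex mat) \<Rightarrow> bool" where
  "local_dS_min v m k d V W \<longleftrightarrow> (\<exists>\<epsilon>>0. \<forall>(V', W') \<in> DRS v m k d.
      dS m d V V' + dS m d W W' < \<epsilon> \<longrightarrow> FP m d V W \<le> FP m d V' W')"

definition global_min :: "(nat \<Rightarrow> real) \<Rightarrow> nat \<Rightarrow> (nat \<Rightarrow> nat) \<Rightarrow> nat
    \<Rightarrow> (nat \<Rightarrow> complex mat) \<Rightarrow> (nat \<Rightarrow> complex mat) \<Rightarrow> bool" where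
  "global_min v m k d V W \<longleftrightarrow> (\<forall>(V', W') \<in> DRS v m k d. FP m d V W \<le> FP m d V' W')"

definition eig_desc :: "complex mat \<Rightarrow> real list" where
  "eig_desc S = (THE l. length l = dim_row S \<and> sorted_wrt (\<ge>) l \<and>
      char_poly S = (\<Prod>x\<leftarrow>l. [:- complex_of_real x, 1:]))"

end

theory Submission
  imports Defs "HOL-Computational_Algebra.Fundamental_Theorem_Algebra" "HOL-Library.Countable"
begin

text \<open>
  Put \<open>X\<^sub>i = V\<^sub>i\<^sup>*\<close>, so that \<open>S\<^sub>V = \<Sum> X\<^sub>i X\<^sub>i\<^sup>*\<close> with \<open>X\<^sub>i\<^sup>* X\<^sub>i = v\<^sub>i\<^sup>2\<close>, and \<open>f x = x\<^sup>2 + x\<^sup>-\<^sup>2\<close>.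
  Every dual \<open>W\<close> of \<open>V\<close> has \<open>S\<^sub>W = S\<^sub>V\<^sup>-\<^sup>1 + S\<^sub>Z\<close> with \<open>Z = W - V\<^sup>#\<close>, and shrinking \<open>Z\<close> lowers the potential;
  so only \<open>tr f(S\<^sub>V)\<close> matters.

  At a local minimum the first variation shows that the range of each \<open>X\<^sub>i\<close> is spanned by eigenvectors of
  \<open>S\<^sub>V\<close>. The second variation shows that no nonzero deformations \<open>Y\<^sub>i\<close> moving these ranges towards
  smaller eigenvalues satisfy \<open>\<Sum> Y\<^sub>i X\<^sub>i\<^sup>* = 0\<close>. This is dual to the surjectivity of a linearized incidence
  problem, so families close to \<open>X\<close> possess a flag with the same intersection dimensions as the flag of
  eigenspaces of \<open>S\<^sub>V\<close>. For any other family \<open>X'\<close>, the \<open>z\<close> for which \<open>X + z (X' - X)\<close> has such a flag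
  form a constructible subset of the complex line; being infinite, it is cofinite, and a limit
  \<open>z \<rightarrow> 1\<close> with unitary matrices yields such a flag for \<open>X'\<close>.

  In an orthonormal basis \<open>u\<close> adapted to that flag the diagonal \<open>t\<close> of \<open>u\<^sup>* S' u\<close> satisfies
  \<open>\<Sum> f'(\<lambda>\<^sub>a) (t\<^sub>a - \<lambda>\<^sub>a) \<ge> 0\<close>, and convexity of \<open>f\<close> gives
  \<open>tr f(S') \<ge> tr f(S\<^sub>V) + \<parallel>u\<^sup>* S' u - \<Lambda>\<parallel>\<^sup>2\<close>. Hence local minimizers are global and share their spectrum.
  This replaces the convexity of the set of attained spectra (the Horn inequalities). No existence of
  minimizers is needed: without local minimizers, any list of the wrong trace serves as \<open>\<lambda>\<^sub>v\<close>.
\<close>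

section \<open>Quantifier elimination over the complex numbers\<close>

text \<open>The tight families do not contain the line from \<open>X\<close> to a distant competitor
  \<open>X'\<close>, so minimality cannot be transported along it. The existence of a flag that
  meets the ranges in prescribed dimensions can be: it makes sense for every matrix on the line, and
  it says of \<open>z\<close> that some \<open>y\<close> solves polynomial equations in
  \<open>z\<close> and \<open>y\<close>. Over the complex numbers such conditions define
  constructible sets, hence validity on a disc about \<open>0\<close> implies validity for almost
  all \<open>z\<close>.

  Two kinds of witness are needed. Unipotent matrices are a polynomial chart near the coordinate
  flag, fit for contraction and for elimination, but may diverge as \<open>z\<close> tends to
  \<open>1\<close>. Unitary matrices form a compact set but involve conjugation. Gram-Schmidt passes
  from the first to the second by triangular factors, which keep the required zeros because the
  eigenvalues are listed increasingly for \<open>S_V\<close> and decreasingly inside each range.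

  The flag for \<open>X'\<close> yields a single linear inequality. Its coefficients are the slopes
  of \<open>f\<close> at the eigenvalues of \<open>S_V\<close>, that is the gradient of
  \<open>tr f\<close> there, so convexity completes the comparison.\<close>

locale complex_function_ring =
  fixes R :: "('a \<Rightarrow> complex) set"
  assumes const: "(\<lambda>x. c) \<in> R"
    and add: "f \<in> R \<Longrightarrow> g \<in> R \<Longrightarrow> (\<lambda>x. f x + g x) \<in> R"
    and mult: "f \<in> R \<Longrightarrow> g \<in> R \<Longrightarrow> (\<lambda>x. f x * g x) \<in> R"
begin

lemma diff: "f \<in> R \<Longrightarrow> g \<in> R \<Longrightarrow> (\<lambda>x. f x - g x) \<in> R"
  using add[of f "\<lambda>x. (-1) * g x"] mult[OF const[of "-1"], of g] by simp

lemma sum: "(\<And>i. i \<in> I \<Longrightarrow> f i \<in> R) \<Longrightarrow> (\<lambda>x. \<Sum>i\<in>I. f i x) \<in> R"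
  by (induction I rule: infinite_finite_induct) (auto intro: const add)

text \<open>Depending only on which members of a finite subset of \<open>R\<close> vanish is the same as being a
  Boolean combination of zero sets, and makes the Boolean closure properties immediate.\<close>

definition constructible :: "'a set \<Rightarrow> bool" where
  "constructible C \<longleftrightarrow> (\<exists>F\<subseteq>R. finite F \<and>
     (\<forall>x y. (\<forall>f\<in>F. f x = 0 \<longleftrightarrow> f y = 0) \<longrightarrow> (x \<in> C \<longleftrightarrow> y \<in> C)))"

lemma constructible_vanishing: "f \<in> R \<Longrightarrow> constructible {x. f x = 0}"
  unfolding constructible_def by (intro exI[of _ "{f}"]) auto

lemma constructible_Compl: "constructible A \<Longrightarrow> constructible (- A)"
  unfolding constructible_def by auto

lemma constructible_Int:
  assumes "constructible A" "constructible B"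
  shows "constructible (A \<inter> B)"
proof -
  obtain F where F: "F \<subseteq> R" "finite F"
    "\<forall>x y. (\<forall>f\<in>F. f x = 0 \<longleftrightarrow> f y = 0) \<longrightarrow> (x \<in> A \<longleftrightarrow> y \<in> A)"
    using assms(1) unfolding constructible_def by blast
  obtain G where G: "G \<subseteq> R" "finite G"
    "\<forall>x y. (\<forall>f\<in>G. f x = 0 \<longleftrightarrow> f y = 0) \<longrightarrow> (x \<in> B \<longleftrightarrow> y \<in> B)"
    using assms(2) unfolding constructible_def by blast
  have "\<forall>x y. (\<forall>f\<in>F \<union> G. f x = 0 \<longleftrightarrow> f y = 0) \<longrightarrow> (x \<in> A \<inter> B \<longleftrightarrow> y \<in> A \<inter> B)"
  proof (intro allI impI)
    fix x y assume "\<forall>f\<in>F \<union> G. f x = 0 \<longleftrightarrow> f y = 0"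
    then have "\<forall>f\<in>F. f x = 0 \<longleftrightarrow> f y = 0" "\<forall>f\<in>G. f x = 0 \<longleftrightarrow> f y = 0" by blast+
    then have "x \<in> A \<longleftrightarrow> y \<in> A" "x \<in> B \<longleftrightarrow> y \<in> B"
      using F(3)[THEN spec[of _ x], THEN spec[of _ y]] G(3)[THEN spec[of _ x], THEN spec[of _ y]]
      by iprover+
    then show "x \<in> A \<inter> B \<longleftrightarrow> y \<in> A \<inter> B" by simp
  qed
  then show ?thesis
    unfolding constructible_def
    by (intro exI[of _ "F \<union> G"] conjI) (simp_all only: F(1,2) G(1,2) Un_least finite_UnI)
qed

lemma constructible_Un: "constructible A \<Longrightarrow> constructible B \<Longrightarrow> constructible (A \<union> B)"
  using constructible_Compl[OF constructible_Int[OF constructible_Compl constructible_Compl], of A B]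
  by simp

lemma constructible_UNION:
  "finite I \<Longrightarrow> (\<And>i. i \<in> I \<Longrightarrow> constructible (A i)) \<Longrightarrow> constructible (\<Union>i\<in>I. A i)"
proof (induction I rule: finite_induct)
  case empty
  then show ?case unfolding constructible_def by (intro exI[of _ "{}"]) auto
qed (auto intro: constructible_Un)

lemma constructible_INTER:
  "finite I \<Longrightarrow> (\<And>i. i \<in> I \<Longrightarrow> constructible (A i)) \<Longrightarrow> constructible (\<Inter>i\<in>I. A i)"
proof (induction I rule: finite_induct)
  case empty
  then show ?case unfolding constructible_def by (intro exI[of _ "{}"]) auto
qed (auto intro: constructible_Int)

lemma constructible_nonvanishing: "f \<in> R \<Longrightarrow> constructible {x. f x \<noteq> 0}"
  using constructible_Compl[OF constructible_vanishing[of f]] by (simp add: Compl_eq)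

text \<open>\<open>n\<close> is a formal degree bound uniform in \<open>x\<close>: the coefficient
  of index \<open>n - 1\<close> may vanish at some parameters and not at others, and elimination has
  to branch on this. Bound \<open>0\<close> means the zero polynomial.\<close>

definition poly_family :: "nat \<Rightarrow> ('a \<Rightarrow> complex poly) \<Rightarrow> bool" where
  "poly_family n F \<longleftrightarrow> (\<forall>i. (\<lambda>x. coeff (F x) i) \<in> R) \<and> (\<forall>x. \<forall>i\<ge>n. coeff (F x) i = 0)"

lemma poly_family_add:
  "poly_family n F \<Longrightarrow> poly_family m G \<Longrightarrow> poly_family (max n m) (\<lambda>x. F x + G x)"
  unfolding poly_family_def by (auto intro: add)

lemma poly_family_mult:
  assumes "poly_family n F" "poly_family m G"
  shows "poly_family (n + m) (\<lambda>x. F x * G x)"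
  unfolding poly_family_def coeff_mult
proof (intro conjI allI impI)
  fix i show "(\<lambda>x. \<Sum>j\<le>i. coeff (F x) j * coeff (G x) (i - j)) \<in> R"
    using assms by (auto intro!: sum mult simp: poly_family_def)
next
  fix x i assume "n + m \<le> i"
  have "coeff (F x) j * coeff (G x) (i - j) = 0" for j
    using assms \<open>n + m \<le> i\<close> by (cases "n \<le> j") (auto simp: poly_family_def)
  then show "(\<Sum>j\<le>i. coeff (F x) j * coeff (G x) (i - j)) = 0" by (intro sum.neutral) blast
qed

lemma poly_family_const: "f \<in> R \<Longrightarrow> poly_family 1 (\<lambda>x. [:f x:])"
  unfolding poly_family_def coeff_pCons
proof (intro conjI allI impI)
  fix i assume "f \<in> R"
  then show "(\<lambda>x. case i of 0 \<Rightarrow> f x | Suc j \<Rightarrow> coeff 0 j) \<in> R" by (cases i) (auto intro: const)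
qed (auto split: nat.splits)

lemma poly_family_power: "poly_family n F \<Longrightarrow> \<exists>m. poly_family m (\<lambda>x. F x ^ j)"
proof (induction j)
  case 0
  show ?case using poly_family_const[OF const[of 1]] by (auto simp: one_pCons[symmetric])
next
  case (Suc j)
  then show ?case using poly_family_mult by fastforce
qed

text \<open>Applied where the formal leading coefficient vanishes; there the subtracted monomial is
  zero, so \<open>F\<close> is unchanged while its bound drops.\<close>

lemma poly_family_drop:
  assumes "poly_family (Suc n) F"
  shows "poly_family n (\<lambda>x. F x - monom (coeff (F x) n) n)"
  unfolding poly_family_def
proof (intro conjI allI impI)
  fix i
  have "(\<lambda>x. coeff (F x) i - (if n = i then coeff (F x) i else 0)) \<in> R"
    using assms by (cases "n = i") (auto simp: poly_family_def const)
  then show "(\<lambda>x. coeff (F x - monom (coeff (F x) n) n) i) \<in> R"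
    by (simp cong: if_cong)
next
  fix x i assume "n \<le> i"
  then show "coeff (F x - monom (coeff (F x) n) n) i = 0"
    using assms by (cases "n = i") (auto simp: poly_family_def)
qed

text \<open>Cross-multiplying by the two leading coefficients cancels the terms of degree
  \<open>m\<close> without a division. Where \<open>coeff (F x) n\<close> is nonzero,
  \<open>F\<close> together with the result has the same common zeros as \<open>F\<close> together
  with \<open>G\<close>.\<close>

lemma poly_family_reduce:
  assumes F: "poly_family (Suc n) F" and G: "poly_family (Suc m) G" and "n \<le> m"
  shows "poly_family m (\<lambda>x. smult (coeff (F x) n) (G x) - monom (coeff (G x) m) (m - n) * F x)"
  unfolding poly_family_def
proof (intro conjI allI impI)
  fix i
  have "(\<lambda>x. coeff (F x) n * coeff (G x) i
      - (if i < m - n then 0 else coeff (G x) m * coeff (F x) (i - (m - n)))) \<in> R"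
    using F G by (cases "i < m - n") (auto intro!: diff mult const simp: poly_family_def)
  then show "(\<lambda>x. coeff (smult (coeff (F x) n) (G x) - monom (coeff (G x) m) (m - n) * F x) i) \<in> R"
    by (cases "i < m - n") (simp_all add: coeff_monom_mult)
next
  fix x i assume "m \<le> i"
  then show "coeff (smult (coeff (F x) n) (G x) - monom (coeff (G x) m) (m - n) * F x) i = 0"
    using F G \<open>n \<le> m\<close> by (cases "m = i") (auto simp: poly_family_def coeff_monom_mult)
qed

text \<open>Multiplying by powers of the leading coefficient avoids division, so all coefficients stay in \<open>R\<close>.\<close>

lemma pseudo_remainder:
  assumes F: "poly_family (Suc n) F"
  shows "poly_family m G \<Longrightarrow> \<exists>H. poly_family n H \<and>
    (\<forall>x. \<exists>N s. smult (coeff (F x) n ^ N) (G x) = s * F x + H x)"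
proof (induction m arbitrary: G)
  case 0
  then have "poly_family n G" by (auto simp: poly_family_def)
  moreover have "\<forall>x. \<exists>N s. smult (coeff (F x) n ^ N) (G x) = s * F x + G x"
    by (intro allI exI[of _ 0]) simp
  ultimately show ?case by blast
next
  case (Suc m)
  show ?case
  proof (cases "n \<le> m")
    case False
    then have "poly_family n G" using Suc.prems by (auto simp: poly_family_def)
    moreover have "\<forall>x. \<exists>N s. smult (coeff (F x) n ^ N) (G x) = s * F x + G x"
      by (intro allI exI[of _ 0]) simp
    ultimately show ?thesis by blast
  next
    case True
    obtain H where H: "poly_family n H"
      "\<And>x. \<exists>N s. smult (coeff (F x) n ^ N)
        (smult (coeff (F x) n) (G x) - monom (coeff (G x) m) (m - n) * F x) = s * F x + H x"
      using Suc.IH[OF poly_family_reduce[OF F Suc.prems True]] by blast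
    have "\<exists>N s. smult (coeff (F x) n ^ N) (G x) = s * F x + H x" for x
    proof -
      let ?a = "coeff (F x) n" and ?t = "monom (coeff (G x) m) (m - n)"
      obtain N s where *: "smult (?a ^ N) (smult ?a (G x) - ?t * F x) = s * F x + H x"
        using H(2) by blast
      have "smult (?a ^ Suc N) (G x) = (s + smult (?a ^ N) ?t) * F x + H x"
      proof -
        have "smult (?a ^ N) (smult ?a (G x)) - smult (?a ^ N) (?t * F x) = s * F x + H x"
          using * by (simp only: smult_diff_right)
        then have "smult (?a ^ N) (smult ?a (G x)) = s * F x + H x + smult (?a ^ N) (?t * F x)"
          by (simp only: diff_eq_eq)
        then show ?thesis by (simp add: algebra_simps)
      qed
      then show ?thesis by blast
    qed
    then show ?thesis using H(1) by blast
  qed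
qed

text \<open>Eliminates one variable. Branching on a formal leading coefficient either truncates an
  equation or, when it is nonzero, lets it reduce another equation of at least its degree. This
  stops at one equation \<open>F = 0\<close> or at none. If \<open>F\<close> has degree
  \<open>n\<close>, the system \<open>F = 0\<close>, \<open>Q \<noteq> 0\<close> is unsolvable iff
  \<open>F\<close> divides \<open>Q ^ n\<close>, and pseudo-division turns this into the vanishing
  of the coefficients of a remainder.\<close>

lemma constructible_solvable:
  assumes "poly_family N Q" "\<forall>p\<in>set P. poly_family (fst p) (snd p)"
  shows "constructible {x. \<exists>y. (\<forall>p\<in>set P. poly (snd p x) y = 0) \<and> poly (Q x) y \<noteq> 0}"
    (is "constructible (?E P)")
  using assms(2)
\<comment> \<open>The summand is \<open>Suc\<close> of the bound, so that deleting an identically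
  zero equation, whose bound is \<open>0\<close>, also decreases the measure.\<close>
proof (induction "\<Sum>p\<leftarrow>P. Suc (fst p)" arbitrary: P rule: less_induct)
  case less
  have split: "constructible A"
    if "poly_family (Suc n) F" "constructible ({x. coeff (F x) n = 0} \<inter> A)"
      "constructible ({x. coeff (F x) n \<noteq> 0} \<inter> A)" for n F A
  proof -
    have "A = ({x. coeff (F x) n = 0} \<inter> A) \<union> ({x. coeff (F x) n \<noteq> 0} \<inter> A)" by auto
    then show ?thesis using constructible_Un[OF that(2,3)] by simp
  qed
  have leading_zero: "constructible ({x. coeff (F x) n = 0} \<inter> ?E ((Suc n, F) # Ps))"
    if "poly_family (Suc n) F" "\<forall>p\<in>set Ps. poly_family (fst p) (snd p)"
      "(\<Sum>p\<leftarrow>P. Suc (fst p)) = (\<Sum>p\<leftarrow>(Suc n, F) # Ps. Suc (fst p))" for n F Ps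
  proof -
    let ?F = "\<lambda>x. F x - monom (coeff (F x) n) n"
    have "constructible (?E ((n, ?F) # Ps))"
      using that poly_family_drop[OF that(1)] by (intro less.hyps) auto
    moreover have "{x. coeff (F x) n = 0} \<inter> ?E ((Suc n, F) # Ps)
        = {x. coeff (F x) n = 0} \<inter> ?E ((n, ?F) # Ps)" by auto
    moreover have "constructible {x. coeff (F x) n = 0}"
      using that(1) by (intro constructible_vanishing) (auto simp: poly_family_def)
    ultimately show ?thesis by (simp add: constructible_Int)
  qed
  have two: "constructible (?E ((Suc n, F) # (Suc k, G) # Ps))"
    if F: "poly_family (Suc n) F" and G: "poly_family (Suc k) G" and "n \<le> k"
      and Ps: "\<forall>p\<in>set Ps. poly_family (fst p) (snd p)"
      and sum: "(\<Sum>p\<leftarrow>P. Suc (fst p)) = (\<Sum>p\<leftarrow>(Suc n, F) # (Suc k, G) # Ps. Suc (fst p))"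
    for n k F G Ps
  proof (rule split[OF F])
    show "constructible ({x. coeff (F x) n = 0} \<inter> ?E ((Suc n, F) # (Suc k, G) # Ps))"
      using F G Ps sum by (intro leading_zero) auto
    let ?G = "\<lambda>x. smult (coeff (F x) n) (G x) - monom (coeff (G x) k) (k - n) * F x"
    have "constructible (?E ((Suc n, F) # (k, ?G) # Ps))"
      using F Ps sum poly_family_reduce[OF F G \<open>n \<le> k\<close>] by (intro less.hyps) auto
    moreover have "{x. coeff (F x) n \<noteq> 0} \<inter> ?E ((Suc n, F) # (Suc k, G) # Ps)
        = {x. coeff (F x) n \<noteq> 0} \<inter> ?E ((Suc n, F) # (k, ?G) # Ps)" by auto
    moreover have "constructible {x. coeff (F x) n \<noteq> 0}"
      using F by (intro constructible_nonvanishing) (auto simp: poly_family_def)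
    ultimately show "constructible ({x. coeff (F x) n \<noteq> 0} \<inter> ?E ((Suc n, F) # (Suc k, G) # Ps))"
      by (simp add: constructible_Int)
  qed
  have single: "constructible (?E [(Suc n, F)])"
    if F: "poly_family (Suc n) F" and sum: "(\<Sum>p\<leftarrow>P. Suc (fst p)) = Suc (Suc n)" for n F
  proof (rule split[OF F])
    show "constructible ({x. coeff (F x) n = 0} \<inter> ?E [(Suc n, F)])"
      using F sum by (intro leading_zero) auto
    \<comment> \<open>The exponent \<open>n\<close> suffices because a root of \<open>F\<close> has
      multiplicity at most its degree \<open>n\<close>.\<close>
    obtain M where "poly_family M (\<lambda>x. Q x ^ n)" using poly_family_power[OF assms(1)] by blast
    from pseudo_remainder[OF F this] obtain H where H: "poly_family n H"
      "\<And>x. \<exists>N s. smult (coeff (F x) n ^ N) (Q x ^ n) = s * F x + H x" by blast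
    have "(\<exists>y. poly (F x) y = 0 \<and> poly (Q x) y \<noteq> 0) \<longleftrightarrow> (\<exists>i<n. coeff (H x) i \<noteq> 0)"
      if a: "coeff (F x) n \<noteq> 0" for x
    proof -
      have deg: "degree (F x) = n"
        using a F by (intro antisym degree_le le_degree) (auto simp: poly_family_def)
      have F0: "F x \<noteq> 0" using a by auto
      obtain N s where *: "smult (coeff (F x) n ^ N) (Q x ^ n) = s * F x + H x"
        using H(2) by blast
      have "\<not> (\<exists>y. poly (F x) y = 0 \<and> poly (Q x) y \<noteq> 0) \<longleftrightarrow> F x dvd Q x ^ n"
        using nullstellensatz_univariate[of "F x" "Q x"] F0 deg by auto
      also have "\<dots> \<longleftrightarrow> F x dvd smult (coeff (F x) n ^ N) (Q x ^ n)"
        using a by (simp add: dvd_smult_iff)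
      also have "\<dots> \<longleftrightarrow> F x dvd H x" unfolding * by (simp add: dvd_add_right_iff)
      also have "\<dots> \<longleftrightarrow> H x = 0"
      proof
        assume dvd: "F x dvd H x"
        show "H x = 0"
        proof (rule ccontr)
          assume "H x \<noteq> 0"
          then have "n \<le> degree (H x)" using dvd_imp_degree_le[OF dvd] deg by blast
          then have "coeff (H x) (degree (H x)) = 0" using H(1) by (auto simp: poly_family_def)
          then show False using \<open>H x \<noteq> 0\<close> by simp
        qed
      qed simp
      also have "\<dots> \<longleftrightarrow> \<not> (\<exists>i<n. coeff (H x) i \<noteq> 0)"
        using H(1) by (auto simp: poly_family_def poly_eq_iff) (meson not_le)
      finally show ?thesis by blast
    qed
    then have "{x. coeff (F x) n \<noteq> 0} \<inter> ?E [(Suc n, F)]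
        = {x. coeff (F x) n \<noteq> 0} \<inter> (\<Union>i\<in>{..<n}. {x. coeff (H x) i \<noteq> 0})" by auto
    moreover have "constructible {x. coeff (F x) n \<noteq> 0}"
      using F by (intro constructible_nonvanishing) (auto simp: poly_family_def)
    moreover have "constructible (\<Union>i\<in>{..<n}. {x. coeff (H x) i \<noteq> 0})"
      using H(1) by (intro constructible_UNION constructible_nonvanishing) (auto simp: poly_family_def)
    ultimately show "constructible ({x. coeff (F x) n \<noteq> 0} \<inter> ?E [(Suc n, F)])"
      by (simp add: constructible_Int)
  qed
  have drop0: "constructible (?E (A @ (0, F) # B))"
    if "poly_family 0 F" "P = A @ (0, F) # B" for A F B
  proof -
    have "F x = 0" for x using that(1) by (auto simp: poly_family_def poly_eq_iff)
    then have "?E (A @ (0, F) # B) = ?E (A @ B)" by auto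
    moreover have "constructible (?E (A @ B))"
      using that less.prems by (intro less.hyps) auto
    ultimately show ?thesis by simp
  qed
  show ?case
  proof (cases P)
    case Nil
    have "(\<exists>y. poly (Q x) y \<noteq> 0) \<longleftrightarrow> (\<exists>i<N. coeff (Q x) i \<noteq> 0)" for x
    proof -
      have "\<not> (\<exists>y. poly (Q x) y \<noteq> 0) \<longleftrightarrow> Q x = 0"
        using poly_all_0_iff_0[of "Q x"] by auto
      also have "\<dots> \<longleftrightarrow> \<not> (\<exists>i<N. coeff (Q x) i \<noteq> 0)"
        using assms(1) by (auto simp: poly_family_def poly_eq_iff) (meson not_le)
      finally show ?thesis by blast
    qed
    then have "?E P = (\<Union>i\<in>{..<N}. {x. coeff (Q x) i \<noteq> 0})" using Nil by auto
    then show ?thesis using assms(1)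
      by (auto intro!: constructible_UNION constructible_nonvanishing simp: poly_family_def)
  next
    case (Cons p Ps)
    obtain n F where p: "p = (n, F)" by force
    have F: "poly_family n F" using less.prems Cons p by simp
    show ?thesis
    proof (cases n)
      case 0
      then show ?thesis using drop0[of F "[]" Ps] F Cons p by simp
    next
      case n: (Suc n')
      show ?thesis
      proof (cases Ps)
        case Nil
        then show ?thesis using single[of n' F] F Cons p n by simp
      next
        case Ps: (Cons q Qs)
        obtain k G where q: "q = (k, G)" by force
        have G: "poly_family k G" using less.prems Cons Ps q by simp
        show ?thesis
        proof (cases k)
          case 0
          then show ?thesis using drop0[of G "[p]" Qs] G Cons Ps q by simp
        next
          case k: (Suc k')
          have Qs: "\<forall>p\<in>set Qs. poly_family (fst p) (snd p)" using less.prems Cons Ps by simp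
          show ?thesis
          proof (cases "n' \<le> k'")
            case True
            then show ?thesis using two[of n' F k' G Qs] F G Qs Cons Ps p q n k by simp
          next
            case False
            then have "constructible (?E ((Suc k', G) # (Suc n', F) # Qs))"
              using two[of k' G n' F Qs] F G Qs Cons Ps p q n k by simp
            moreover have "?E ((Suc k', G) # (Suc n', F) # Qs) = ?E P"
              using Cons Ps p q n k by auto
            ultimately show ?thesis by simp
          qed
        qed
      qed
    qed
  qed
qed

end

text \<open>Polynomials are functions of a whole sequence that read only its first \<open>n\<close>
  coordinates. Projection along the last variable is then the update \<open>x(n := y)\<close>, with
  no change of type.\<close>

inductive_set polyfun :: "nat \<Rightarrow> ((nat \<Rightarrow> complex) \<Rightarrow> complex) set" for n where
  const: "(\<lambda>x. c) \<in> polyfun n"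
| coord: "i < n \<Longrightarrow> (\<lambda>x. x i) \<in> polyfun n"
| add: "f \<in> polyfun n \<Longrightarrow> g \<in> polyfun n \<Longrightarrow> (\<lambda>x. f x + g x) \<in> polyfun n"
| mult: "f \<in> polyfun n \<Longrightarrow> g \<in> polyfun n \<Longrightarrow> (\<lambda>x. f x * g x) \<in> polyfun n"

interpretation polys: complex_function_ring "polyfun n"
  by unfold_locales (fact polyfun.const polyfun.add polyfun.mult)+

text \<open>A polynomial in \<open>n + 1\<close> variables is a polynomial in the last one with
  coefficients in the others; this feeds \<open>constructible_solvable\<close>.\<close>

lemma polyfun_Suc_poly_family:
  assumes "f \<in> polyfun (Suc n)"
  shows "\<exists>N F. polys.poly_family n N F \<and> (\<forall>x y. f (x(n := y)) = poly (F x) y)"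
  using assms
proof induction
  case (const c)
  show ?case
    using polys.poly_family_const[OF polyfun.const[of c n]]
    by (intro exI[of _ 1] exI[of _ "\<lambda>x. [:c:]"]) simp
next
  case (coord i)
  show ?case
  proof (cases "i = n")
    case True
    have "polys.poly_family n 2 (\<lambda>x. [:0, 1:])"
      unfolding polys.poly_family_def coeff_pCons
      by (auto intro!: polyfun.const split: nat.splits)
    then show ?thesis using True by (intro exI[of _ 2] exI[of _ "\<lambda>x. [:0, 1:]"]) simp
  next
    case False
    then have "polys.poly_family n 1 (\<lambda>x. [:x i:])"
      using coord by (intro polys.poly_family_const polyfun.intros) auto
    then show ?thesis using False by (intro exI[of _ 1] exI[of _ "\<lambda>x. [:x i:]"]) simp
  qed
next
  case (add f g)
  then obtain N F M G where "polys.poly_family n N F" "\<And>x y. f (x(n := y)) = poly (F x) y"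
    "polys.poly_family n M G" "\<And>x y. g (x(n := y)) = poly (G x) y" by blast
  then show ?case
    by (intro exI[of _ "max N M"] exI[of _ "\<lambda>x. F x + G x"])
      (simp add: polys.poly_family_add del: fun_upd_apply)
next
  case (mult f g)
  then obtain N F M G where "polys.poly_family n N F" "\<And>x y. f (x(n := y)) = poly (F x) y"
    "polys.poly_family n M G" "\<And>x y. g (x(n := y)) = poly (G x) y" by blast
  then show ?case
    by (intro exI[of _ "N + M"] exI[of _ "\<lambda>x. F x * G x"])
      (simp add: polys.poly_family_mult del: fun_upd_apply)
qed

text \<open>Chevalley's theorem for one coordinate. Membership in \<open>C\<close> depends only on
  the set \<open>T\<close> of those members of \<open>Fs\<close> that vanish, and there are finitely
  many such sets. Each fixed \<open>T\<close> gives one system in the last variable: the equations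
  of \<open>T\<close> and the single inequation that the product over \<open>Fs - T\<close> is
  nonzero.\<close>

lemma constructible_projection:
  assumes "polys.constructible (Suc n) C"
  shows "polys.constructible n {x. \<exists>y. x(n := y) \<in> C}"
proof -
  obtain Fs where Fs: "Fs \<subseteq> polyfun (Suc n)" "finite Fs"
    "\<forall>x y. (\<forall>f\<in>Fs. f x = 0 \<longleftrightarrow> f y = 0) \<longrightarrow> (x \<in> C \<longleftrightarrow> y \<in> C)"
    using assms unfolding polys.constructible_def by blast
  have "\<forall>f\<in>Fs. \<exists>N F. polys.poly_family n N F \<and> (\<forall>x y. f (x(n := y)) = poly (F x) y)"
    using polyfun_Suc_poly_family Fs(1) by blast
  then obtain N \<Phi> where \<Phi>: "\<And>f. f \<in> Fs \<Longrightarrow> polys.poly_family n (N f) (\<Phi> f)"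
    "\<And>f x y. f \<in> Fs \<Longrightarrow> f (x(n := y)) = poly (\<Phi> f x) y"
    by metis
  define zeros where "zeros x = {f\<in>Fs. f x = 0}" for x
  define E where "E T = {x. \<exists>y. (\<forall>f\<in>T. f (x(n := y)) = 0) \<and> (\<forall>f\<in>Fs - T. f (x(n := y)) \<noteq> 0)}" for T
  have "{x. \<exists>y. x(n := y) \<in> C} = (\<Union>T\<in>zeros ` C. E T)"
  proof (intro equalityI subsetI)
    fix x assume "x \<in> {x. \<exists>y. x(n := y) \<in> C}"
    then obtain y where "x(n := y) \<in> C" by blast
    then have "zeros (x(n := y)) \<in> zeros ` C" "x \<in> E (zeros (x(n := y)))"
      by (auto simp: zeros_def E_def)
    then show "x \<in> (\<Union>T\<in>zeros ` C. E T)" by blast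
  next
    fix x assume "x \<in> (\<Union>T\<in>zeros ` C. E T)"
    then obtain w y where w: "w \<in> C" "\<forall>f\<in>zeros w. f (x(n := y)) = 0"
      "\<forall>f\<in>Fs - zeros w. f (x(n := y)) \<noteq> 0" by (auto simp: E_def)
    then have "\<forall>f\<in>Fs. f (x(n := y)) = 0 \<longleftrightarrow> f w = 0" by (auto simp: zeros_def)
    then have "x(n := y) \<in> C \<longleftrightarrow> w \<in> C" by (rule Fs(3)[THEN spec, THEN spec, THEN mp])
    then show "x \<in> {x. \<exists>y. x(n := y) \<in> C}" using w(1) by blast
  qed
  moreover have "finite (zeros ` C)"
    by (rule finite_subset[of _ "Pow Fs"]) (auto simp: zeros_def Fs(2))
  moreover have "polys.constructible n (E T)" if "T \<in> zeros ` C" for T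
  proof -
    have T: "T \<subseteq> Fs" using that by (auto simp: zeros_def)
    obtain Ts where Ts: "set Ts = T" using T Fs(2) finite_list finite_subset by metis
    have prod: "\<exists>M. polys.poly_family n M (\<lambda>x. \<Prod>f\<in>G. \<Phi> f x)" if "G \<subseteq> Fs" for G
      using finite_subset[OF that Fs(2)] that
    proof (induction G rule: finite_induct)
      case empty
      show ?case using polys.poly_family_const[OF polyfun.const[of 1 n]]
        by (auto simp: one_pCons[symmetric])
    next
      case (insert f G)
      then obtain M where "polys.poly_family n M (\<lambda>x. \<Prod>f\<in>G. \<Phi> f x)" by auto
      then have "polys.poly_family n (N f + M) (\<lambda>x. \<Phi> f x * (\<Prod>f\<in>G. \<Phi> f x))"
        using insert.prems by (intro polys.poly_family_mult \<Phi>(1)) auto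
      then show ?case using insert.hyps by auto
    qed
    obtain M where M: "polys.poly_family n M (\<lambda>x. \<Prod>f\<in>Fs - T. \<Phi> f x)"
      using prod[of "Fs - T"] by blast
    let ?P = "map (\<lambda>f. (N f, \<Phi> f)) Ts"
    have "polys.constructible n {x. \<exists>y. (\<forall>p\<in>set ?P. poly (snd p x) y = 0) \<and>
        poly (\<Prod>f\<in>Fs - T. \<Phi> f x) y \<noteq> 0}"
      using Ts T \<Phi>(1) by (intro polys.constructible_solvable[OF M]) auto
    also have "{x. \<exists>y. (\<forall>p\<in>set ?P. poly (snd p x) y = 0) \<and>
        poly (\<Prod>f\<in>Fs - T. \<Phi> f x) y \<noteq> 0} = E T"
      unfolding E_def poly_prod using Ts T Fs(2) by (auto simp: \<Phi>(2) subset_iff)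
    finally show ?thesis .
  qed
  ultimately show ?thesis by (simp only: polys.constructible_UNION)
qed

lemma polyfun_1_poly: "f \<in> polyfun 1 \<Longrightarrow> \<exists>p. \<forall>x. f x = poly p (x 0)"
proof (induction rule: polyfun.induct)
  case (const c)
  show ?case by (rule exI[of _ "[:c:]"]) simp
next
  case (coord i)
  then show ?case by (intro exI[of _ "[:0, 1:]"]) simp
next
  case (add f g)
  then show ?case by (metis poly_add)
next
  case (mult f g)
  then show ?case by (metis poly_mult)
qed

text \<open>Projecting away the last coordinate does not change the set of values of coordinate
  \<open>0\<close>, so the claim reduces to one variable, where a nonzero polynomial has finitely
  many roots.\<close>

theorem constructible_line_finite_or_cofinite:
  assumes "polys.constructible (Suc n) C"
  shows "finite {x 0 |x. x \<in> C} \<or> finite (- {x 0 |x. x \<in> C})"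
  using assms
proof (induction n arbitrary: C)
  case 0
  obtain Fs where Fs: "Fs \<subseteq> polyfun 1" "finite Fs"
    "\<forall>x y. (\<forall>f\<in>Fs. f x = 0 \<longleftrightarrow> f y = 0) \<longrightarrow> (x \<in> C \<longleftrightarrow> y \<in> C)"
    using 0 unfolding polys.constructible_def One_nat_def by blast
  have "\<forall>f\<in>Fs. \<exists>p. \<forall>x. f x = poly p (x 0)" using polyfun_1_poly Fs(1) by blast
  then obtain p where p: "\<And>f x. f \<in> Fs \<Longrightarrow> f x = poly (p f) (x 0)" by metis
  \<comment> \<open>Members of \<open>Fs\<close> that are the zero polynomial never separate two
    points; off the roots of the others the vanishing pattern is constant.\<close>
  define B where "B = (\<Union>f\<in>{f\<in>Fs. p f \<noteq> 0}. {z. poly (p f) z = 0})"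
  have "finite B" unfolding B_def using Fs(2) poly_roots_finite by auto
  have generic: "x \<in> C \<longleftrightarrow> y \<in> C" if "x 0 \<notin> B" "y 0 \<notin> B" for x y
  proof (rule Fs(3)[THEN spec, THEN spec, THEN mp], intro ballI)
    fix f assume f: "f \<in> Fs"
    show "(f x = 0) = (f y = 0)"
      using that f by (cases "p f = 0") (auto simp: B_def p)
  qed
  show ?case
  proof (cases "{x 0 |x. x \<in> C} \<subseteq> B")
    case True
    then show ?thesis using \<open>finite B\<close> finite_subset by blast
  next
    case False
    then obtain x where x: "x \<in> C" "x 0 \<notin> B" by blast
    have "- {x 0 |x. x \<in> C} \<subseteq> B"
    proof
      fix z assume z: "z \<in> - {x 0 |x. x \<in> C}"
      then have "(\<lambda>_. z) \<notin> C" by auto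
      then show "z \<in> B" using generic[of x "\<lambda>_. z"] x by auto
    qed
    then show ?thesis using \<open>finite B\<close> finite_subset by blast
  qed
next
  case (Suc n)
  let ?C = "{x. \<exists>y. x(Suc n := y) \<in> C}"
  have "{x 0 |x. x \<in> C} = {x 0 |x. x \<in> ?C}"
  proof (intro equalityI subsetI)
    fix z assume "z \<in> {x 0 |x. x \<in> C}"
    then obtain x where "x \<in> C" "z = x 0" by blast
    then have "x \<in> ?C" "z = x 0" by (auto intro!: exI[of _ "x (Suc n)"])
    then show "z \<in> {x 0 |x. x \<in> ?C}" by blast
  next
    fix z assume "z \<in> {x 0 |x. x \<in> ?C}"
    then obtain x y where "x(Suc n := y) \<in> C" "z = (x(Suc n := y)) 0" by auto
    then show "z \<in> {x 0 |x. x \<in> C}" by blast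
  qed
  then show ?case using Suc.IH[OF constructible_projection[OF Suc.prems]] by simp
qed

section \<open>Solving perturbed linear systems\<close>

lemma sum_of_bool_eq_mult:
  fixes f :: "'b \<Rightarrow> 'a::semiring_1"
  assumes "finite A" "a \<in> A"
  shows "(\<Sum>x\<in>A. of_bool (a = x) * f x) = f a" "(\<Sum>x\<in>A. f x * of_bool (x = a)) = f a"
proof -
  have "A \<inter> {x. a = x} = {a}" "A \<inter> {x. x = a} = {a}" using assms(2) by auto
  then show "(\<Sum>x\<in>A. of_bool (a = x) * f x) = f a" "(\<Sum>x\<in>A. f x * of_bool (x = a)) = f a"
    using assms(1) by (simp_all only: sum_of_bool_mult_eq sum_mult_of_bool_eq) simp_all
qed

text \<open>Rows are added one at a time. The residual \<open>\<rho>\<close> of the new row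
  \<open>r\<close>, obtained by subtracting a combination of the earlier rows, cannot vanish
  identically by independence; a coordinate \<open>i0\<close> where it is nonzero yields the new
  column.\<close>

lemma independent_rows_right_inverse:
  fixes L :: "'j \<Rightarrow> 'i \<Rightarrow> 'a::field"
  assumes "finite I" "finite J"
    and "\<And>w. \<forall>i\<in>I. (\<Sum>j\<in>J. w j * L j i) = 0 \<Longrightarrow> \<forall>j\<in>J. w j = 0"
  shows "\<exists>R. \<forall>j\<in>J. \<forall>l\<in>J. (\<Sum>i\<in>I. L j i * R i l) = of_bool (j = l)"
  using assms(2,3)
proof (induction J rule: finite_induct)
  case empty
  show ?case by simp
next
  case (insert r J)
  have "\<forall>j\<in>J. w j = 0" if "\<forall>i\<in>I. (\<Sum>j\<in>J. w j * L j i) = 0" for w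
  proof -
    let ?w = "w(r := 0)"
    have "(\<Sum>j\<in>insert r J. ?w j * L j i) = (\<Sum>j\<in>J. w j * L j i)" for i
      using insert.hyps by (auto intro!: sum.cong)
    then have "\<forall>j\<in>insert r J. ?w j = 0" using insert.prems[of ?w] that by simp
    then show ?thesis using insert.hyps(2) by (metis fun_upd_other insertCI)
  qed
  then obtain R where R: "\<And>j l. j \<in> J \<Longrightarrow> l \<in> J \<Longrightarrow> (\<Sum>i\<in>I. L j i * R i l) = of_bool (j = l)"
    using insert.IH by blast
  define c where "c l = (\<Sum>i\<in>I. L r i * R i l)" for l
  define \<rho> where "\<rho> i = L r i - (\<Sum>j\<in>J. c j * L j i)" for i
  have "\<exists>i\<in>I. \<rho> i \<noteq> 0"
  proof (rule ccontr)
    assume neg: "\<not> (\<exists>i\<in>I. \<rho> i \<noteq> 0)"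
    let ?w = "(\<lambda>j. - c j)(r := 1)"
    have "(\<Sum>j\<in>insert r J. ?w j * L j i) = \<rho> i" for i
    proof -
      have "(\<Sum>j\<in>J. ?w j * L j i) = (\<Sum>j\<in>J. - (c j * L j i))"
        using insert.hyps by (intro sum.cong) auto
      then show ?thesis using insert.hyps by (simp add: \<rho>_def sum_negf)
    qed
    then have "?w r = 0" using insert.prems[of ?w] neg by simp
    then show False by simp
  qed
  then obtain i0 where i0: "i0 \<in> I" "\<rho> i0 \<noteq> 0" by blast
  \<comment> \<open>The unit vector at \<open>i0\<close> minus its correction through
    \<open>R\<close>: the rows in \<open>J\<close> annihilate it, and division by
    \<open>\<rho> i0\<close> makes its product with row \<open>r\<close> equal to
    \<open>1\<close>.\<close>
  define x where "x i = (of_bool (i = i0) - (\<Sum>j\<in>J. R i j * L j i0)) / \<rho> i0" for i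
  have Lx: "(\<Sum>i\<in>I. L j i * x i) = (L j i0 - (\<Sum>l\<in>J. (\<Sum>i\<in>I. L j i * R i l) * L l i0)) / \<rho> i0" for j
  proof -
    have "(\<Sum>i\<in>I. L j i * x i)
        = (\<Sum>i\<in>I. L j i * of_bool (i = i0) - (\<Sum>l\<in>J. L j i * R i l * L l i0)) / \<rho> i0"
      unfolding x_def sum_divide_distrib
      by (intro sum.cong refl) (simp add: right_diff_distrib sum_distrib_left mult.assoc)
    also have "(\<Sum>i\<in>I. L j i * of_bool (i = i0) - (\<Sum>l\<in>J. L j i * R i l * L l i0))
        = L j i0 - (\<Sum>i\<in>I. \<Sum>l\<in>J. L j i * R i l * L l i0)"
      using sum_of_bool_eq_mult(2)[OF assms(1) i0(1), of "L j"] by (simp only: sum_subtractf)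
    also have "(\<Sum>i\<in>I. \<Sum>l\<in>J. L j i * R i l * L l i0) = (\<Sum>l\<in>J. (\<Sum>i\<in>I. L j i * R i l) * L l i0)"
      by (subst sum.swap) (simp add: sum_distrib_right)
    finally show ?thesis .
  qed
  have x_J: "(\<Sum>i\<in>I. L j i * x i) = 0" if "j \<in> J" for j
  proof -
    have "(\<Sum>l\<in>J. (\<Sum>i\<in>I. L j i * R i l) * L l i0) = (\<Sum>l\<in>J. of_bool (j = l) * L l i0)"
      using R that by (intro sum.cong) auto
    also have "\<dots> = L j i0" by (rule sum_of_bool_eq_mult(1)[OF insert.hyps(1) that])
    finally show ?thesis unfolding Lx by simp
  qed
  have x_r: "(\<Sum>i\<in>I. L r i * x i) = 1"
    unfolding Lx using i0(2) by (simp add: \<rho>_def c_def)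
  define S where "S i l = (if l = r then x i else R i l - x i * c l)" for i l
  have "(\<Sum>i\<in>I. L j i * S i l) = of_bool (j = l)" if "j \<in> insert r J" "l \<in> insert r J" for j l
  proof (cases "l = r")
    case True
    then show ?thesis using that x_J x_r insert.hyps by (auto simp: S_def)
  next
    case False
    have "(\<Sum>i\<in>I. L j i * S i l) = (\<Sum>i\<in>I. L j i * R i l) - (\<Sum>i\<in>I. L j i * x i) * c l"
      using False by (simp add: S_def right_diff_distrib sum_subtractf sum_distrib_right mult.assoc)
    then show ?thesis
      using that x_J x_r R False insert.hyps(2) by (cases "j = r") (auto simp: c_def)
  qed
  then show ?case by blast
qed

text \<open>Banach's fixed point theorem for the maximum norm over \<open>J\<close> with ratio
  \<open>1 / 2\<close>. The bound \<open>s\<close> in the contraction hypothesis takes the place of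
  the norm of a difference, so no normed space of functions has to be set up.\<close>

lemma coordinatewise_contraction_fixpoint:
  fixes T :: "('j \<Rightarrow> complex) \<Rightarrow> 'j \<Rightarrow> complex"
  assumes "r \<ge> 0"
    and ball: "\<And>w j. \<forall>j\<in>J. cmod (w j) \<le> r \<Longrightarrow> j \<in> J \<Longrightarrow> cmod (T w j) \<le> r"
    and contr: "\<And>w w' s j. \<forall>j\<in>J. cmod (w j) \<le> r \<Longrightarrow> \<forall>j\<in>J. cmod (w' j) \<le> r \<Longrightarrow>
      \<forall>j\<in>J. cmod (w j - w' j) \<le> s \<Longrightarrow> j \<in> J \<Longrightarrow> cmod (T w j - T w' j) \<le> s / 2"
  shows "\<exists>w. (\<forall>j\<in>J. cmod (w j) \<le> r) \<and> (\<forall>j\<in>J. T w j = w j)"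
proof -
  define u where "u n = (T ^^ n) (\<lambda>_. 0)" for n
  have u_Suc: "u (Suc n) = T (u n)" for n by (simp add: u_def)
  have u_ball: "\<forall>j\<in>J. cmod (u n j) \<le> r" for n
    using ball \<open>r \<ge> 0\<close> by (induction n) (simp_all add: u_Suc, simp add: u_def)
  have step: "\<forall>j\<in>J. cmod (u (Suc n) j - u n j) \<le> 2 * r / 2 ^ n" for n
  proof (induction n)
    case 0
    show ?case
    proof
      fix j assume "j \<in> J"
      have "cmod (u (Suc 0) j - u 0 j) \<le> cmod (u (Suc 0) j) + cmod (u 0 j)"
        by (rule norm_triangle_ineq4)
      then show "cmod (u (Suc 0) j - u 0 j) \<le> 2 * r / 2 ^ 0"
        using u_ball[of "Suc 0"] u_ball[of 0] \<open>j \<in> J\<close> by fastforce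
    qed
  next
    case (Suc n)
    then show ?case
      using contr[OF u_ball u_ball Suc.IH] by (simp add: u_Suc field_simps)
  qed
  have conv: "\<exists>l. (\<lambda>n. u n j) \<longlonglongrightarrow> l" if "j \<in> J" for j
  proof -
    have "summable (\<lambda>n. 2 * r * (1 / 2) ^ n)" by (intro summable_mult summable_geometric) simp
    then have "summable (\<lambda>n. u (Suc n) j - u n j)"
      using step that by (rule_tac summable_comparison_test') (auto simp: power_one_over field_simps)
    then have "(\<lambda>n. (u n j - u 0 j) + u 0 j) \<longlonglongrightarrow> (\<Sum>n. u (Suc n) j - u n j) + u 0 j"
      unfolding summable_sums_iff sums_def by (intro tendsto_intros) (simp only: sum_lessThan_telescope[of "\<lambda>n. u n j"])
    then show ?thesis by auto
  qed
  then obtain w where w: "\<And>j. j \<in> J \<Longrightarrow> (\<lambda>n. u n j) \<longlonglongrightarrow> w j" by metis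
  have w_ball: "\<forall>j\<in>J. cmod (w j) \<le> r"
  proof
    fix j assume "j \<in> J"
    then show "cmod (w j) \<le> r"
      using u_ball by (intro LIMSEQ_le_const2[OF tendsto_norm[OF w]]) auto
  qed
  \<comment> \<open>Geometric tail: the steps from \<open>n\<close> onwards add up to at most
    \<open>4 * r / 2 ^ n\<close>.\<close>
  have err: "cmod (u n j - w j) \<le> 4 * r / 2 ^ n" if "j \<in> J" for n j
  proof -
    have "cmod (u n j - u (n + p) j) \<le> 4 * r / 2 ^ n - 4 * r / 2 ^ (n + p)" for p
    proof (induction p)
      case (Suc p)
      have "cmod (u n j - u (n + Suc p) j)
          \<le> cmod (u n j - u (n + p) j) + cmod (u (Suc (n + p)) j - u (n + p) j)"
        using norm_triangle_ineq4[of "u n j - u (n + p) j" "u (Suc (n + p)) j - u (n + p) j"] by simp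
      also have "\<dots> \<le> (4 * r / 2 ^ n - 4 * r / 2 ^ (n + p)) + 2 * r / 2 ^ (n + p)"
        using Suc step that by (intro add_mono) auto
      also have "\<dots> = 4 * r / 2 ^ n - 4 * r / 2 ^ (n + Suc p)" by (simp add: field_simps)
      finally show ?case .
    qed simp
    moreover have "4 * r / 2 ^ n - 4 * r / 2 ^ (n + p) \<le> 4 * r / 2 ^ n" for p
      using \<open>r \<ge> 0\<close> by simp
    ultimately have "cmod (u n j - u (n + p) j) \<le> 4 * r / 2 ^ n" for p
      using order_trans by blast
    moreover have "(\<lambda>p. cmod (u n j - u (n + p) j)) \<longlonglongrightarrow> cmod (u n j - w j)"
      using LIMSEQ_ignore_initial_segment[OF w[OF that], of n]
      by (intro tendsto_intros) (simp add: add.commute)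
    ultimately show ?thesis by (intro LIMSEQ_le_const2) auto
  qed
  have "T w j = w j" if "j \<in> J" for j
  proof -
    have "(\<lambda>n. T w j - u (Suc n) j) \<longlonglongrightarrow> 0"
    proof (rule tendsto_norm_zero_cancel, rule tendsto_sandwich)
      show "(\<lambda>_. 0) \<longlonglongrightarrow> (0::real)" "\<forall>\<^sub>F n in sequentially. 0 \<le> cmod (T w j - u (Suc n) j)"
        by simp_all
      have "cmod (T w j - u (Suc n) j) \<le> 4 * r / 2 ^ n / 2" for n
        unfolding u_Suc using err that
        by (intro contr[OF w_ball u_ball]) (auto simp: norm_minus_commute)
      then show "\<forall>\<^sub>F n in sequentially. cmod (T w j - u (Suc n) j) \<le> 2 * r * (1 / 2) ^ n"
        by (intro always_eventually allI) (simp add: power_one_over field_simps)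
      show "(\<lambda>n. 2 * r * (1 / 2) ^ n) \<longlonglongrightarrow> 0"
        by (intro tendsto_mult_right_zero LIMSEQ_power_zero) simp
    qed
    moreover have "(\<lambda>n. T w j - u (Suc n) j) \<longlonglongrightarrow> T w j - w j"
      by (intro tendsto_intros LIMSEQ_Suc w that)
    ultimately show ?thesis using LIMSEQ_unique by fastforce
  qed
  then show ?thesis using w_ball by blast
qed

text \<open>A contraction version of the implicit function theorem. With a right inverse
  \<open>R\<close> of \<open>L\<close> and \<open>y = R w\<close>, the equations become the fixed
  point problem \<open>w = - N (R w) z\<close>. The hypothesis \<open>lip\<close> gives
  \<open>N\<close> a small Lipschitz constant near the origin, and \<open>zero\<close> makes its
  value at \<open>y = 0\<close> small.\<close>

lemma solvable_near_zero:
  fixes L :: "'j \<Rightarrow> 'i \<Rightarrow> complex" and N :: "('i \<Rightarrow> complex) \<Rightarrow> complex \<Rightarrow> 'j \<Rightarrow> complex"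
  assumes fin: "finite I" "finite J"
    and indep: "\<And>w. \<forall>i\<in>I. (\<Sum>j\<in>J. w j * L j i) = 0 \<Longrightarrow> \<forall>j\<in>J. w j = 0"
    and lip: "\<And>\<eta>. \<eta> > 0 \<Longrightarrow> \<exists>\<delta>>0. \<forall>z y y' s. cmod z \<le> \<delta> \<longrightarrow> (\<forall>i\<in>I. cmod (y i) \<le> \<delta>) \<longrightarrow>
      (\<forall>i\<in>I. cmod (y' i) \<le> \<delta>) \<longrightarrow> (\<forall>i\<in>I. cmod (y i - y' i) \<le> s) \<longrightarrow> s \<ge> 0 \<longrightarrow>
      (\<forall>j\<in>J. cmod (N y z j - N y' z j) \<le> \<eta> * s)"
    and zero: "\<And>\<eta>. \<eta> > 0 \<Longrightarrow> \<exists>\<delta>>0. \<forall>z. cmod z \<le> \<delta> \<longrightarrow> (\<forall>j\<in>J. cmod (N (\<lambda>_. 0) z j) \<le> \<eta>)"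
  shows "\<exists>\<epsilon>>0. \<forall>z. cmod z < \<epsilon> \<longrightarrow> (\<exists>y. \<forall>j\<in>J. (\<Sum>i\<in>I. L j i * y i) + N y z j = 0)"
proof -
  obtain R where R: "\<And>j l. j \<in> J \<Longrightarrow> l \<in> J \<Longrightarrow> (\<Sum>i\<in>I. L j i * R i l) = of_bool (j = l)"
    using independent_rows_right_inverse[OF fin indep] by blast
  define C where "C = 1 + (\<Sum>i\<in>I. \<Sum>j\<in>J. cmod (R i j))"
  have C: "C \<ge> 1" unfolding C_def by (simp add: sum_nonneg)
  define Y where "Y w i = (\<Sum>j\<in>J. R i j * w j)" for w :: "'j \<Rightarrow> complex" and i
  have Y_bound: "cmod (Y w i) \<le> C * s" if "\<forall>j\<in>J. cmod (w j) \<le> s" "i \<in> I" "s \<ge> 0" for w i s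
  proof -
    have "cmod (Y w i) \<le> (\<Sum>j\<in>J. cmod (R i j) * s)"
      unfolding Y_def using that by (intro sum_norm_le) (auto simp: norm_mult intro: mult_left_mono)
    also have "\<dots> = (\<Sum>j\<in>J. cmod (R i j)) * s" by (simp add: sum_distrib_right)
    also have "(\<Sum>j\<in>J. cmod (R i j)) \<le> (\<Sum>i\<in>I. \<Sum>j\<in>J. cmod (R i j))"
      using that fin by (intro member_le_sum) (auto intro: sum_nonneg)
    then have "(\<Sum>j\<in>J. cmod (R i j)) * s \<le> C * s"
      using that by (intro mult_right_mono) (auto simp: C_def)
    finally show ?thesis .
  qed
  have Y_diff: "Y w i - Y w' i = Y (\<lambda>j. w j - w' j) i" for w w' i
    by (simp add: Y_def right_diff_distrib sum_subtractf)
  have LY: "(\<Sum>i\<in>I. L j i * Y w i) = w j" if "j \<in> J" for w j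
  proof -
    have "(\<Sum>i\<in>I. L j i * Y w i) = (\<Sum>l\<in>J. (\<Sum>i\<in>I. L j i * R i l) * w l)"
      unfolding Y_def sum_distrib_left sum_distrib_right by (subst sum.swap) (simp add: mult.assoc)
    also have "\<dots> = (\<Sum>l\<in>J. of_bool (j = l) * w l)" using R that by (intro sum.cong) auto
    also have "\<dots> = w j" by (rule sum_of_bool_eq_mult(1)[OF fin(2) that])
    finally show ?thesis .
  qed
  \<comment> \<open>Passing from \<open>w\<close> to \<open>Y w\<close> expands by at most
    \<open>C\<close>, so the Lipschitz constant \<open>1 / (2 * C)\<close> of \<open>N\<close> gives
    the ratio \<open>1 / 2\<close>.\<close>
  obtain \<delta> where \<delta>: "\<delta> > 0" "\<And>z y y' s j. cmod z \<le> \<delta> \<Longrightarrow> (\<forall>i\<in>I. cmod (y i) \<le> \<delta>) \<Longrightarrow>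
      (\<forall>i\<in>I. cmod (y' i) \<le> \<delta>) \<Longrightarrow> (\<forall>i\<in>I. cmod (y i - y' i) \<le> s) \<Longrightarrow> s \<ge> 0 \<Longrightarrow> j \<in> J \<Longrightarrow>
      cmod (N y z j - N y' z j) \<le> 1 / (2 * C) * s"
  proof -
    have "1 / (2 * C) > 0" using C by simp
    from lip[OF this] show ?thesis using that by blast
  qed
  define r where "r = \<delta> / C"
  have r: "r > 0" "C * r = \<delta>" using \<delta>(1) C by (auto simp: r_def)
  obtain \<epsilon> where \<epsilon>: "\<epsilon> > 0" "\<And>z j. cmod z \<le> \<epsilon> \<Longrightarrow> j \<in> J \<Longrightarrow> cmod (N (\<lambda>_. 0) z j) \<le> r / 2"
  proof -
    have "r / 2 > 0" using r(1) by simp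
    from zero[OF this] show ?thesis using that by blast
  qed
  have "\<exists>y. \<forall>j\<in>J. (\<Sum>i\<in>I. L j i * y i) + N y z j = 0" if z: "cmod z < min \<delta> \<epsilon>" for z
  proof -
    define T where "T w j = - N (Y w) z j" for w j
    have contr: "cmod (T w j - T w' j) \<le> s / 2"
      if "\<forall>j\<in>J. cmod (w j) \<le> r" "\<forall>j\<in>J. cmod (w' j) \<le> r" "\<forall>j\<in>J. cmod (w j - w' j) \<le> s" "j \<in> J"
      for w w' s j
    proof -
      have s: "s \<ge> 0" using that(3,4) norm_ge_zero order_trans by blast
      have "cmod (N (Y w) z j - N (Y w') z j) \<le> 1 / (2 * C) * (C * s)"
        using that z s r C Y_bound[of w r] Y_bound[of w' r] Y_bound[of "\<lambda>j. w j - w' j" s]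
        by (intro \<delta>(2)) (auto simp: Y_diff)
      then show ?thesis using C by (simp add: T_def norm_minus_commute)
    qed
    have "\<exists>w. (\<forall>j\<in>J. cmod (w j) \<le> r) \<and> (\<forall>j\<in>J. T w j = w j)"
    proof (rule coordinatewise_contraction_fixpoint)
      fix w j assume w: "\<forall>j\<in>J. cmod (w j) \<le> r" and j: "j \<in> J"
      have Y0: "Y (\<lambda>_. 0) = (\<lambda>_. 0)" by (simp add: Y_def fun_eq_iff)
      have "cmod (T w j - T (\<lambda>_. 0) j) \<le> r / 2" using w j r by (intro contr) auto
      moreover have "cmod (T (\<lambda>_. 0) j) \<le> r / 2" using \<epsilon>(2)[of z j] z j by (simp add: T_def Y0)
      ultimately show "cmod (T w j) \<le> r"
        using norm_triangle_ineq[of "T w j - T (\<lambda>_. 0) j" "T (\<lambda>_. 0) j"] by simp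
    qed (use r contr in auto)
    then obtain w where "\<And>j. j \<in> J \<Longrightarrow> T w j = w j" by blast
    then have "\<forall>j\<in>J. (\<Sum>i\<in>I. L j i * Y w i) + N (Y w) z j = 0" by (auto simp: LY T_def add_eq_0_iff2)
    then show ?thesis by blast
  qed
  then show ?thesis using \<delta>(1) \<epsilon>(1) by (intro exI[of _ "min \<delta> \<epsilon>"]) auto
qed

section \<open>Flags along a pencil\<close>

text \<open>The free entries lie between strictly increasing levels of \<open>w\<close>. They
  complement the stabilizer of the flag spanned by the coordinates of high \<open>w\<close>, so
  \<open>y\<close> is an affine chart around that flag.\<close>

definition unipotent :: "(nat \<Rightarrow> real) \<Rightarrow> (nat \<Rightarrow> nat \<Rightarrow> complex) \<Rightarrow> nat \<Rightarrow> nat \<Rightarrow> complex" where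
  "unipotent w y a c = of_bool (a = c) + (if w a < w c then y a c else 0)"

text \<open>Expansion of \<open>(1 + E) X (1 + F)\<close>: the two middle terms are the
  linearization in the unknowns \<open>E\<close> and \<open>F\<close>, the last one is
  quadratic.\<close>

lemma sum_diagonal_plus:
  fixes E F X :: "nat \<Rightarrow> nat \<Rightarrow> complex"
  assumes "a < d" "b < k"
  shows "(\<Sum>p<d. \<Sum>s<k. (of_bool (a = p) + E a p) * X p s * (of_bool (s = b) + F s b))
    = X a b + (\<Sum>p<d. E a p * X p b) + (\<Sum>s<k. X a s * F s b) + (\<Sum>p<d. \<Sum>s<k. E a p * X p s * F s b)"
proof -
  have "(\<Sum>s<k. (of_bool (a = p) + E a p) * X p s * (of_bool (s = b) + F s b))
      = of_bool (a = p) * X p b + E a p * X p b + of_bool (a = p) * (\<Sum>s<k. X p s * F s b)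
        + (\<Sum>s<k. E a p * X p s * F s b)" for p
  proof -
    have "(\<Sum>s<k. (of_bool (a = p) + E a p) * X p s * (of_bool (s = b) + F s b))
        = (\<Sum>s<k. (of_bool (a = p) + E a p) * X p s * of_bool (s = b))
          + (of_bool (a = p) * (\<Sum>s<k. X p s * F s b) + (\<Sum>s<k. E a p * X p s * F s b))"
      unfolding sum_distrib_left sum.distrib[symmetric]
      by (intro sum.cong refl) (simp add: algebra_simps)
    also have "(\<Sum>s<k. (of_bool (a = p) + E a p) * X p s * of_bool (s = b))
        = (of_bool (a = p) + E a p) * X p b"
      using assms(2) by (intro sum_of_bool_eq_mult(2)) auto
    finally show ?thesis by (simp add: algebra_simps)
  qed
  moreover have "(\<Sum>p<d. of_bool (a = p) * X p b) = X a b"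
    using assms(1) by (intro sum_of_bool_eq_mult(1)) auto
  moreover have "(\<Sum>p<d. of_bool (a = p) * (\<Sum>s<k. X p s * F s b)) = (\<Sum>s<k. X a s * F s b)"
    using assms(1) by (intro sum_of_bool_eq_mult(1)) auto
  ultimately show ?thesis by (simp add: sum.distrib)
qed

text \<open>Writing \<open>G\<close>, \<open>H\<^sub>i\<close> for the unipotent matrices built from \<open>y\<close>, this says that the entries of
  \<open>G (X\<^sub>i + z D\<^sub>i) H\<^sub>i\<close> at positions with \<open>lam a < mu i b\<close> vanish. Geometrically: the flag
  obtained from the coordinate flag \<open>lam \<ge> c\<close> by applying \<open>G\<^sup>-\<^sup>1\<close> meets the range of \<open>X\<^sub>i + z D\<^sub>i\<close> at least
  in the dimensions prescribed by \<open>mu i\<close>.\<close>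

definition pencil_certificate ::
  "nat \<Rightarrow> nat \<Rightarrow> (nat \<Rightarrow> nat) \<Rightarrow> (nat \<Rightarrow> real) \<Rightarrow> (nat \<Rightarrow> nat \<Rightarrow> real) \<Rightarrow> (nat \<Rightarrow> nat \<Rightarrow> nat \<Rightarrow> complex)
    \<Rightarrow> (nat \<Rightarrow> nat \<Rightarrow> nat \<Rightarrow> complex) \<Rightarrow> complex \<Rightarrow> (nat \<times> nat + nat \<times> nat \<times> nat \<Rightarrow> complex) \<Rightarrow> bool" where
  "pencil_certificate m d k lam mu X D z y \<longleftrightarrow> (\<forall>i<m. \<forall>a<d. \<forall>b<k i. lam a < mu i b \<longrightarrow>
    (\<Sum>p<d. \<Sum>s<k i. unipotent lam (\<lambda>p s. y (Inl (p, s))) a p * (X i p s + z * D i p s)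
      * unipotent (mu i) (\<lambda>p s. y (Inr (i, p, s))) s b) = 0)"

text \<open>At \<open>z = 0\<close>, \<open>y = 0\<close> the equations hold by \<open>supp\<close>.
  Their linear part sends the unknowns \<open>E\<close>, \<open>F_i\<close> to the entries of
  \<open>E X_i + X_i F_i\<close> at the positions with \<open>lam a < mu i b\<close>. A linear
  relation \<open>w\<close> among these equations, conjugated, is a family \<open>Y\<close> on the
  same positions such that the \<open>Y_i X_i^*\<close> sum to zero and each
  \<open>X_i^* Y_i\<close> vanishes. So \<open>rigid\<close> is the surjectivity that
  \<open>solvable_near_zero\<close> asks for.\<close>

lemma unipotent_certificate_near_zero:
  fixes X D :: "nat \<Rightarrow> nat \<Rightarrow> nat \<Rightarrow> complex" and lam :: "nat \<Rightarrow> real" and mu :: "nat \<Rightarrow> nat \<Rightarrow> real"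
  assumes supp: "\<And>i a b. i < m \<Longrightarrow> a < d \<Longrightarrow> b < k i \<Longrightarrow> X i a b \<noteq> 0 \<Longrightarrow> lam a = mu i b"
    and rigid: "\<And>Y :: nat \<Rightarrow> nat \<Rightarrow> nat \<Rightarrow> complex.
      (\<And>i a b. i < m \<Longrightarrow> a < d \<Longrightarrow> b < k i \<Longrightarrow> Y i a b \<noteq> 0 \<Longrightarrow> lam a < mu i b) \<Longrightarrow>
      (\<And>a c. a < d \<Longrightarrow> c < d \<Longrightarrow> (\<Sum>i<m. \<Sum>b<k i. Y i a b * cnj (X i c b)) = 0) \<Longrightarrow>
      (\<And>i c b. i < m \<Longrightarrow> c < k i \<Longrightarrow> b < k i \<Longrightarrow> (\<Sum>a<d. cnj (X i a c) * Y i a b) = 0) \<Longrightarrow>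
      \<forall>i<m. \<forall>a<d. \<forall>b<k i. Y i a b = 0"
  shows "\<exists>\<epsilon>>0. \<forall>z. cmod z < \<epsilon> \<longrightarrow> (\<exists>y. pencil_certificate m d k lam mu X D z y)"
proof -
  define K where "K = (SIGMA i:{..<m}. {..<d} \<times> {..<k i})"
  define J where "J = {x\<in>K. case x of (i, a, b) \<Rightarrow> lam a < mu i b}"
  define I1 where "I1 = {x\<in>{..<d} \<times> {..<d}. case x of (p, s) \<Rightarrow> lam p < lam s}"
  define K2 where "K2 = (SIGMA i:{..<m}. {..<k i} \<times> {..<k i})"
  define I2 where "I2 = {x\<in>K2. case x of (i, s, t) \<Rightarrow> mu i s < mu i t}"
  define E where "E y a p = (if lam a < lam p then y (Inl (a, p)) else 0)"
    for y :: "nat \<times> nat + nat \<times> nat \<times> nat \<Rightarrow> complex" and a p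
  define F where "F y i s b = (if mu i s < mu i b then y (Inr (i, s, b)) else 0)"
    for y :: "nat \<times> nat + nat \<times> nat \<times> nat \<Rightarrow> complex" and i s b
  \<comment> \<open>\<open>L\<close> is the linear part in the unknowns; \<open>N\<close> collects
    the quadratic term \<open>E X F\<close> and everything multiplied by \<open>z\<close>.\<close>
  define L where "L j \<iota> = (case j of (i, a, b) \<Rightarrow> case \<iota> of
      Inl (p, s) \<Rightarrow> of_bool (a = p) * X i s b
    | Inr (q, s, t) \<Rightarrow> of_bool (i = q \<and> b = t) * X i a s)" for j \<iota>
  define N where "N y z j = (case j of (i, a, b) \<Rightarrow>
      (\<Sum>p<d. \<Sum>s<k i. E y a p * X i p s * F y i s b)
      + z * (\<Sum>p<d. \<Sum>s<k i. (of_bool (a = p) + E y a p) * D i p s * (of_bool (s = b) + F y i s b)))"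
    for y z j
  have fin: "finite K" "finite J" "finite I1" "finite K2" "finite I2" "finite (I1 <+> I2)"
    by (auto simp: K_def J_def I1_def K2_def I2_def)
  have sumJ: "(\<Sum>x\<in>J. f x) = (\<Sum>i<m. \<Sum>a<d. \<Sum>b<k i. if lam a < mu i b then f (i, a, b) else 0)"
    for f :: "_ \<Rightarrow> complex"
  proof -
    have "(\<Sum>x\<in>J. f x) = (\<Sum>x\<in>K. if (case x of (i, a, b) \<Rightarrow> lam a < mu i b) then f x else 0)"
      unfolding J_def using fin(1) by (rule sum.inter_filter)
    also have "\<dots> = (\<Sum>i<m. \<Sum>a<d. \<Sum>b<k i. if lam a < mu i b then f (i, a, b) else 0)"
      unfolding K_def by (simp add: sum.Sigma sum.cartesian_product case_prod_unfold cong: if_cong)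
    finally show ?thesis .
  qed
  have L_sum: "(\<Sum>\<iota>\<in>I1 <+> I2. L (i, a, b) \<iota> * y \<iota>)
      = (\<Sum>p<d. E y a p * X i p b) + (\<Sum>s<k i. X i a s * F y i s b)"
    if "i < m" "a < d" "b < k i" for i a b y
  proof -
    have "(\<Sum>x\<in>I1. L (i, a, b) (Inl x) * y (Inl x))
        = (\<Sum>p<d. \<Sum>s<d. if lam p < lam s then of_bool (a = p) * X i s b * y (Inl (p, s)) else 0)"
    proof -
      have "(\<Sum>x\<in>I1. L (i, a, b) (Inl x) * y (Inl x)) = (\<Sum>x\<in>{..<d} \<times> {..<d}.
          if (case x of (p, s) \<Rightarrow> lam p < lam s) then L (i, a, b) (Inl x) * y (Inl x) else 0)"
        unfolding I1_def by (rule sum.inter_filter) simp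
      then show ?thesis
        by (simp add: sum.cartesian_product case_prod_unfold L_def cong: if_cong)
    qed
    also have "\<dots> = (\<Sum>p<d. of_bool (a = p) * (\<Sum>s<d. E y p s * X i s b))"
      unfolding sum_distrib_left by (intro sum.cong refl) (auto simp: E_def)
    also have "\<dots> = (\<Sum>p<d. E y a p * X i p b)"
      using that by (intro sum_of_bool_eq_mult(1)) auto
    finally have 1: "(\<Sum>x\<in>I1. L (i, a, b) (Inl x) * y (Inl x)) = (\<Sum>p<d. E y a p * X i p b)" .
    have "(\<Sum>x\<in>I2. L (i, a, b) (Inr x) * y (Inr x))
        = (\<Sum>q<m. \<Sum>s<k q. \<Sum>t<k q. if mu q s < mu q t
             then of_bool (i = q \<and> b = t) * X i a s * y (Inr (q, s, t)) else 0)"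
    proof -
      have "(\<Sum>x\<in>I2. L (i, a, b) (Inr x) * y (Inr x)) = (\<Sum>x\<in>K2.
          if (case x of (q, s, t) \<Rightarrow> mu q s < mu q t) then L (i, a, b) (Inr x) * y (Inr x) else 0)"
        unfolding I2_def using fin(4) by (rule sum.inter_filter)
      then show ?thesis unfolding K2_def
        by (simp add: sum.Sigma sum.cartesian_product case_prod_unfold L_def cong: if_cong)
    qed
    also have "\<dots> = (\<Sum>q<m. of_bool (i = q) * (\<Sum>s<k q. X i a s * (\<Sum>t<k q. of_bool (b = t) * F y q s t)))"
      unfolding sum_distrib_left by (intro sum.cong refl) (auto simp: F_def)
    also have "\<dots> = (\<Sum>s<k i. X i a s * (\<Sum>t<k i. of_bool (b = t) * F y i s t))"
      using that by (intro sum_of_bool_eq_mult(1)) auto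
    also have "\<dots> = (\<Sum>s<k i. X i a s * F y i s b)"
      using that by (intro sum.cong refl arg_cong2[of _ _ _ _ "(*)"] sum_of_bool_eq_mult(1)) auto
    finally show ?thesis using 1 fin by (simp add: sum.Plus)
  qed
  have zero_X: "X i a b = 0" if "i < m" "a < d" "b < k i" "lam a < mu i b" for i a b
    using supp[OF that(1-3)] that(4) by auto
  have "\<exists>\<epsilon>>0. \<forall>z. cmod z < \<epsilon> \<longrightarrow> (\<exists>y. \<forall>j\<in>J. (\<Sum>\<iota>\<in>I1 <+> I2. L j \<iota> * y \<iota>) + N y z j = 0)"
  proof (rule solvable_near_zero)
    show "finite (I1 <+> I2)" "finite J" by (fact fin)+
  next
    fix w assume w: "\<forall>\<iota>\<in>I1 <+> I2. (\<Sum>j\<in>J. w j * L j \<iota>) = 0"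
    \<comment> \<open>Conjugation turns the bilinear relations for \<open>w\<close> into the
      sesquilinear hypotheses of \<open>rigid\<close>.\<close>
    define Y where "Y i a b = (if lam a < mu i b then cnj (w (i, a, b)) else 0)" for i a b
    have "\<forall>i<m. \<forall>a<d. \<forall>b<k i. Y i a b = 0"
    proof (rule rigid)
      fix a c assume ac: "a < d" "c < d"
      have "cnj (\<Sum>i<m. \<Sum>b<k i. Y i a b * cnj (X i c b)) = 0"
      proof (cases "lam a < lam c")
        case True
        then have "Inl (a, c) \<in> I1 <+> I2" using ac by (auto simp: I1_def)
        then have "(\<Sum>j\<in>J. w j * L j (Inl (a, c))) = 0" using w by blast
        then have "0 = (\<Sum>i<m. \<Sum>p<d. \<Sum>b<k i. if lam p < mu i b then w (i, p, b) * (of_bool (p = a) * X i c b) else 0)"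
          by (simp add: sumJ L_def cong: if_cong)
        also have "\<dots> = (\<Sum>i<m. \<Sum>p<d. of_bool (a = p) * (\<Sum>b<k i. cnj (Y i p b) * X i c b))"
          unfolding sum_distrib_left by (intro sum.cong refl) (auto simp: Y_def)
        also have "\<dots> = (\<Sum>i<m. \<Sum>b<k i. cnj (Y i a b) * X i c b)"
          using ac by (intro sum.cong refl sum_of_bool_eq_mult(1)) auto
        finally show ?thesis by simp
      next
        \<comment> \<open>No unknown sits at \<open>(a, c)\<close>, but every product vanishes
          anyway: \<open>X i c b \<noteq> 0\<close> forces \<open>lam c = mu i b\<close>, and then
          \<open>Y i a b \<noteq> 0\<close> would need \<open>lam a < lam c\<close>.\<close>
        case False
        have "Y i a b * cnj (X i c b) = 0" if "i < m" "b < k i" for i b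
          using supp[OF that(1) ac(2) that(2)] False by (cases "X i c b = 0") (auto simp: Y_def)
        then have "(\<Sum>i<m. \<Sum>b<k i. Y i a b * cnj (X i c b)) = 0" by (intro sum.neutral ballI) blast
        then show ?thesis by simp
      qed
      then show "(\<Sum>i<m. \<Sum>b<k i. Y i a b * cnj (X i c b)) = 0" by (simp only: complex_cnj_zero_iff)
    next
      fix i c b assume i: "i < m" "c < k i" "b < k i"
      have "cnj (\<Sum>a<d. cnj (X i a c) * Y i a b) = 0"
      proof (cases "mu i c < mu i b")
        case True
        then have "Inr (i, c, b) \<in> I1 <+> I2" using i by (auto simp: I2_def K2_def)
        then have "(\<Sum>j\<in>J. w j * L j (Inr (i, c, b))) = 0" using w by blast
        then have "0 = (\<Sum>q<m. \<Sum>a<d. \<Sum>t<k q. if lam a < mu q t then w (q, a, t) * (of_bool (q = i \<and> t = b) * X q a c) else 0)"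
          by (simp add: sumJ L_def cong: if_cong)
        also have "\<dots> = (\<Sum>q<m. of_bool (i = q) * (\<Sum>a<d. \<Sum>t<k q. of_bool (b = t) * (X q a c * cnj (Y q a t))))"
          unfolding sum_distrib_left by (intro sum.cong refl) (auto simp: Y_def)
        also have "\<dots> = (\<Sum>a<d. \<Sum>t<k i. of_bool (b = t) * (X i a c * cnj (Y i a t)))"
          using i by (intro sum_of_bool_eq_mult(1)) auto
        also have "\<dots> = (\<Sum>a<d. X i a c * cnj (Y i a b))"
          using i by (intro sum.cong refl sum_of_bool_eq_mult(1)) auto
        finally show ?thesis by simp
      next
        case False
        have "cnj (X i a c) * Y i a b = 0" if "a < d" for a
          using supp[OF i(1) that i(2)] False by (cases "X i a c = 0") (auto simp: Y_def)
        then have "(\<Sum>a<d. cnj (X i a c) * Y i a b) = 0" by (intro sum.neutral ballI) blast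
        then show ?thesis by simp
      qed
      then show "(\<Sum>a<d. cnj (X i a c) * Y i a b) = 0" by (simp only: complex_cnj_zero_iff)
    qed (auto simp: Y_def split: if_splits)
    then show "\<forall>j\<in>J. w j = 0" by (force simp: J_def K_def Y_def)
  next
    fix \<eta> :: real assume \<eta>: "\<eta> > 0"
    define C where "C = 1 + (\<Sum>i<m. \<Sum>p<d. \<Sum>s<k i. cmod (X i p s) + cmod (D i p s))"
    have C: "C \<ge> 1" unfolding C_def by (simp add: sum_nonneg)
    have C_bound: "(\<Sum>p<d. \<Sum>s<k i. cmod (X i p s) + cmod (D i p s)) \<le> C" if "i < m" for i
    proof -
      have "(\<Sum>p<d. \<Sum>s<k i. cmod (X i p s) + cmod (D i p s))
          \<le> (\<Sum>i<m. \<Sum>p<d. \<Sum>s<k i. cmod (X i p s) + cmod (D i p s))"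
        using that by (intro member_le_sum[where f = "\<lambda>i. \<Sum>p<d. \<Sum>s<k i. cmod (X i p s) + cmod (D i p s)"])
          (auto intro!: sum_nonneg add_nonneg_nonneg)
      then show ?thesis by (simp add: C_def)
    qed
    \<comment> \<open>The factor \<open>4 * C\<close> comes from the estimate
      \<open>4 * \<delta> * s\<close> per entry below, summed against the weights in
      \<open>C\<close>; \<open>\<delta> \<le> 1\<close> keeps the entries of \<open>1 + E\<close>
      and \<open>1 + F\<close> within \<open>2\<close>.\<close>
    define \<delta> where "\<delta> = min 1 (\<eta> / (4 * C))"
    have \<delta>: "\<delta> > 0" "\<delta> \<le> 1" "4 * \<delta> * C \<le> \<eta>" using C \<eta> by (auto simp: \<delta>_def min_def field_simps)
    have "cmod (N y z j - N y' z j) \<le> \<eta> * s"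
      if z: "cmod z \<le> \<delta>" and y: "\<forall>\<iota>\<in>I1 <+> I2. cmod (y \<iota>) \<le> \<delta>" "\<forall>\<iota>\<in>I1 <+> I2. cmod (y' \<iota>) \<le> \<delta>"
        "\<forall>\<iota>\<in>I1 <+> I2. cmod (y \<iota> - y' \<iota>) \<le> s" and s: "s \<ge> 0" and j: "j \<in> J" for z y y' s j
    proof -
      obtain i a b where j': "j = (i, a, b)" "i < m" "a < d" "b < k i"
        using j by (auto simp: J_def K_def)
      have E: "cmod (E y a p) \<le> \<delta>" "cmod (E y' a p) \<le> \<delta>" "cmod (E y a p - E y' a p) \<le> s"
        if "p < d" for p
      proof -
        have "Inl (a, p) \<in> I1 <+> I2" if "lam a < lam p" using that \<open>p < d\<close> j' by (auto simp: I1_def)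
        then show "cmod (E y a p) \<le> \<delta>" "cmod (E y' a p) \<le> \<delta>" "cmod (E y a p - E y' a p) \<le> s"
          using y \<delta> s by (auto simp: E_def)
      qed
      have F: "cmod (F y i p b) \<le> \<delta>" "cmod (F y' i p b) \<le> \<delta>" "cmod (F y i p b - F y' i p b) \<le> s"
        if "p < k i" for p
      proof -
        have "Inr (i, p, b) \<in> I1 <+> I2" if "mu i p < mu i b"
          using that \<open>p < k i\<close> j' by (auto simp: I2_def K2_def)
        then show "cmod (F y i p b) \<le> \<delta>" "cmod (F y' i p b) \<le> \<delta>" "cmod (F y i p b - F y' i p b) \<le> s"
          using y \<delta> s by (auto simp: F_def)
      qed
      have prod: "cmod (e * f - e' * f') \<le> 2 * r * s"
        if "cmod e \<le> r" "cmod f' \<le> r" "cmod (e - e') \<le> s" "cmod (f - f') \<le> s" for e e' f f' :: complex and r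
      proof -
        have "e * f - e' * f' = e * (f - f') + (e - e') * f'" by (simp add: algebra_simps)
        then have "cmod (e * f - e' * f') \<le> cmod e * cmod (f - f') + cmod (e - e') * cmod f'"
          using norm_triangle_ineq[of "e * (f - f')" "(e - e') * f'"] by (simp add: norm_mult)
        also have "\<dots> \<le> r * s + s * r"
          using that s order_trans[OF norm_ge_zero that(1)] by (intro add_mono mult_mono) auto
        finally show ?thesis by simp
      qed
      have EF: "cmod (E y a p * F y i t b - E y' a p * F y' i t b) \<le> 2 * \<delta> * s"
        if "p < d" "t < k i" for p t using E[OF that(1)] F[OF that(2)] by (intro prod)
      have GH: "cmod ((of_bool (a = p) + E y a p) * (of_bool (t = b) + F y i t b)
          - (of_bool (a = p) + E y' a p) * (of_bool (t = b) + F y' i t b)) \<le> 2 * 2 * s"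
        if "p < d" "t < k i" for p t
      proof (rule prod)
        show "cmod (of_bool (a = p) + E y a p) \<le> 2"
          using norm_triangle_ineq[of "of_bool (a = p)" "E y a p"] E[OF that(1)] \<delta>(2) by (auto split: if_splits)
        show "cmod (of_bool (t = b) + F y' i t b) \<le> 2"
          using norm_triangle_ineq[of "of_bool (t = b)" "F y' i t b"] F[OF that(2)] \<delta>(2) by (auto split: if_splits)
      qed (use E[OF that(1)] F[OF that(2)] in auto)
      have ring: "u * x * v + z * (g * w * h) - (u' * x * v' + z * (g' * w * h'))
          = (u * v - u' * v') * x + z * (g * h - g' * h') * w" for u v u' v' g h g' h' x w :: complex
        by (simp add: algebra_simps)
      have bound: "cmod (U * x + z * V * w) \<le> 4 * \<delta> * s * (cmod x + cmod w)"
        if "cmod U \<le> 2 * \<delta> * s" "cmod V \<le> 2 * 2 * s" for U V x w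
      proof -
        have "cmod (U * x + z * V * w) \<le> cmod U * cmod x + cmod z * cmod V * cmod w"
          using norm_triangle_ineq[of "U * x" "z * V * w"] by (simp add: norm_mult)
        also have "\<dots> \<le> 2 * \<delta> * s * cmod x + \<delta> * (2 * 2 * s) * cmod w"
          using that z \<delta>(1) by (intro add_mono mult_right_mono mult_mono) auto
        also have "\<dots> \<le> 4 * \<delta> * s * (cmod x + cmod w)"
          using s \<delta>(1) by (simp add: distrib_left mult_right_mono)
        finally show ?thesis .
      qed
      have eq: "N y z j - N y' z j = (\<Sum>p<d. \<Sum>t<k i.
          (E y a p * F y i t b - E y' a p * F y' i t b) * X i p t
          + z * ((of_bool (a = p) + E y a p) * (of_bool (t = b) + F y i t b)
            - (of_bool (a = p) + E y' a p) * (of_bool (t = b) + F y' i t b)) * D i p t)"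
        unfolding N_def j' prod.case sum_distrib_left sum.distrib[symmetric] sum_subtractf[symmetric]
        by (intro sum.cong refl ring)
      have "cmod (N y z j - N y' z j) \<le> (\<Sum>p<d. \<Sum>t<k i. 4 * \<delta> * s * (cmod (X i p t) + cmod (D i p t)))"
      unfolding eq
      proof (intro sum_norm_le)
        fix p t assume "p \<in> {..<d}" "t \<in> {..<k i}"
        then have p: "p < d" "t < k i" by auto
        show "cmod ((E y a p * F y i t b - E y' a p * F y' i t b) * X i p t
          + z * ((of_bool (a = p) + E y a p) * (of_bool (t = b) + F y i t b)
            - (of_bool (a = p) + E y' a p) * (of_bool (t = b) + F y' i t b)) * D i p t) \<le>
          4 * \<delta> * s * (cmod (X i p t) + cmod (D i p t))"
          by (rule bound[OF EF[OF p] GH[OF p]])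
      qed
      also have "\<dots> = 4 * \<delta> * s * (\<Sum>p<d. \<Sum>t<k i. cmod (X i p t) + cmod (D i p t))"
        by (simp only: sum_distrib_left)
      also have "\<dots> \<le> 4 * \<delta> * s * C"
        using C_bound[OF j'(2)] s \<delta>(1) by (intro mult_left_mono) auto
      also have "\<dots> \<le> \<eta> * s" using mult_right_mono[OF \<delta>(3) s] by (simp add: ac_simps)
      finally show ?thesis .
    qed
    then show "\<exists>\<delta>>0. \<forall>z y y' s. cmod z \<le> \<delta> \<longrightarrow> (\<forall>\<iota>\<in>I1 <+> I2. cmod (y \<iota>) \<le> \<delta>) \<longrightarrow>
      (\<forall>\<iota>\<in>I1 <+> I2. cmod (y' \<iota>) \<le> \<delta>) \<longrightarrow> (\<forall>\<iota>\<in>I1 <+> I2. cmod (y \<iota> - y' \<iota>) \<le> s) \<longrightarrow> s \<ge> 0 \<longrightarrow>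
      (\<forall>j\<in>J. cmod (N y z j - N y' z j) \<le> \<eta> * s)"
      using \<delta>(1) by blast
  next
    fix \<eta> :: real assume \<eta>: "\<eta> > 0"
    define C where "C = 1 + (\<Sum>(i, a, b)\<in>J. cmod (D i a b))"
    have C: "C \<ge> 1" unfolding C_def by (simp add: sum_nonneg case_prod_unfold)
    have "cmod (N (\<lambda>_. 0) z j) \<le> \<eta>" if z: "cmod z \<le> \<eta> / C" and j: "j \<in> J" for z j
    proof -
      obtain i a b where j': "j = (i, a, b)" "i < m" "a < d" "b < k i"
        using j by (auto simp: J_def K_def)
      have E0: "E (\<lambda>_. 0) = (\<lambda>_ _. 0)" "F (\<lambda>_. 0) = (\<lambda>_ _ _. 0)" by (simp_all add: E_def F_def fun_eq_iff)
      have "N (\<lambda>_. 0) z j = z * D i a b"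
        using sum_diagonal_plus[OF j'(3,4), of "\<lambda>_ _. 0" "D i" "\<lambda>_ _. 0"] by (simp add: N_def j'(1) E0)
      moreover have "cmod (D i a b) \<le> C"
        using member_le_sum[OF j, of "\<lambda>(i, a, b). cmod (D i a b)"] fin j'(1)
        by (auto simp: C_def)
      ultimately have "cmod (N (\<lambda>_. 0) z j) \<le> \<eta> / C * C"
        using z C \<eta> by (simp only: norm_mult) (intro mult_mono, auto)
      then show ?thesis using C by simp
    qed
    then show "\<exists>\<delta>>0. \<forall>z. cmod z \<le> \<delta> \<longrightarrow> (\<forall>j\<in>J. cmod (N (\<lambda>_. 0) z j) \<le> \<eta>)"
      using \<eta> C by (intro exI[of _ "\<eta> / C"]) auto
  qed
  then obtain \<epsilon> where \<epsilon>: "\<epsilon> > 0"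
    "\<And>z. cmod z < \<epsilon> \<Longrightarrow> \<exists>y. \<forall>j\<in>J. (\<Sum>\<iota>\<in>I1 <+> I2. L j \<iota> * y \<iota>) + N y z j = 0" by blast
  show ?thesis
  proof (intro exI[of _ \<epsilon>] conjI allI impI \<epsilon>(1))
    fix z assume "cmod z < \<epsilon>"
    then obtain y where y: "\<And>j. j \<in> J \<Longrightarrow> (\<Sum>\<iota>\<in>I1 <+> I2. L j \<iota> * y \<iota>) + N y z j = 0"
      using \<epsilon>(2) by blast
    have "(\<Sum>p<d. \<Sum>s<k i. unipotent lam (\<lambda>p s. y (Inl (p, s))) a p * (X i p s + z * D i p s)
        * unipotent (mu i) (\<lambda>p s. y (Inr (i, p, s))) s b) = 0"
      if i: "i < m" "a < d" "b < k i" and "lam a < mu i b" for i a b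
    proof -
      have "(i, a, b) \<in> J" using that by (auto simp: J_def K_def)
      from y[OF this] have "(\<Sum>p<d. E y a p * X i p b) + (\<Sum>s<k i. X i a s * F y i s b) + N y z (i, a, b) = 0"
        by (simp only: L_sum[OF i])
      moreover have "unipotent lam (\<lambda>p s. y (Inl (p, s))) a p = of_bool (a = p) + E y a p"
        "unipotent (mu i) (\<lambda>p s. y (Inr (i, p, s))) s b = of_bool (s = b) + F y i s b" for p s
        by (simp_all add: unipotent_def E_def F_def)
      moreover have "(\<Sum>p<d. \<Sum>s<k i. (of_bool (a = p) + E y a p) * (X i p s + z * D i p s) * (of_bool (s = b) + F y i s b))
          = (\<Sum>p<d. \<Sum>s<k i. (of_bool (a = p) + E y a p) * X i p s * (of_bool (s = b) + F y i s b))
          + z * (\<Sum>p<d. \<Sum>s<k i. (of_bool (a = p) + E y a p) * D i p s * (of_bool (s = b) + F y i s b))"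
        unfolding sum_distrib_left sum.distrib[symmetric] by (intro sum.cong refl) (simp add: algebra_simps)
      ultimately show ?thesis
        using sum_diagonal_plus[OF i(2,3), of "E y" "X i" "F y i"] zero_X[OF that]
        by (simp only: N_def prod.case add.assoc add_0_left)
    qed
    then show "\<exists>y. pencil_certificate m d k lam mu X D z y" unfolding pencil_certificate_def by blast
  qed
qed

lemma polyfun_sum: "(\<And>i. i \<in> I \<Longrightarrow> f i \<in> polyfun n) \<Longrightarrow> (\<lambda>x. \<Sum>i\<in>I. f i x) \<in> polyfun n"
  by (fact polys.sum)

text \<open>Elimination of \<open>y\<close> leaves a set of parameters \<open>z\<close> that is
  finite or cofinite, and the disc provided by \<open>near\<close> rules out the first
  alternative.\<close>

lemma unipotent_certificate_cofinite:
  fixes X D :: "nat \<Rightarrow> nat \<Rightarrow> nat \<Rightarrow> complex" and lam :: "nat \<Rightarrow> real" and mu :: "nat \<Rightarrow> nat \<Rightarrow> real"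
  assumes near: "\<exists>\<epsilon>>0. \<forall>z. cmod z < \<epsilon> \<longrightarrow> (\<exists>y. pencil_certificate m d k lam mu X D z y)"
  shows "finite (- {z. \<exists>y. pencil_certificate m d k lam mu X D z y})"
proof -
  \<comment> \<open>\<open>Suc\<close> reserves coordinate \<open>0\<close> for the parameter
    \<open>z\<close>, the one that survives the projections.\<close>
  define e where "e = (\<lambda>\<iota> :: nat \<times> nat + nat \<times> nat \<times> nat. Suc (to_nat \<iota>))"
  have e_inj: "inj e" and e_pos: "e \<iota> \<noteq> 0" for \<iota> by (auto simp: e_def inj_def)
  define I where "I = ({..<d} \<times> {..<d}) <+> (SIGMA i:{..<m}. {..<k i} \<times> {..<k i})"
  have "finite I" by (simp add: I_def)
  then obtain n where n: "\<forall>\<iota>\<in>I. e \<iota> < n"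
    using finite_nat_set_iff_bounded[of "e ` I"] by auto
  define C where "C = {x. pencil_certificate m d k lam mu X D (x 0) (\<lambda>\<iota>. x (e \<iota>))}"
  define f where "f i a b x = (\<Sum>p<d. \<Sum>s<k i. unipotent lam (\<lambda>p s. x (e (Inl (p, s)))) a p
      * (X i p s + x 0 * D i p s) * unipotent (mu i) (\<lambda>p s. x (e (Inr (i, p, s)))) s b)" for i a b x
  have entry: "(\<lambda>x. of_bool P + (if Q then x j else 0)) \<in> polyfun (Suc n)" if "j < Suc n" for P Q j
    using polyfun.add[OF polyfun.const polyfun.coord[OF that]] by (cases Q) (simp_all add: polyfun.const)
  have f: "f i a b \<in> polyfun (Suc n)" if "i < m" "a < d" "b < k i" for i a b
    unfolding f_def
  proof (intro polyfun_sum polyfun.mult)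
    fix p s assume "p \<in> {..<d}" "s \<in> {..<k i}"
    then have "Inl (a, p) \<in> I" "Inr (i, s, b) \<in> I" using that by (auto simp: I_def)
    then have less: "e (Inl (a, p)) < Suc n" "e (Inr (i, s, b)) < Suc n" using n by auto
    show "(\<lambda>x. unipotent lam (\<lambda>p s. x (e (Inl (p, s)))) a p) \<in> polyfun (Suc n)"
      "(\<lambda>x. unipotent (mu i) (\<lambda>p s. x (e (Inr (i, p, s)))) s b) \<in> polyfun (Suc n)"
      unfolding unipotent_def by (fact entry[OF less(1)], fact entry[OF less(2)])
    show "(\<lambda>x. X i p s + x 0 * D i p s) \<in> polyfun (Suc n)"
      by (intro polyfun.add polyfun.mult polyfun.const polyfun.coord) simp
  qed
  have "C = (\<Inter>i<m. \<Inter>a<d. \<Inter>b\<in>{b. b < k i \<and> lam a < mu i b}. {x. f i a b x = 0})"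
    unfolding C_def pencil_certificate_def f_def by auto
  moreover have "polys.constructible (Suc n) \<dots>"
    by (intro polys.constructible_INTER polys.constructible_vanishing f) auto
  ultimately have "polys.constructible (Suc n) C" by (simp only:)
  from constructible_line_finite_or_cofinite[OF this]
  have "finite {x 0 |x. x \<in> C} \<or> finite (- {x 0 |x. x \<in> C})" .
  moreover have eq: "{x 0 |x. x \<in> C} = {z. \<exists>y. pencil_certificate m d k lam mu X D z y}"
  proof (intro equalityI subsetI)
    fix z assume "z \<in> {z. \<exists>y. pencil_certificate m d k lam mu X D z y}"
    then obtain y where y: "pencil_certificate m d k lam mu X D z y" by blast
    let ?x = "\<lambda>j. if j = 0 then z else y (inv_into UNIV e j)"
    have "(\<lambda>\<iota>. ?x (e \<iota>)) = y" using e_inj by (auto simp: fun_eq_iff dest: e_pos[THEN notE])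
    then have "?x \<in> C" using y by (simp only: C_def mem_Collect_eq) simp
    then show "z \<in> {x 0 |x. x \<in> C}" by (intro CollectI exI[of _ ?x]) simp
  qed (auto simp: C_def)
  moreover have "infinite {z. \<exists>y. pencil_certificate m d k lam mu X D z y}"
  proof -
    obtain \<epsilon> where \<epsilon>: "\<epsilon> > 0" "\<And>z. cmod z < \<epsilon> \<Longrightarrow> \<exists>y. pencil_certificate m d k lam mu X D z y" using near by blast
    have "complex_of_real ` {0<..<\<epsilon>} \<subseteq> {z. \<exists>y. pencil_certificate m d k lam mu X D z y}" using \<epsilon>(2) by auto
    moreover have "infinite (complex_of_real ` {0<..<\<epsilon>})"
      using \<epsilon>(1) by (simp add: finite_image_iff inj_on_def)
    ultimately show ?thesis using finite_subset by blast
  qed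
  ultimately show ?thesis by simp
qed

section \<open>Complex matrices\<close>

lemma index_mult_mat_sum:
  assumes "A \<in> carrier_mat p n" "B \<in> carrier_mat n q" "i < p" "j < q"
  shows "(A * B) $$ (i, j) = (\<Sum>l<n. A $$ (i, l) * B $$ (l, j))"
  using assms by (auto simp: scalar_prod_def atLeast0LessThan intro!: sum.cong)

lemma dim_adjoint [simp]: "dim_row (mat_adjoint A) = dim_col A" "dim_col (mat_adjoint A) = dim_row A"
  by (auto simp: mat_adjoint_def)

lemma carrier_adjoint [simp]: "A \<in> carrier_mat p q \<Longrightarrow> mat_adjoint A \<in> carrier_mat q p"
  by auto

lemma index_adjoint [simp]:
  fixes A :: "complex mat"
  shows "i < dim_col A \<Longrightarrow> j < dim_row A \<Longrightarrow> mat_adjoint A $$ (i, j) = cnj (A $$ (j, i))"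
  by (simp add: mat_adjoint_def mat_of_rows_def)

lemma adjoint_adjoint [simp]: "mat_adjoint (mat_adjoint A) = (A :: complex mat)"
  by (rule eq_matI) auto

lemma adjoint_mult:
  fixes A B :: "complex mat"
  assumes "A \<in> carrier_mat p n" "B \<in> carrier_mat n q"
  shows "mat_adjoint (A * B) = mat_adjoint B * mat_adjoint A"
  using assms
  by (intro eq_matI) (auto simp: index_mult_mat_sum[OF assms]
    index_mult_mat_sum[OF carrier_adjoint[OF assms(2)] carrier_adjoint[OF assms(1)]] mult.commute
    simp del: index_mult_mat(1) intro!: sum.cong)

lemma adjoint_one [simp]: "mat_adjoint (1\<^sub>m n) = (1\<^sub>m n :: complex mat)"
  by (rule eq_matI) auto

lemma adjoint_zero [simp]: "mat_adjoint (0\<^sub>m p q) = (0\<^sub>m q p :: complex mat)"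
  by (rule eq_matI) auto

lemma adjoint_smult: "mat_adjoint (c \<cdot>\<^sub>m A) = cnj c \<cdot>\<^sub>m mat_adjoint (A :: complex mat)"
  by (rule eq_matI) auto

lemma smult_smult_times: "a \<cdot>\<^sub>m (b \<cdot>\<^sub>m A) = (a * b) \<cdot>\<^sub>m (A :: complex mat)"
  by (rule eq_matI) auto

lemma adjoint_add:
  fixes A B :: "complex mat"
  assumes "A \<in> carrier_mat p q" "B \<in> carrier_mat p q"
  shows "mat_adjoint (A + B) = mat_adjoint A + mat_adjoint B"
  using assms by (intro eq_matI) auto

lemma mult_left_inverse_commute:
  fixes A B :: "complex mat"
  assumes "A \<in> carrier_mat n n" "B \<in> carrier_mat n n" "A * B = 1\<^sub>m n"
  shows "B * A = 1\<^sub>m n"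
  using mat_mult_left_right_inverse[OF assms(1,2)] assms by blast

section \<open>Hermitian forms and Gram-Schmidt orthonormalization\<close>

definition form :: "nat \<Rightarrow> (nat \<Rightarrow> nat \<Rightarrow> complex) \<Rightarrow> (nat \<Rightarrow> complex) \<Rightarrow> (nat \<Rightarrow> complex) \<Rightarrow> complex" where
  "form k N x y = (\<Sum>p<k. \<Sum>q<k. cnj (x p) * N p q * y q)"

lemma form_linear:
  "form k N x (\<lambda>q. y q - z q) = form k N x y - form k N x z"
  "form k N x (\<lambda>q. y q * c) = form k N x y * c"
  by (simp_all add: form_def algebra_simps sum_subtractf sum_distrib_left)

lemma form_sum: "form k N x (\<lambda>q. \<Sum>j\<in>J. y j q) = (\<Sum>j\<in>J. form k N x (y j))"
proof -
  have "form k N x (\<lambda>q. \<Sum>j\<in>J. y j q) = (\<Sum>p<k. \<Sum>j\<in>J. \<Sum>q<k. cnj (x p) * N p q * y j q)"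
    unfolding form_def sum_distrib_left by (intro sum.cong refl sum.swap)
  then show ?thesis unfolding form_def by (simp only: sum.swap[of _ "{..<k}" J])
qed

lemma form_hermitian:
  assumes "\<And>p q. N q p = cnj (N p q)"
  shows "form k N y x = cnj (form k N x y)"
proof -
  have "cnj (y p) * N p q * x q = cnj (cnj (x q) * N q p * y p)" for p q
    using assms[where p = q and q = p] by simp
  then show ?thesis
    unfolding form_def cnj_sum by (subst sum.swap) (simp only:)
qed

text \<open>Gram-Schmidt applied to the standard basis. The triangular shape of \<open>r\<close> is
  what later lets orthonormalization preserve zero patterns of matrices.\<close>

lemma form_triangular_orthonormalization:
  assumes herm: "\<And>p q. N q p = cnj (N p q)"
    and pos: "\<And>x. \<exists>p<k. x p \<noteq> 0 \<Longrightarrow> Re (form k N x x) > 0"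
  shows "\<exists>r. (\<forall>p j. p > j \<longrightarrow> r p j = 0) \<and>
    (\<forall>j<k. \<forall>l<k. form k N (\<lambda>p. r p j) (\<lambda>p. r p l) = of_bool (j = l))"
  using pos
proof (induction k)
  case 0
  show ?case by (intro exI[of _ "\<lambda>_ _. 0"]) simp
next
  case (Suc k)
  have ext: "form (Suc k) N x y = form k N x y" if "x k = 0" "y k = 0" for x y
    using that by (simp add: form_def)
  have cong: "form k N x y = form k N x' y'" if "\<And>p. p < k \<Longrightarrow> x p = x' p" "\<And>p. p < k \<Longrightarrow> y p = y' p" for x y x' y'
    using that by (simp add: form_def)
  have "Re (form k N x x) > 0" if "\<exists>p<k. x p \<noteq> 0" for x
  proof -
    let ?x = "x(k := 0)"
    have "Re (form (Suc k) N ?x ?x) > 0" using that by (intro Suc.prems) (auto intro!: less_SucI)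
    moreover have "form (Suc k) N ?x ?x = form k N x x" by (subst ext) (auto intro: cong)
    ultimately show ?thesis by simp
  qed
  from Suc.IH[OF this] obtain r where "(\<forall>p j. p > j \<longrightarrow> r p j = 0) \<and>
    (\<forall>j<k. \<forall>l<k. form k N (\<lambda>p. r p j) (\<lambda>p. r p l) = of_bool (j = l))" by (rule exE)
  then have r: "\<And>p j. p > j \<Longrightarrow> r p j = 0"
    "\<And>j l. j < k \<Longrightarrow> l < k \<Longrightarrow> form k N (\<lambda>p. r p j) (\<lambda>p. r p l) = of_bool (j = l)"
    by simp_all
  let ?F = "form (Suc k) N"
  have rF: "?F (\<lambda>p. r p j) (\<lambda>p. r p l) = of_bool (j = l)" if "j < k" "l < k" for j l
    using r that by (subst ext) auto
  define e :: "nat \<Rightarrow> complex" where "e p = of_bool (p = k)" for p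
  \<comment> \<open>Residual of the last basis vector after projection to the earlier ones; its last
    entry stays \<open>1\<close>, so it is nonzero and has positive norm.\<close>
  define u where "u p = e p - (\<Sum>j<k. r p j * ?F (\<lambda>p. r p j) e)" for p
  have u_k: "u k = 1" using r(1) by (simp add: u_def e_def)
  have u_above: "u p = 0" if "p > k" for p using r(1) that by (simp add: u_def e_def)
  have ru: "?F (\<lambda>p. r p l) u = 0" if "l < k" for l
  proof -
    have "?F (\<lambda>p. r p l) u = ?F (\<lambda>p. r p l) e - (\<Sum>j<k. of_bool (l = j) * ?F (\<lambda>p. r p j) e)"
      unfolding u_def form_linear form_sum using rF that by simp
    also have "(\<Sum>j<k. of_bool (l = j) * ?F (\<lambda>p. r p j) e) = ?F (\<lambda>p. r p l) e"
      using that by (intro sum_of_bool_eq_mult(1)) auto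
    finally show ?thesis by simp
  qed
  have ur: "?F u (\<lambda>p. r p l) = 0" if "l < k" for l
    using form_hermitian[of N "Suc k" u "\<lambda>p. r p l", OF herm] ru[OF that] by simp
  have u_pos: "Re (?F u u) > 0" using u_k by (intro Suc.prems) auto
  have u_real: "?F u u = of_real (Re (?F u u))"
    using form_hermitian[of N "Suc k" u u, OF herm] by (simp add: complex_eq_iff)
  define s where "s = 1 / sqrt (Re (?F u u))"
  define r' where "r' p j = (if j < k then r p j else if j = k then u p * of_real s else 0)" for p j
  have "r' p j = 0" if "p > j" for p j using that r(1) u_above by (auto simp: r'_def)
  moreover have "?F (\<lambda>p. r' p j) (\<lambda>p. r' p l) = of_bool (j = l)" if "j < Suc k" "l < Suc k" for j l
  proof -
    have scale: "?F (\<lambda>p. u p * of_real s) y = ?F u y * of_real s" for y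
      by (simp add: form_def algebra_simps sum_distrib_left)
    have "?F u u * of_real s * of_real s = 1"
    proof -
      have "Re (?F u u) * s * s = 1" using u_pos by (simp add: s_def real_div_sqrt divide_simps)
      then have "of_real (Re (?F u u) * s * s) = (1 :: complex)" by simp
      then show ?thesis using u_real by simp
    qed
    then show ?thesis
      using that rF ru ur by (auto simp: r'_def less_Suc_eq form_linear scale)
  qed
  ultimately show ?case by blast
qed

lemma sum_cmod_power2_pos:
  assumes "p < k" "x p \<noteq> 0"
  shows "(\<Sum>p<k :: nat. (cmod (x p))\<^sup>2) > 0"
  using assms by (intro sum_pos2[of _ p]) auto

lemma form_gram:
  fixes A :: "complex mat"
  assumes A: "A \<in> carrier_mat n k"
  shows "form k (\<lambda>p q. \<Sum>l<n. cnj (A $$ (l, p)) * A $$ (l, q)) x x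
    = of_real (\<Sum>l<n. (cmod (\<Sum>q<k. A $$ (l, q) * x q))\<^sup>2)"
proof -
  have "form k (\<lambda>p q. \<Sum>l<n. cnj (A $$ (l, p)) * A $$ (l, q)) x x
      = (\<Sum>p<k. \<Sum>q<k. \<Sum>l<n. cnj (A $$ (l, p) * x p) * (A $$ (l, q) * x q))"
    unfolding form_def sum_distrib_left sum_distrib_right by (simp add: ac_simps)
  also have "\<dots> = (\<Sum>l<n. \<Sum>p<k. \<Sum>q<k. cnj (A $$ (l, p) * x p) * (A $$ (l, q) * x q))"
    by (simp only: sum.swap[of _ "{..<n}"])
  also have "\<dots> = (\<Sum>l<n. cnj (\<Sum>q<k. A $$ (l, q) * x q) * (\<Sum>q<k. A $$ (l, q) * x q))"
    by (simp only: cnj_sum sum_product)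
  finally show ?thesis by (simp only: of_real_sum complex_norm_square mult.commute)
qed

text \<open>Stated for \<open>c I + A\<^sup>* A\<close> so as to cover both invertible \<open>A\<close> (with \<open>c = 0\<close>) and arbitrary \<open>A\<close> (with \<open>c > 0\<close>).\<close>

lemma gram_triangular_orthonormalization:
  fixes A :: "complex mat" and c :: real
  assumes A: "A \<in> carrier_mat n k" and c: "c \<ge> 0"
    and inj: "c > 0 \<or> (\<exists>B \<in> carrier_mat k n. B * A = 1\<^sub>m k)"
  obtains r where "r \<in> carrier_mat k k" "\<And>p j. p < k \<Longrightarrow> j < p \<Longrightarrow> r $$ (p, j) = 0"
    "mat_adjoint r * ((of_real c \<cdot>\<^sub>m 1\<^sub>m k + mat_adjoint A * A) * r) = 1\<^sub>m k"
proof -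
  define M where "M p q = of_real c * of_bool (p = q) + (\<Sum>l<n. cnj (A $$ (l, p)) * A $$ (l, q))" for p q
  have M_form: "Re (form k M x x) = c * (\<Sum>p<k. (cmod (x p))\<^sup>2) + (\<Sum>l<n. (cmod (\<Sum>q<k. A $$ (l, q) * x q))\<^sup>2)" for x
  proof -
    have "form k M x x = (\<Sum>p<k. \<Sum>q<k. of_real c * (of_bool (p = q) * (cnj (x p) * x q)))
        + form k (\<lambda>p q. \<Sum>l<n. cnj (A $$ (l, p)) * A $$ (l, q)) x x"
      unfolding form_def M_def sum.distrib[symmetric] by (intro sum.cong refl) (simp add: algebra_simps)
    also have "(\<Sum>p<k. \<Sum>q<k. of_real c * (of_bool (p = q) * (cnj (x p) * x q))) = (\<Sum>p<k. of_real c * (cnj (x p) * x p))"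
      unfolding sum_distrib_left[symmetric] by (intro arg_cong2[of _ _ _ _ "(*)"] sum.cong refl sum_of_bool_eq_mult(1)) auto
    also have "\<dots> = of_real (c * (\<Sum>p<k. (cmod (x p))\<^sup>2))"
      by (simp add: sum_distrib_left complex_norm_square[symmetric] mult.commute[of "cnj _"] del: of_real_power)
    finally show ?thesis unfolding form_gram[OF A] by simp
  qed
  have "\<exists>r. (\<forall>p j. p > j \<longrightarrow> r p j = 0) \<and>
      (\<forall>j<k. \<forall>l<k. form k M (\<lambda>p. r p j) (\<lambda>p. r p l) = of_bool (j = l))"
  proof (rule form_triangular_orthonormalization)
    show "M q p = cnj (M p q)" for p q by (cases "p = q") (auto simp: M_def mult.commute)
    fix x :: "nat \<Rightarrow> complex" assume "\<exists>p<k. x p \<noteq> 0"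
    then obtain p where p: "p < k" "x p \<noteq> 0" by blast
    show "Re (form k M x x) > 0"
    proof (cases "c > 0")
      case True
      then show ?thesis unfolding M_form using sum_cmod_power2_pos[of p k x, OF p]
        by (intro add_pos_nonneg mult_pos_pos sum_nonneg) auto
    next
      case False
      then obtain B where B: "B \<in> carrier_mat k n" "B * A = 1\<^sub>m k" using inj by blast
      \<comment> \<open>The left inverse \<open>B\<close> recovers \<open>x\<close> from
        \<open>A x\<close>, so some entry of \<open>A x\<close> is nonzero.\<close>
      have "x p = (\<Sum>q<k. of_bool (p = q) * x q)"
        using p by (subst sum_of_bool_eq_mult(1)) auto
      also have "\<dots> = (\<Sum>q<k. (\<Sum>l<n. B $$ (p, l) * A $$ (l, q)) * x q)"
      proof (intro sum.cong refl arg_cong2[of _ _ _ _ "(*)"])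
        fix q assume "q \<in> {..<k}"
        then show "of_bool (p = q) = (\<Sum>l<n. B $$ (p, l) * A $$ (l, q))"
          using index_mult_mat_sum[OF B(1) A, of p q] B(2) p by (simp split: if_splits)
      qed
      also have "\<dots> = (\<Sum>l<n. B $$ (p, l) * (\<Sum>q<k. A $$ (l, q) * x q))"
        unfolding sum_distrib_left sum_distrib_right by (subst sum.swap) (simp add: mult.assoc)
      finally have "\<exists>l<n. (\<Sum>q<k. A $$ (l, q) * x q) \<noteq> 0"
        using p(2) by (force intro!: sum.neutral)
      then obtain l where l: "l < n" "(\<Sum>q<k. A $$ (l, q) * x q) \<noteq> 0" by blast
      show ?thesis unfolding M_form
        using False c sum_cmod_power2_pos[of l n "\<lambda>l. \<Sum>q<k. A $$ (l, q) * x q", OF l]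
        by (intro add_nonneg_pos) (auto intro!: sum_nonneg)
    qed
  qed
  then obtain \<rho> where \<rho>: "\<And>p j. p > j \<Longrightarrow> \<rho> p j = 0"
    "\<And>j l. j < k \<Longrightarrow> l < k \<Longrightarrow> form k M (\<lambda>p. \<rho> p j) (\<lambda>p. \<rho> p l) = of_bool (j = l)" by blast
  define r where "r = mat k k (\<lambda>(p, j). \<rho> p j)"
  have r: "r \<in> carrier_mat k k" by (simp add: r_def)
  let ?M = "of_real c \<cdot>\<^sub>m 1\<^sub>m k + mat_adjoint A * A"
  have M: "?M \<in> carrier_mat k k" using A by auto
  have M_idx: "?M $$ (p, q) = M p q" if "p < k" "q < k" for p q
    using that A index_mult_mat_sum[OF carrier_adjoint[OF A] A that] by (simp add: M_def)
  have "mat_adjoint r * (?M * r) = 1\<^sub>m k"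
  proof (rule eq_matI)
    fix j l assume "j < dim_row (1\<^sub>m k :: complex mat)" "l < dim_col (1\<^sub>m k :: complex mat)"
    then have jl: "j < k" "l < k" by auto
    have "(mat_adjoint r * (?M * r)) $$ (j, l) = (\<Sum>p<k. cnj (\<rho> p j) * (\<Sum>q<k. M p q * \<rho> q l))"
      using jl r M M_idx
      by (subst index_mult_mat_sum[of _ k k _ k])
        (auto simp: r_def index_mult_mat_sum[of _ k k _ k] simp del: index_mult_mat(1) intro!: sum.cong)
    also have "\<dots> = of_bool (j = l)"
      using \<rho>(2)[OF jl] by (simp add: form_def sum_distrib_left mult.assoc)
    finally show "(mat_adjoint r * (?M * r)) $$ (j, l) = 1\<^sub>m k $$ (j, l)" using jl by simp
  qed (use r in auto)
  then show ?thesis using that[OF r] \<rho>(1) by (simp add: r_def)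
qed

section \<open>Unitary matrices and the spectral theorem\<close>

definition unitary :: "nat \<Rightarrow> complex mat \<Rightarrow> bool" where
  "unitary n U \<longleftrightarrow> U \<in> carrier_mat n n \<and> mat_adjoint U * U = 1\<^sub>m n"

lemma unitaryD:
  assumes "unitary n U"
  shows "U \<in> carrier_mat n n" "mat_adjoint U * U = 1\<^sub>m n" "U * mat_adjoint U = 1\<^sub>m n"
  using assms mult_left_inverse_commute[of "mat_adjoint U" n U] by (auto simp: unitary_def)

definition real_diag :: "nat \<Rightarrow> (nat \<Rightarrow> real) \<Rightarrow> complex mat" where
  "real_diag n w = mat n n (\<lambda>(i, j). if i = j then of_real (w i) else 0)"

lemma real_diag_carrier [simp]: "real_diag n w \<in> carrier_mat n n"
  and real_diag_dim [simp]: "dim_row (real_diag n w) = n" "dim_col (real_diag n w) = n"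
  and real_diag_index [simp]: "i < n \<Longrightarrow> j < n \<Longrightarrow> real_diag n w $$ (i, j) = (if i = j then of_real (w i) else 0)"
  by (auto simp: real_diag_def)

lemma sum_eq_single:
  fixes f :: "nat \<Rightarrow> 'a::comm_monoid_add"
  assumes "a < n" "\<And>c. c < n \<Longrightarrow> c \<noteq> a \<Longrightarrow> f c = 0"
  shows "(\<Sum>c<n. f c) = f a"
proof -
  have "(\<Sum>c<n. f c) = (\<Sum>c\<in>{a}. f c)" using assms by (intro sum.mono_neutral_right) auto
  then show ?thesis by simp
qed

text \<open>\<open>C\<close> is \<open>B\<close> conjugated by \<open>r\<close>, written without an
  inverse. Going from the last row upwards, the rows of \<open>C\<close> below \<open>a\<close> are
  already triangular, so in row \<open>a\<close> and column \<open>b \<le> a\<close> of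
  \<open>r * C\<close> only the term \<open>r $$ (a, a) * C $$ (a, b)\<close> survives.\<close>

lemma upper_triangular_conjugate:
  fixes B C r :: "complex mat"
  assumes carr: "r \<in> carrier_mat n n" "B \<in> carrier_mat n n" "C \<in> carrier_mat n n"
    and ut: "\<And>p j. p < n \<Longrightarrow> j < p \<Longrightarrow> r $$ (p, j) = 0" "\<And>p j. p < n \<Longrightarrow> j < p \<Longrightarrow> B $$ (p, j) = 0"
    and diag: "\<And>j. j < n \<Longrightarrow> r $$ (j, j) \<noteq> 0"
    and eq: "r * C = B * r"
  shows "a < n \<Longrightarrow> b < a \<Longrightarrow> C $$ (a, b) = 0" "a < n \<Longrightarrow> C $$ (a, a) = B $$ (a, a)"
proof -
  have "(\<forall>b<a. C $$ (a, b) = 0) \<and> C $$ (a, a) = B $$ (a, a)" if "a < n" for a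
    using that
  proof (induction "n - a" arbitrary: a rule: less_induct)
    case less
    have "r $$ (a, a) * C $$ (a, b) = (\<Sum>c<n. B $$ (a, c) * r $$ (c, b))" if "b \<le> a" for b
    proof -
      have "r $$ (a, a) * C $$ (a, b) = (\<Sum>c<n. r $$ (a, c) * C $$ (c, b))"
      proof (subst sum_eq_single[of a])
        fix c assume c: "c < n" "c \<noteq> a"
        show "r $$ (a, c) * C $$ (c, b) = 0"
        proof (cases "c < a")
          case True
          then show ?thesis using ut(1) less.prems by simp
        next
          case False
          then show ?thesis using less.hyps[of c] c that less.prems by simp
        qed
      qed (use less.prems in auto)
      also have "\<dots> = (\<Sum>c<n. B $$ (a, c) * r $$ (c, b))"
        using arg_cong[OF eq, of "\<lambda>M. M $$ (a, b)"] less.prems that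
          index_mult_mat_sum[OF carr(1,3), of a b] index_mult_mat_sum[OF carr(2,1), of a b] by simp
      finally show ?thesis .
    qed note * = this
    have "C $$ (a, b) = 0" if "b < a" for b
    proof -
      have "(\<Sum>c<n. B $$ (a, c) * r $$ (c, b)) = 0"
      proof (intro sum.neutral ballI)
        fix c assume c: "c \<in> {..<n}"
        show "B $$ (a, c) * r $$ (c, b) = 0"
          using ut(1)[of c b] ut(2)[of a c] c that less.prems by (cases "c < a") auto
      qed
      then show ?thesis using *[of b] that diag less.prems by simp
    qed
    moreover have "C $$ (a, a) = B $$ (a, a)"
    proof -
      have "(\<Sum>c<n. B $$ (a, c) * r $$ (c, a)) = B $$ (a, a) * r $$ (a, a)"
      proof (rule sum_eq_single)
        fix c assume c: "c < n" "c \<noteq> a"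
        then show "B $$ (a, c) * r $$ (c, a) = 0"
          using ut(1)[of c a] ut(2)[of a c] less.prems by (cases "c < a") auto
      qed (use less.prems in auto)
      then show ?thesis using *[of a] diag less.prems by simp
    qed
    ultimately show ?case by blast
  qed
  then show "a < n \<Longrightarrow> b < a \<Longrightarrow> C $$ (a, b) = 0" "a < n \<Longrightarrow> C $$ (a, a) = B $$ (a, a)" by blast+
qed

lemma upper_triangular_diag_nonzero:
  fixes r :: "complex mat"
  assumes "r \<in> carrier_mat n n" "\<And>p j. p < n \<Longrightarrow> j < p \<Longrightarrow> r $$ (p, j) = 0" "det r \<noteq> 0" "j < n"
  shows "r $$ (j, j) \<noteq> 0"
proof -
  have "upper_triangular r" using assms by auto
  from det_upper_triangular[OF this assms(1)] assms show ?thesis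
    by (auto simp: prod_list_zero_iff diag_mat_def)
qed

text \<open>Gram-Schmidt on the columns of an invertible \<open>P\<close>, that is its QR
  factorization with the triangular factor inverted.\<close>

lemma orthonormalize_columns:
  fixes P Q :: "complex mat"
  assumes P: "P \<in> carrier_mat n n" and Q: "Q \<in> carrier_mat n n" and QP: "Q * P = 1\<^sub>m n"
  obtains r where "r \<in> carrier_mat n n" "\<And>p j. p < n \<Longrightarrow> j < p \<Longrightarrow> r $$ (p, j) = 0"
    "\<And>j. j < n \<Longrightarrow> r $$ (j, j) \<noteq> 0" "unitary n (P * r)"
proof -
  obtain r where r: "r \<in> carrier_mat n n" "\<And>p j. p < n \<Longrightarrow> j < p \<Longrightarrow> r $$ (p, j) = 0"
    "mat_adjoint r * ((of_real 0 \<cdot>\<^sub>m 1\<^sub>m n + mat_adjoint P * P) * r) = 1\<^sub>m n"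
    using gram_triangular_orthonormalization[OF P, of 0] Q QP by (metis order_refl)
  have "of_real 0 \<cdot>\<^sub>m 1\<^sub>m n + mat_adjoint P * P = mat_adjoint P * P"
    using P by (intro eq_matI) auto
  then have r3: "mat_adjoint r * ((mat_adjoint P * P) * r) = 1\<^sub>m n" using r(3) by simp
  have "mat_adjoint (P * r) * (P * r) = mat_adjoint r * ((mat_adjoint P * P) * r)"
    using P r(1) by (simp add: adjoint_mult[of _ n n _ n] assoc_mult_mat[of _ n n _ n _ n])
  then have "unitary n (P * r)" using r3 P r(1) by (simp add: unitary_def)
  moreover have "det r \<noteq> 0"
  proof
    assume "det r = 0"
    then have "det (mat_adjoint r * ((mat_adjoint P * P) * r)) = 0"
      using P r(1) det_mult[of "mat_adjoint P * P" n r]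
        det_mult[of "mat_adjoint r" n "mat_adjoint P * P * r"]
      by (simp add: mult_carrier_mat[of _ n n _ n])
    then show False using r3 by simp
  qed
  ultimately show ?thesis using that[OF r(1,2)] upper_triangular_diag_nonzero[OF r(1,2)] by blast
qed

text \<open>Orthonormalizing the columns of the Schur transformation keeps the triangular form and
  its diagonal, and a Hermitian triangular matrix is diagonal with real entries. The list
  \<open>es\<close> may come in any order, and the diagonal follows it.\<close>

lemma hermitian_diagonalization_list:
  fixes A :: "complex mat"
  assumes A: "A \<in> carrier_mat n n" and herm: "mat_adjoint A = A"
    and cp: "char_poly A = (\<Prod>e\<leftarrow>es. [:- e, 1:])"
  obtains U where "unitary n U" "length es = n" "\<And>i. i < n \<Longrightarrow> es ! i = of_real (Re (es ! i))"
    "mat_adjoint U * A * U = real_diag n (\<lambda>i. Re (es ! i))"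
proof -
  obtain B P Q where BPQ: "schur_decomposition A es = (B, P, Q)" by (metis prod_cases3)
  from schur_decomposition[OF A cp BPQ]
  have wit: "similar_mat_wit A B P Q" and ut: "upper_triangular B" and diag: "diag_mat B = es" by auto
  from similar_mat_witD2[OF A wit]
  have carr: "B \<in> carrier_mat n n" "P \<in> carrier_mat n n" "Q \<in> carrier_mat n n"
    and PQ: "P * Q = 1\<^sub>m n" "Q * P = 1\<^sub>m n" and APBQ: "A = P * B * Q" by auto
  have len: "length es = n" using diag carr by (auto simp: diag_mat_def)
  obtain r where r: "r \<in> carrier_mat n n" "\<And>p j. p < n \<Longrightarrow> j < p \<Longrightarrow> r $$ (p, j) = 0"
    "\<And>j. j < n \<Longrightarrow> r $$ (j, j) \<noteq> 0" "unitary n (P * r)"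
    using orthonormalize_columns[OF carr(2,3) PQ(2)] by metis
  define U where "U = P * r"
  define C where "C = mat_adjoint U * A * U"
  have U: "U \<in> carrier_mat n n" "mat_adjoint U * U = 1\<^sub>m n" "U * mat_adjoint U = 1\<^sub>m n"
    using unitaryD[OF r(4)] by (simp_all add: U_def)
  have C: "C \<in> carrier_mat n n" using U A by (simp add: C_def mult_carrier_mat[of _ n n _ n])
  note as = assoc_mult_mat[of _ n n _ n _ n] mult_carrier_mat[of _ n n _ n]
  have "U * C = (U * mat_adjoint U) * (A * U)" using U(1) A by (simp add: C_def as)
  also have "\<dots> = A * U" using U A by simp
  also have "\<dots> = P * (B * ((Q * P) * r))" using carr r(1) by (simp add: APBQ U_def as)
  also have "\<dots> = P * (B * r)" using carr r(1) PQ by simp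
  finally have "Q * (U * C) = Q * (P * (B * r))" by simp
  then have "(Q * P) * (r * C) = (Q * P) * (B * r)" using carr r(1) C by (simp add: U_def as)
  then have "r * C = B * r" using carr r(1) C PQ by simp
  have utB: "B $$ (p, j) = 0" if "p < n" "j < p" for p j using ut that carr by auto
  note conj = upper_triangular_conjugate[OF r(1) carr(1) C r(2) utB r(3) \<open>r * C = B * r\<close>]
  have Cherm: "mat_adjoint C = C"
    using U(1) A herm by (simp add: C_def adjoint_mult[of _ n n _ n] as)
  have sym: "C $$ (a, b) = cnj (C $$ (b, a))" if "a < n" "b < n" for a b
    using arg_cong[OF Cherm, of "\<lambda>M. M $$ (a, b)"] that C by simp
  have es: "es ! i = C $$ (i, i)" if "i < n" for i
    using conj(2) that diag carr by (auto simp: diag_mat_def)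
  have real: "es ! i = of_real (Re (es ! i))" if "i < n" for i
    using sym[OF that that] es[OF that] by (simp add: complex_eq_iff)
  have "C = real_diag n (\<lambda>i. Re (es ! i))"
  proof (rule eq_matI)
    fix a b assume "a < dim_row (real_diag n (\<lambda>i. Re (es ! i)))" "b < dim_col (real_diag n (\<lambda>i. Re (es ! i)))"
    then have ab: "a < n" "b < n" by auto
    consider "a = b" | "b < a" | "a < b" by linarith
    then show "C $$ (a, b) = real_diag n (\<lambda>i. Re (es ! i)) $$ (a, b)"
    proof cases
      case 1
      then show ?thesis using ab es[of a] real[of a] by simp
    next
      case 2
      then show ?thesis using ab conj(1) by simp
    next
      case 3
      then show ?thesis using ab conj(1)[of b a] sym[of a b] by simp
    qed
  qed (use C in auto)
  then show ?thesis using that[OF r(4) len real] by (simp add: C_def U_def)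
qed

section \<open>The decreasing list of eigenvalues: uniqueness and diagonalization\<close>

lemma mset_linear_factors_unique:
  fixes l l' :: "real list"
  assumes "(\<Prod>x\<leftarrow>l. [:- complex_of_real x, 1:]) = (\<Prod>x\<leftarrow>l'. [:- complex_of_real x, 1:])"
  shows "mset l = mset l'"
proof -
  have "proots (\<Prod>x\<leftarrow>l. [:- complex_of_real x, 1:]) = image_mset complex_of_real (mset l)" for l
  proof (induction l)
    case (Cons a l)
    have "(\<Prod>x\<leftarrow>l. [:- complex_of_real x, 1:]) \<noteq> 0"
      by (auto simp: prod_list_zero_iff image_iff)
    then show ?case
      using Cons by (simp add: proots_mult del: mult_pCons_left)
  qed simp
  then have "image_mset complex_of_real (mset l) = image_mset complex_of_real (mset l')"
    using assms by metis
  then have "image_mset Re (image_mset complex_of_real (mset l))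
      = image_mset Re (image_mset complex_of_real (mset l'))" by simp
  then show ?thesis by (simp add: image_mset.compositionality comp_def)
qed

lemma sorted_ge_mset_unique:
  fixes l l' :: "real list"
  assumes "sorted_wrt (\<ge>) l" "sorted_wrt (\<ge>) l'" "mset l = mset l'"
  shows "l = l'"
proof -
  have "sorted (rev l)" "sorted (rev l')" using assms(1,2) by (simp_all add: sorted_wrt_rev)
  then have "rev l = rev l'" using assms(3) by (metis mset_rev properties_for_sort sorted_sort_id)
  then show ?thesis by simp
qed

lemma eig_desc_eqI:
  assumes "length l = dim_row S" "sorted_wrt (\<ge>) l" "char_poly S = (\<Prod>x\<leftarrow>l. [:- complex_of_real x, 1:])"
  shows "eig_desc S = l"
  unfolding eig_desc_def
  using assms mset_linear_factors_unique sorted_ge_mset_unique by (intro the_equality) metis+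

text \<open>The last conclusion allows every arrangement \<open>l\<close> of the spectrum, because
  the flag argument wants increasing eigenvalues whereas \<open>eig_desc\<close> is
  decreasing.\<close>

lemma hermitian_diagonalization:
  fixes A :: "complex mat"
  assumes A: "A \<in> carrier_mat n n" and herm: "mat_adjoint A = A"
  shows "length (eig_desc A) = n" "sorted_wrt (\<ge>) (eig_desc A)"
    "mset l = mset (eig_desc A) \<Longrightarrow> \<exists>U. unitary n U \<and> mat_adjoint U * A * U = real_diag n (\<lambda>i. l ! i)"
proof -
  obtain es where es: "char_poly A = (\<Prod>e\<leftarrow>es. [:- e, 1:])" "length es = n"
    using char_poly_factorized[OF A] by blast
  obtain U where "\<And>i. i < n \<Longrightarrow> es ! i = of_real (Re (es ! i))"
    using hermitian_diagonalization_list[OF A herm es(1)] by metis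
  then have es_eq: "es = map complex_of_real (map Re es)"
    using es(2) by (intro nth_equalityI) (simp_all del: of_real_eq_iff)
  define l0 where "l0 = rev (sort (map Re es))"
  have l0: "mset l0 = mset (map Re es)" by (simp add: l0_def)
  have prod: "char_poly A = (\<Prod>x\<leftarrow>l. [:- complex_of_real x, 1:])" if "mset l = mset (map Re es)" for l
  proof -
    have "char_poly A = prod_mset (image_mset (\<lambda>x. [:- complex_of_real x, 1:]) (mset (map Re es)))"
      by (subst es(1), subst es_eq)
        (simp add: prod_mset_prod_list[symmetric] image_mset.compositionality comp_def)
    also have "\<dots> = (\<Prod>x\<leftarrow>l. [:- complex_of_real x, 1:])"
      unfolding that[symmetric] by (simp add: prod_mset_prod_list[symmetric])
    finally show ?thesis .
  qed
  have sorted: "sorted_wrt (\<ge>) l0" by (simp add: l0_def sorted_wrt_rev)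
  have eig: "eig_desc A = l0"
    using A es(2) prod[OF l0] sorted by (intro eig_desc_eqI) (auto simp: l0_def)
  show "length (eig_desc A) = n" "sorted_wrt (\<ge>) (eig_desc A)" using eig sorted es(2) by (auto simp: l0_def)
  assume "mset l = mset (eig_desc A)"
  then have "mset l = mset (map Re es)" using eig l0 by simp
  from prod[OF this] have "char_poly A = (\<Prod>e\<leftarrow>map complex_of_real l. [:- e, 1:])" by (simp add: comp_def)
  from hermitian_diagonalization_list[OF A herm this]
  obtain U where U: "unitary n U" "length (map complex_of_real l) = n"
    "mat_adjoint U * A * U = real_diag n (\<lambda>i. Re (map complex_of_real l ! i))" by metis
  moreover have "real_diag n (\<lambda>i. Re (map complex_of_real l ! i)) = real_diag n (\<lambda>i. l ! i)"
    using U(2) by (intro eq_matI) auto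
  ultimately show "\<exists>U. unitary n U \<and> mat_adjoint U * A * U = real_diag n (\<lambda>i. l ! i)" by metis
qed

lemma eig_desc_unitary_conjugate:
  assumes A: "A \<in> carrier_mat n n" and U: "unitary n U"
    and eq: "mat_adjoint U * A * U = real_diag n (\<lambda>i. l ! i)" and len: "length l = n"
  shows "mset (eig_desc A) = mset l"
proof -
  let ?D = "real_diag n (\<lambda>i. l ! i)"
  note as = assoc_mult_mat[of _ n n _ n _ n] mult_carrier_mat[of _ n n _ n]
  have "U * ?D * mat_adjoint U = (U * mat_adjoint U) * A * (U * mat_adjoint U)"
    unfolding eq[symmetric] using A unitaryD(1)[OF U] by (simp add: as)
  then have "A = U * ?D * mat_adjoint U" using A unitaryD[OF U] by simp
  then have "similar_mat_wit A ?D U (mat_adjoint U)"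
    using A unitaryD[OF U] by (simp add: similar_mat_wit_def Let_def)
  then have "char_poly A = char_poly ?D" by (intro char_poly_similar) (auto simp: similar_mat_def)
  also have "\<dots> = (\<Prod>a\<leftarrow>diag_mat ?D. [:- a, 1:])"
    by (rule char_poly_upper_triangular[of _ n]) auto
  also have "diag_mat ?D = map complex_of_real l"
    using len by (intro nth_equalityI) (auto simp: diag_mat_def)
  also have "(\<Prod>a\<leftarrow>map complex_of_real l. [:- a, 1:]) = (\<Prod>x\<leftarrow>rev (sort l). [:- complex_of_real x, 1:])"
  proof -
    have "(\<Prod>x\<leftarrow>l. [:- complex_of_real x, 1:]) = prod_mset (image_mset (\<lambda>x. [:- complex_of_real x, 1:]) (mset l))"
      for l by (simp add: prod_mset_prod_list[symmetric])
    from this[of l] this[of "rev (sort l)"] show ?thesis by (simp add: comp_def)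
  qed
  finally have "eig_desc A = rev (sort l)"
    using A len by (intro eig_desc_eqI) (auto simp: sorted_wrt_rev)
  then show ?thesis by simp
qed

section \<open>Perturbation of frames\<close>

lemma tendsto_det:
  fixes A :: "nat \<Rightarrow> complex mat"
  assumes A: "\<And>n. A n \<in> carrier_mat d d" and B: "B \<in> carrier_mat d d"
    and lim: "\<And>i j. i < d \<Longrightarrow> j < d \<Longrightarrow> (\<lambda>n. A n $$ (i, j)) \<longlonglongrightarrow> B $$ (i, j)"
  shows "(\<lambda>n. det (A n)) \<longlonglongrightarrow> det B"
  unfolding det_def'[OF A] det_def'[OF B]
proof (intro tendsto_sum tendsto_mult tendsto_const tendsto_prod lim)
  fix p i assume "p \<in> {p. p permutes {0..<d}}" "i \<in> {0..<d}"
  then show "p i < d" using permutes_in_image[of p "{0..<d}" i] by simp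
qed simp

text \<open>\<open>F\<close> is the adjugate divided by the determinant. It is defined for every
  \<open>n\<close> and converges entrywise, but it is an inverse only where the determinant is
  nonzero, hence eventually.\<close>

lemma tendsto_inverse_mat:
  fixes A :: "nat \<Rightarrow> complex mat"
  assumes A: "\<And>n. A n \<in> carrier_mat d d" and B: "B \<in> carrier_mat d d"
    and lim: "\<And>i j. i < d \<Longrightarrow> j < d \<Longrightarrow> (\<lambda>n. A n $$ (i, j)) \<longlonglongrightarrow> B $$ (i, j)"
    and C: "C \<in> carrier_mat d d" "B * C = 1\<^sub>m d"
  shows "\<exists>F. (\<forall>n. F n \<in> carrier_mat d d) \<and> (\<forall>\<^sub>F n in sequentially. A n * F n = 1\<^sub>m d) \<and>
    (\<forall>i<d. \<forall>j<d. (\<lambda>n. F n $$ (i, j)) \<longlonglongrightarrow> C $$ (i, j))"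
proof -
  have detB: "det B \<noteq> 0"
    using det_mult[OF B C(1)] C(2) by auto
  have det_lim: "(\<lambda>n. det (A n)) \<longlonglongrightarrow> det B" by (rule tendsto_det[OF A B lim])
  define F where "F n = (1 / det (A n)) \<cdot>\<^sub>m adj_mat (A n)" for n
  have F: "F n \<in> carrier_mat d d" for n using adj_mat(1)[OF A] by (simp add: F_def)
  have "A n * F n = 1\<^sub>m d" if "det (A n) \<noteq> 0" for n
  proof -
    have "A n * F n = (1 / det (A n)) \<cdot>\<^sub>m (A n * adj_mat (A n))"
      using A adj_mat(1)[OF A] by (simp add: F_def mult_smult_distrib[of _ d d _ d])
    then show ?thesis using that by (simp add: adj_mat(2)[OF A]) (auto intro!: eq_matI)
  qed
  moreover have "\<forall>\<^sub>F n in sequentially. det (A n) \<noteq> 0"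
    using tendsto_imp_eventually_ne[OF det_lim detB] .
  ultimately have inv: "\<forall>\<^sub>F n in sequentially. A n * F n = 1\<^sub>m d" by (simp add: eventually_mono)
  have adjB: "adj_mat B = det B \<cdot>\<^sub>m C"
  proof -
    have "adj_mat B = adj_mat B * (B * C)" using adj_mat(1)[OF B] C by simp
    also have "\<dots> = (adj_mat B * B) * C"
      using adj_mat(1)[OF B] B C by (simp add: assoc_mult_mat[of _ d d _ d _ d])
    also have "\<dots> = det B \<cdot>\<^sub>m C" using C by (simp add: adj_mat(3)[OF B] mult_smult_assoc_mat[of _ d d _ d])
    finally show ?thesis .
  qed
  have "(\<lambda>n. F n $$ (i, j)) \<longlonglongrightarrow> C $$ (i, j)" if ij: "i < d" "j < d" for i j
  proof -
    have del: "mat_delete M j i $$ (p, q) = M $$ (if p < j then p else Suc p, if q < i then q else Suc q)"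
      if "M \<in> carrier_mat d d" "p < d - 1" "q < d - 1" for M :: "complex mat" and p q
      using that by (simp add: mat_delete_def)
    have "(\<lambda>n. cofactor (A n) j i) \<longlonglongrightarrow> cofactor B j i"
      unfolding cofactor_def
    proof (intro tendsto_mult tendsto_const tendsto_det)
      fix p q assume "p < d - 1" "q < d - 1"
      then show "(\<lambda>n. mat_delete (A n) j i $$ (p, q)) \<longlonglongrightarrow> mat_delete B j i $$ (p, q)"
        unfolding del[OF A \<open>p < d - 1\<close> \<open>q < d - 1\<close>] del[OF B \<open>p < d - 1\<close> \<open>q < d - 1\<close>]
        by (intro lim) auto
    qed (rule mat_delete_carrier[OF A] mat_delete_carrier[OF B])+
    then have "(\<lambda>n. 1 / det (A n) * cofactor (A n) j i) \<longlonglongrightarrow> 1 / det B * cofactor B j i"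
      using det_lim detB by (intro tendsto_intros)
    moreover have "F n $$ (i, j) = 1 / det (A n) * cofactor (A n) j i" for n
      using ij A[of n] by (simp add: F_def adj_mat_def)
    moreover have "1 / det B * cofactor B j i = C $$ (i, j)"
      using arg_cong[OF adjB, of "\<lambda>M. M $$ (i, j)"] ij B C detB by (simp add: adj_mat_def)
    ultimately show ?thesis by simp
  qed
  then show ?thesis using F inv by blast
qed

section \<open>Derivatives of traces and of the energy\<close>

lemma mtrace_mult:
  assumes "A \<in> carrier_mat n k" "B \<in> carrier_mat k n"
  shows "mtrace (A * B) = (\<Sum>a<n. \<Sum>b<k. A $$ (a, b) * B $$ (b, a))"
  unfolding mtrace_def using assms
  by (auto simp: index_mult_mat_sum[OF assms] simp del: index_mult_mat(1) intro!: sum.cong)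

lemma mtrace_mult_commute:
  assumes "A \<in> carrier_mat n k" "B \<in> carrier_mat k n"
  shows "mtrace (A * B) = mtrace (B * A)"
  unfolding mtrace_mult[OF assms] mtrace_mult[OF assms(2,1)]
  by (subst sum.swap) (simp add: mult.commute)

lemma trace_square_derivative:
  fixes A :: "nat \<Rightarrow> complex mat" and \<tau> :: "nat \<Rightarrow> real"
  assumes A: "\<And>n. A n \<in> carrier_mat d d" and B: "B \<in> carrier_mat d d"
    and lim: "\<And>a b. a < d \<Longrightarrow> b < d \<Longrightarrow> (\<lambda>n. A n $$ (a, b)) \<longlonglongrightarrow> B $$ (a, b)"
    and deriv: "\<And>a b. a < d \<Longrightarrow> b < d \<Longrightarrow>
      (\<lambda>n. (A n $$ (a, b) - B $$ (a, b)) / of_real (\<tau> n)) \<longlonglongrightarrow> D a b"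
  shows "(\<lambda>n. (mtrace (A n * A n) - mtrace (B * B)) / of_real (\<tau> n))
    \<longlonglongrightarrow> (\<Sum>a<d. \<Sum>b<d. D a b * B $$ (b, a) + B $$ (a, b) * D b a)"
proof -
  have "(mtrace (A n * A n) - mtrace (B * B)) / of_real (\<tau> n)
    = (\<Sum>a<d. \<Sum>b<d. (A n $$ (a, b) - B $$ (a, b)) / of_real (\<tau> n) * A n $$ (b, a)
        + B $$ (a, b) * ((A n $$ (b, a) - B $$ (b, a)) / of_real (\<tau> n)))" for n
    unfolding mtrace_mult[OF A A] mtrace_mult[OF B B] sum_subtractf[symmetric] sum_divide_distrib
    by (intro sum.cong refl) (simp add: diff_divide_distrib algebra_simps)
  moreover have "(\<lambda>n. \<Sum>a<d. \<Sum>b<d. (A n $$ (a, b) - B $$ (a, b)) / of_real (\<tau> n) * A n $$ (b, a)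
        + B $$ (a, b) * ((A n $$ (b, a) - B $$ (b, a)) / of_real (\<tau> n)))
    \<longlonglongrightarrow> (\<Sum>a<d. \<Sum>b<d. D a b * B $$ (b, a) + B $$ (a, b) * D b a)"
    by (intro tendsto_sum tendsto_add tendsto_mult tendsto_const lim deriv) auto
  ultimately show ?thesis by simp
qed

definition energy :: "complex mat \<Rightarrow> complex mat \<Rightarrow> real" where
  "energy S F = Re (mtrace (S * S)) + Re (mtrace (F * F))"

text \<open>To first order the inverse changes by \<open>- B a b / (w a * w b)\<close>, so the
  coefficient of \<open>B a a\<close> is \<open>2 * w a\<close> from the trace of the square of
  \<open>S\<close> and \<open>- 2 / w a ^ 3\<close> from that of \<open>F\<close>. The scale
  \<open>\<tau>\<close> is left free, so that the lemma serves variations of first and of second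
  order.\<close>

lemma energy_derivative:
  fixes S F :: "nat \<Rightarrow> complex mat" and \<tau> :: "nat \<Rightarrow> real"
  assumes w: "\<And>a. a < d \<Longrightarrow> w a > 0"
    and S: "\<And>n. S n \<in> carrier_mat d d" and F: "\<And>n. F n \<in> carrier_mat d d"
    and \<tau>: "\<And>n. \<tau> n > 0" "\<tau> \<longlonglongrightarrow> 0"
    and inv: "\<And>n. S n * F n = 1\<^sub>m d"
    and F_lim: "\<And>a b. a < d \<Longrightarrow> b < d \<Longrightarrow>
      (\<lambda>n. F n $$ (a, b)) \<longlonglongrightarrow> real_diag d (\<lambda>a. 1 / w a) $$ (a, b)"
    and deriv: "\<And>a b. a < d \<Longrightarrow> b < d \<Longrightarrow>
      (\<lambda>n. (S n $$ (a, b) - real_diag d w $$ (a, b)) / of_real (\<tau> n)) \<longlonglongrightarrow> B a b"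
  shows "(\<lambda>n. (energy (S n) (F n) - energy (real_diag d w) (real_diag d (\<lambda>a. 1 / w a))) / \<tau> n)
    \<longlonglongrightarrow> 2 * (\<Sum>a<d. (w a - 1 / w a ^ 3) * Re (B a a))"
proof -
  let ?L = "real_diag d w" and ?L' = "real_diag d (\<lambda>a. 1 / w a)"
  have S_lim: "(\<lambda>n. S n $$ (a, b)) \<longlonglongrightarrow> ?L $$ (a, b)" if "a < d" "b < d" for a b
  proof -
    have "(\<lambda>n. of_real (\<tau> n) * ((S n $$ (a, b) - ?L $$ (a, b)) / of_real (\<tau> n)) + ?L $$ (a, b))
        \<longlonglongrightarrow> of_real 0 * B a b + ?L $$ (a, b)"
      using that by (intro tendsto_add tendsto_mult tendsto_of_real \<tau> deriv tendsto_const)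
    moreover have "of_real (\<tau> n) * ((S n $$ (a, b) - ?L $$ (a, b)) / of_real (\<tau> n)) + ?L $$ (a, b)
        = S n $$ (a, b)" for n using \<tau>(1)[of n] by simp
    ultimately show ?thesis by simp
  qed
  \<comment> \<open>Entrywise form of \<open>F - L^{-1} = - L^{-1} (S - L) F\<close> with
    \<open>L\<close> the diagonal matrix of \<open>w\<close>; it reduces the derivative of
    \<open>F\<close> to that of \<open>S\<close> and the limit of \<open>F\<close>.\<close>
  have F_diff: "F n $$ (a, b) - ?L' $$ (a, b)
      = - (1 / of_real (w a)) * (\<Sum>c<d. (S n $$ (a, c) - ?L $$ (a, c)) * F n $$ (c, b))"
    if ab: "a < d" "b < d" for n a b
  proof -
    have "(\<Sum>c<d. S n $$ (a, c) * F n $$ (c, b)) = of_bool (a = b)"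
      using arg_cong[OF inv[of n], of "\<lambda>M. M $$ (a, b)"] ab index_mult_mat_sum[OF S F ab, of n n]
      by simp
    moreover have "(\<Sum>c<d. ?L $$ (a, c) * F n $$ (c, b)) = of_real (w a) * F n $$ (a, b)"
      using ab by (subst sum_eq_single[of a]) auto
    ultimately show ?thesis
      using ab w[OF ab(1)] w[OF ab(2)] by (simp add: left_diff_distrib sum_subtractf field_simps)
  qed
  have F_deriv: "(\<lambda>n. (F n $$ (a, b) - ?L' $$ (a, b)) / of_real (\<tau> n))
      \<longlonglongrightarrow> - (1 / of_real (w a)) * B a b * (1 / of_real (w b))" if ab: "a < d" "b < d" for a b
  proof -
    have "(\<lambda>n. - (1 / of_real (w a)) * (\<Sum>c<d. (S n $$ (a, c) - ?L $$ (a, c)) / of_real (\<tau> n) * F n $$ (c, b)))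
        \<longlonglongrightarrow> - (1 / of_real (w a)) * (\<Sum>c<d. B a c * ?L' $$ (c, b))"
      using ab by (intro tendsto_mult tendsto_const tendsto_sum deriv F_lim) auto
    moreover have "(\<Sum>c<d. B a c * ?L' $$ (c, b)) = B a b * (1 / of_real (w b))"
      using ab by (subst sum_eq_single[of b]) auto
    moreover have "(F n $$ (a, b) - ?L' $$ (a, b)) / of_real (\<tau> n)
        = - (1 / of_real (w a)) * (\<Sum>c<d. (S n $$ (a, c) - ?L $$ (a, c)) / of_real (\<tau> n) * F n $$ (c, b))" for n
      unfolding F_diff[OF ab] times_divide_eq_right[symmetric] sum_divide_distrib by simp
    ultimately show ?thesis by (simp only: mult.assoc)
  qed
  have diag: "(\<Sum>a<d. \<Sum>b<d. D a b * real_diag d u $$ (b, a) + real_diag d u $$ (a, b) * D b a)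
      = (\<Sum>a<d. 2 * of_real (u a) * D a a)" for D u
  proof (intro sum.cong refl)
    fix a assume "a \<in> {..<d}"
    then show "(\<Sum>b<d. D a b * real_diag d u $$ (b, a) + real_diag d u $$ (a, b) * D b a)
        = 2 * of_real (u a) * D a a"
      by (subst sum_eq_single[of a]) auto
  qed
  have "(\<lambda>n. Re ((mtrace (S n * S n) - mtrace (?L * ?L)) / of_real (\<tau> n))
      + Re ((mtrace (F n * F n) - mtrace (?L' * ?L')) / of_real (\<tau> n)))
    \<longlonglongrightarrow> Re (\<Sum>a<d. 2 * of_real (w a) * B a a)
      + Re (\<Sum>a<d. 2 * of_real (1 / w a) * (- (1 / of_real (w a)) * B a a * (1 / of_real (w a))))"
    using trace_square_derivative[OF S real_diag_carrier S_lim deriv]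
      trace_square_derivative[OF F real_diag_carrier F_lim F_deriv]
    unfolding diag by (intro tendsto_add tendsto_Re)
  also have "Re (\<Sum>a<d. 2 * of_real (w a) * B a a)
      + Re (\<Sum>a<d. 2 * of_real (1 / w a) * (- (1 / of_real (w a)) * B a a * (1 / of_real (w a))))
      = 2 * (\<Sum>a<d. (w a - 1 / w a ^ 3) * Re (B a a))"
    unfolding Re_sum sum.distrib[symmetric] sum_distrib_left
  proof (intro sum.cong refl)
    fix a assume "a \<in> {..<d}"
    have "2 * complex_of_real (1 / w a) * (- (1 / of_real (w a)) * B a a * (1 / of_real (w a)))
        = of_real (- 2 / w a ^ 3) * B a a"
      by (simp add: power3_eq_cube)
    moreover have "Re (2 * of_real (w a) * B a a) = 2 * w a * Re (B a a)"
      "Re (of_real (- 2 / w a ^ 3) * B a a) = - 2 / w a ^ 3 * Re (B a a)" by simp_all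
    ultimately show "Re (2 * of_real (w a) * B a a)
        + Re (2 * of_real (1 / w a) * (- (1 / of_real (w a)) * B a a * (1 / of_real (w a))))
        = 2 * ((w a - 1 / w a ^ 3) * Re (B a a))"
      by (simp only:) (simp add: algebra_simps)
  qed
  also have "(\<lambda>n. Re ((mtrace (S n * S n) - mtrace (?L * ?L)) / of_real (\<tau> n))
      + Re ((mtrace (F n * F n) - mtrace (?L' * ?L')) / of_real (\<tau> n)))
    = (\<lambda>n. (energy (S n) (F n) - energy ?L ?L') / \<tau> n)"
    by (simp add: energy_def add_divide_distrib[symmetric] fun_eq_iff)
  finally show ?thesis .
qed

text \<open>The coefficients of \<open>t\<close> and \<open>t\<^sup>2\<close> in \<open>Q Q\<^sup>*\<close> when \<open>Q\<close> is obtained from \<open>X + t Y\<close> by orthonormalising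
  the columns and rescaling them to length \<open>v\<close> (for \<open>X\<^sup>* X = v\<^sup>2\<close> and \<open>X\<^sup>* Y = 0\<close>).\<close>

definition tangent_term :: "complex mat \<Rightarrow> complex mat \<Rightarrow> nat \<Rightarrow> nat \<Rightarrow> complex" where
  "tangent_term X Y a b = (Y * mat_adjoint X) $$ (a, b) + (X * mat_adjoint Y) $$ (a, b)"

definition curvature_term :: "nat \<Rightarrow> real \<Rightarrow> complex mat \<Rightarrow> complex mat \<Rightarrow> nat \<Rightarrow> nat \<Rightarrow> complex" where
  "curvature_term k v X Y a b = (Y * mat_adjoint Y) $$ (a, b)
    - (\<Sum>p<k. \<Sum>q<k. X $$ (a, p) * (mat_adjoint Y * Y) $$ (p, q) * cnj (X $$ (b, q))) / of_real (v\<^sup>2)"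

text \<open>\<open>Q = v (X + t Y) r\<close> with \<open>r\<close> triangular and
  \<open>r r^*\<close> inverse to \<open>N = v^2 + t^2 Y^* Y\<close>; the condition
  \<open>X^* Y = 0\<close> removes the term linear in \<open>t\<close> from \<open>N\<close>. As
  \<open>Q Q^*\<close> contains \<open>r\<close> only through \<open>r r^*\<close>, the expansion
  \<open>v^2 N^{-1} = 1 - t^2 Y^* Y / v^2 + ...\<close> gives both coefficients.\<close>

lemma orthonormal_perturbation:
  fixes X Y :: "complex mat" and v :: real
  assumes X: "X \<in> carrier_mat d k" and Y: "Y \<in> carrier_mat d k" and v: "v > 0"
    and XX: "mat_adjoint X * X = of_real (v\<^sup>2) \<cdot>\<^sub>m 1\<^sub>m k" and XY: "mat_adjoint X * Y = 0\<^sub>m k k"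
  defines "t \<equiv> \<lambda>n. 1 / real (Suc n)"
  shows "\<exists>Q. (\<forall>n. Q n \<in> carrier_mat d k \<and> mat_adjoint (Q n) * Q n = of_real (v\<^sup>2) \<cdot>\<^sub>m 1\<^sub>m k) \<and>
    (\<forall>a<d. \<forall>b<d. (\<lambda>n. ((Q n * mat_adjoint (Q n)) $$ (a, b) - (X * mat_adjoint X) $$ (a, b)
        - of_real (t n) * tangent_term X Y a b) / of_real ((t n)\<^sup>2))
      \<longlonglongrightarrow> curvature_term k v X Y a b)"
proof -
  have t: "t n > 0" for n by (simp add: t_def)
  have t_lim: "t \<longlonglongrightarrow> 0" unfolding t_def by (rule LIMSEQ_Suc[OF lim_1_over_n])
  note mc = mult_carrier_mat[of _ k k _ k] mult_carrier_mat[of _ k d _ k] mult_carrier_mat[of _ d k _ k]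
  define c where "c n = complex_of_real (t n)" for n
  define V where "V = complex_of_real (v\<^sup>2)"
  have V: "V \<noteq> 0" using v by (simp add: V_def)
  define G where "G = mat_adjoint Y * Y"
  have G: "G \<in> carrier_mat k k" using Y by (simp add: G_def mc)
  define N where "N n = V \<cdot>\<^sub>m 1\<^sub>m k + (c n)\<^sup>2 \<cdot>\<^sub>m G" for n
  have N: "N n \<in> carrier_mat k k" for n using G by (simp add: N_def)
  have "\<exists>r. r \<in> carrier_mat k k \<and> mat_adjoint r * (N n * r) = 1\<^sub>m k" for n
  proof -
    have "c n \<cdot>\<^sub>m Y \<in> carrier_mat d k" using Y by simp
    then obtain r where "r \<in> carrier_mat k k"
      "mat_adjoint r * ((of_real (v\<^sup>2) \<cdot>\<^sub>m 1\<^sub>m k + mat_adjoint (c n \<cdot>\<^sub>m Y) * (c n \<cdot>\<^sub>m Y)) * r) = 1\<^sub>m k"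
      using gram_triangular_orthonormalization[of "c n \<cdot>\<^sub>m Y" d k "v\<^sup>2"] v by (metis zero_le_power2 zero_less_power)
    moreover have "mat_adjoint (c n \<cdot>\<^sub>m Y) * (c n \<cdot>\<^sub>m Y) = (c n)\<^sup>2 \<cdot>\<^sub>m G"
      using Y by (simp add: adjoint_smult G_def c_def power2_eq_square
        mult_smult_assoc_mat[of _ k d _ k] mult_smult_distrib[of _ k d _ k] smult_smult_times)
    ultimately show ?thesis unfolding N_def V_def by metis
  qed
  then obtain r where r: "\<And>n. r n \<in> carrier_mat k k" "\<And>n. mat_adjoint (r n) * (N n * r n) = 1\<^sub>m k" by metis
  define A where "A n = X + c n \<cdot>\<^sub>m Y" for n
  have A: "A n \<in> carrier_mat d k" for n using X Y by (simp add: A_def)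
  have YX: "mat_adjoint Y * X = 0\<^sub>m k k"
  proof -
    have "mat_adjoint Y * X = mat_adjoint (mat_adjoint X * Y)" using X Y by (simp add: adjoint_mult[of _ k d _ k])
    then show ?thesis unfolding XY by (auto intro!: eq_matI)
  qed
  have AA: "mat_adjoint (A n) * A n = N n" for n
  proof -
    have adj: "mat_adjoint (A n) = mat_adjoint X + c n \<cdot>\<^sub>m mat_adjoint Y"
      using X Y by (simp add: A_def adjoint_add[of _ d k] adjoint_smult c_def)
    have "mat_adjoint (A n) * A n = (mat_adjoint X * X + c n \<cdot>\<^sub>m (mat_adjoint Y * X))
        + c n \<cdot>\<^sub>m (mat_adjoint X * Y + c n \<cdot>\<^sub>m (mat_adjoint Y * Y))"
      unfolding adj unfolding A_def using X Y
      by (simp add: add_mult_distrib_mat[of _ k d _ _ k] mult_add_distrib_mat[of _ k d _ k]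
        mult_smult_assoc_mat[of _ k d _ k] mult_smult_distrib[of _ k d _ k] smult_smult_times)
    also have "\<dots> = N n" unfolding XX XY YX using G
      by (auto intro!: eq_matI simp: N_def V_def G_def power2_eq_square)
    finally show ?thesis .
  qed
  define Q where "Q n = of_real v \<cdot>\<^sub>m (A n * r n)" for n
  have Q: "Q n \<in> carrier_mat d k" for n using A r by (simp add: Q_def mc)
  have QQ: "mat_adjoint (Q n) * Q n = of_real (v\<^sup>2) \<cdot>\<^sub>m 1\<^sub>m k" for n
  proof -
    have "mat_adjoint (A n * r n) * (A n * r n) = mat_adjoint (r n) * ((mat_adjoint (A n) * A n) * r n)"
      using A[of n] r(1)[of n]
      by (simp add: adjoint_mult[of _ d k _ k] assoc_mult_mat[of _ k d _ k _ k] assoc_mult_mat[of _ k k _ d _ k] mc)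
    also have "\<dots> = 1\<^sub>m k" unfolding AA by (rule r(2))
    finally have *: "mat_adjoint (A n * r n) * (A n * r n) = 1\<^sub>m k" .
    have Ar: "A n * r n \<in> carrier_mat d k" using A r by (simp add: mc)
    have "mat_adjoint (Q n) * Q n = of_real v \<cdot>\<^sub>m (of_real v \<cdot>\<^sub>m (mat_adjoint (A n * r n) * (A n * r n)))"
      using Ar by (simp add: Q_def adjoint_smult mult_smult_assoc_mat[of _ k d _ k] mult_smult_distrib[of _ k d _ k])
    then show ?thesis unfolding * by (simp add: smult_smult_times power2_eq_square)
  qed
  define M where "M n = V \<cdot>\<^sub>m (r n * mat_adjoint (r n))" for n
  have M: "M n \<in> carrier_mat k k" for n using r by (simp add: M_def mc)
  have NM: "N n * M n = V \<cdot>\<^sub>m 1\<^sub>m k" for n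
  proof -
    have "(N n * r n) * mat_adjoint (r n) = 1\<^sub>m k"
      using r(1)[of n] N[of n] by (intro mult_left_inverse_commute[OF _ _ r(2)]) (simp_all add: mc)
    then show ?thesis using r(1)[of n] N[of n]
      by (simp add: M_def mult_smult_distrib[of _ k k _ k] assoc_mult_mat[of _ k k _ k _ k] mc)
  qed
  have M_lim: "(\<lambda>n. M n $$ (p, q)) \<longlonglongrightarrow> of_bool (p = q)" if pq: "p < k" "q < k" for p q
  proof -
    have "\<exists>F. (\<forall>n. F n \<in> carrier_mat k k) \<and> (\<forall>\<^sub>F n in sequentially. N n * F n = 1\<^sub>m k) \<and>
      (\<forall>i<k. \<forall>j<k. (\<lambda>n. F n $$ (i, j)) \<longlonglongrightarrow> ((1 / V) \<cdot>\<^sub>m 1\<^sub>m k) $$ (i, j))"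
    proof (rule tendsto_inverse_mat[OF N, where B = "V \<cdot>\<^sub>m 1\<^sub>m k"])
      fix i j assume ij: "i < k" "j < k"
      have "(\<lambda>n. V * of_bool (i = j) + (c n)\<^sup>2 * G $$ (i, j)) \<longlonglongrightarrow> V * of_bool (i = j) + (of_real 0)\<^sup>2 * G $$ (i, j)"
        unfolding c_def by (intro tendsto_intros t_lim)
      then show "(\<lambda>n. N n $$ (i, j)) \<longlonglongrightarrow> (V \<cdot>\<^sub>m 1\<^sub>m k) $$ (i, j)"
        using ij G by (auto simp: N_def split: if_splits)
    next
      show "V \<cdot>\<^sub>m 1\<^sub>m k * ((1 / V) \<cdot>\<^sub>m 1\<^sub>m k) = 1\<^sub>m k"
        using V by (simp add: mult_smult_assoc_mat[of _ k k _ k] smult_smult_times) (auto intro!: eq_matI)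
    qed auto
    then obtain F where F: "\<And>n. F n \<in> carrier_mat k k" "\<forall>\<^sub>F n in sequentially. N n * F n = 1\<^sub>m k"
      "(\<lambda>n. F n $$ (p, q)) \<longlonglongrightarrow> ((1 / V) \<cdot>\<^sub>m 1\<^sub>m k) $$ (p, q)" using pq by blast
    have "\<forall>\<^sub>F n in sequentially. V * F n $$ (p, q) = M n $$ (p, q)"
      using F(2)
    proof eventually_elim
      case (elim n)
      have FN: "F n * N n = 1\<^sub>m k" by (rule mult_left_inverse_commute[OF N F(1) elim])
      have "M n = (F n * N n) * M n" unfolding FN using M[of n] by simp
      also have "\<dots> = V \<cdot>\<^sub>m F n" using NM[of n] F(1)[of n] N[of n] M[of n]
        by (simp add: assoc_mult_mat[of _ k k _ k _ k] mult_smult_distrib[of _ k k _ k])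
      finally show ?case using pq F(1)[of n] by simp
    qed
    moreover have "(\<lambda>n. V * F n $$ (p, q)) \<longlonglongrightarrow> V * ((1 / V) \<cdot>\<^sub>m 1\<^sub>m k) $$ (p, q)"
      by (intro tendsto_intros F)
    moreover have "V * ((1 / V) \<cdot>\<^sub>m 1\<^sub>m k) $$ (p, q) = of_bool (p = q)" using pq V by simp
    ultimately show ?thesis using Lim_transform_eventually by fastforce
  qed
  \<comment> \<open>The exact identity \<open>M = 1 + t^2 E\<close>, read off from
    \<open>N M = v^2\<close>, replaces a power series for the inverse; for the expansion it is
    enough to know the limit of \<open>E\<close>.\<close>
  define E where "E n p q = - (\<Sum>l<k. G $$ (p, l) * M n $$ (l, q)) / V" for n p q
  have M_E: "M n $$ (p, q) = of_bool (p = q) + (c n)\<^sup>2 * E n p q" if pq: "p < k" "q < k" for n p q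
  proof -
    have "V * of_bool (p = q) = (N n * M n) $$ (p, q)" using NM[of n] pq by simp
    also have "\<dots> = (\<Sum>l<k. V * (of_bool (p = l) * M n $$ (l, q)) + (c n)\<^sup>2 * (G $$ (p, l) * M n $$ (l, q)))"
      unfolding index_mult_mat_sum[OF N M pq] using pq G
      by (intro sum.cong refl) (auto simp: N_def algebra_simps)
    also have "\<dots> = V * M n $$ (p, q) + (c n)\<^sup>2 * (\<Sum>l<k. G $$ (p, l) * M n $$ (l, q))"
      unfolding sum.distrib sum_distrib_left[symmetric] using pq by (subst sum_of_bool_eq_mult(1)) auto
    finally show ?thesis using V by (simp add: E_def field_simps)
  qed
  have E_lim: "(\<lambda>n. E n p q) \<longlonglongrightarrow> - G $$ (p, q) / V" if pq: "p < k" "q < k" for p q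
  proof -
    have "(\<lambda>n. E n p q) \<longlonglongrightarrow> - (\<Sum>l<k. G $$ (p, l) * of_bool (l = q)) / V"
      unfolding E_def using pq V by (intro tendsto_divide tendsto_minus tendsto_sum tendsto_mult tendsto_const M_lim) auto
    moreover have "(\<Sum>l<k. G $$ (p, l) * of_bool (l = q)) = G $$ (p, q)"
      using pq by (intro sum_of_bool_eq_mult(2)) auto
    ultimately show ?thesis by simp
  qed
  define bil where "bil K Z W a b = (\<Sum>p<k. \<Sum>q<k. Z $$ (a, p) * K p q * cnj (W $$ (b, q)))"
    for K :: "nat \<Rightarrow> nat \<Rightarrow> complex" and Z W :: "complex mat" and a b
  have bil_one: "bil (\<lambda>p q. of_bool (p = q)) Z W a b = (Z * mat_adjoint W) $$ (a, b)"
    if "Z \<in> carrier_mat d k" "W \<in> carrier_mat d k" "a < d" "b < d" for Z W a b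
  proof -
    have "bil (\<lambda>p q. of_bool (p = q)) Z W a b = (\<Sum>p<k. \<Sum>q<k. of_bool (p = q) * (Z $$ (a, p) * cnj (W $$ (b, q))))"
      unfolding bil_def by (intro sum.cong refl) simp
    also have "\<dots> = (\<Sum>p<k. Z $$ (a, p) * cnj (W $$ (b, p)))"
      by (intro sum.cong refl sum_of_bool_eq_mult(1)) auto
    also have "\<dots> = (Z * mat_adjoint W) $$ (a, b)"
      using that by (simp add: index_mult_mat_sum[of _ d k _ d] del: index_mult_mat(1))
    finally show ?thesis .
  qed
  have expand: "(Q n * mat_adjoint (Q n)) $$ (a, b) = (X * mat_adjoint X) $$ (a, b)
      + c n * tangent_term X Y a b
      + (c n)\<^sup>2 * (bil (E n) X X a b + bil (\<lambda>p q. M n $$ (p, q)) Y Y a b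
        + c n * (bil (E n) Y X a b + bil (E n) X Y a b))"
    if ab: "a < d" "b < d" for n a b
  proof -
    have "Q n * mat_adjoint (Q n) = A n * (M n * mat_adjoint (A n))"
    proof -
      have Ar: "A n * r n \<in> carrier_mat d k" using A r by (simp add: mc)
      have vv: "of_real v * of_real v = V" by (simp add: V_def power2_eq_square)
      have "Q n * mat_adjoint (Q n) = of_real v \<cdot>\<^sub>m (of_real v \<cdot>\<^sub>m ((A n * r n) * mat_adjoint (A n * r n)))"
        using Ar by (simp add: Q_def adjoint_smult mult_smult_assoc_mat[of _ d k _ d] mult_smult_distrib[of _ d k _ d])
      also have "(A n * r n) * mat_adjoint (A n * r n) = A n * ((r n * mat_adjoint (r n)) * mat_adjoint (A n))"
        using A[of n] r(1)[of n]
        by (simp add: adjoint_mult[of _ d k _ k] assoc_mult_mat[of _ d k _ k _ d] assoc_mult_mat[of _ k k _ k _ d]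
          mult_carrier_mat[of _ k k _ d])
      finally show ?thesis using A[of n] r(1)[of n]
        by (simp add: M_def smult_smult_times vv mult_smult_distrib[of _ d k _ d]
          mult_smult_assoc_mat[of _ k k _ d] mc mult_carrier_mat[of _ k k _ d])
    qed
    then have "(Q n * mat_adjoint (Q n)) $$ (a, b) = bil (\<lambda>p q. M n $$ (p, q)) (A n) (A n) a b"
      using ab A[of n] M[of n]
      by (auto simp: index_mult_mat_sum[of _ d k _ d] index_mult_mat_sum[of _ k k _ d] bil_def
        mult_carrier_mat[of _ k k _ d] sum_distrib_left mult.assoc simp del: index_mult_mat(1) intro!: sum.cong)
    also have "\<dots> = bil (\<lambda>p q. of_bool (p = q)) X X a b
      + c n * (bil (\<lambda>p q. of_bool (p = q)) Y X a b + bil (\<lambda>p q. of_bool (p = q)) X Y a b)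
      + (c n)\<^sup>2 * (bil (E n) X X a b + bil (\<lambda>p q. M n $$ (p, q)) Y Y a b
        + c n * (bil (E n) Y X a b + bil (E n) X Y a b))"
      unfolding bil_def sum_distrib_left sum.distrib[symmetric]
    proof (intro sum.cong refl)
      fix p q assume "p \<in> {..<k}" "q \<in> {..<k}"
      then have pq: "p < k" "q < k" by auto
      have Aidx: "A n $$ (a, p) = X $$ (a, p) + c n * Y $$ (a, p)"
        "cnj (A n $$ (b, q)) = cnj (X $$ (b, q)) + c n * cnj (Y $$ (b, q))"
        using ab pq X Y by (auto simp: A_def c_def)
      have ring: "(x + c * y) * (u + c\<^sup>2 * e) * (x' + c * y') = x * u * x' + c * (y * u * x' + x * u * y')
        + c\<^sup>2 * (x * e * x' + y * (u + c\<^sup>2 * e) * y' + c * (y * e * x' + x * e * y'))"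
        for x y x' y' u e c :: complex by (simp add: algebra_simps power2_eq_square)
      show "A n $$ (a, p) * M n $$ (p, q) * cnj (A n $$ (b, q))
        = X $$ (a, p) * of_bool (p = q) * cnj (X $$ (b, q))
        + c n * (Y $$ (a, p) * of_bool (p = q) * cnj (X $$ (b, q)) + X $$ (a, p) * of_bool (p = q) * cnj (Y $$ (b, q)))
        + (c n)\<^sup>2 * (X $$ (a, p) * E n p q * cnj (X $$ (b, q)) + Y $$ (a, p) * M n $$ (p, q) * cnj (Y $$ (b, q))
          + c n * (Y $$ (a, p) * E n p q * cnj (X $$ (b, q)) + X $$ (a, p) * E n p q * cnj (Y $$ (b, q))))"
        unfolding Aidx M_E[OF pq] by (rule ring)
    qed
    finally show ?thesis using ab X Y by (simp add: bil_one tangent_term_def)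
  qed
  have limit: "(\<lambda>n. ((Q n * mat_adjoint (Q n)) $$ (a, b) - (X * mat_adjoint X) $$ (a, b)
      - of_real (t n) * tangent_term X Y a b) / of_real ((t n)\<^sup>2))
    \<longlonglongrightarrow> curvature_term k v X Y a b"
    if ab: "a < d" "b < d" for a b
  proof -
    have eq: "((Q n * mat_adjoint (Q n)) $$ (a, b) - (X * mat_adjoint X) $$ (a, b)
      - of_real (t n) * tangent_term X Y a b) / of_real ((t n)\<^sup>2)
      = bil (E n) X X a b + bil (\<lambda>p q. M n $$ (p, q)) Y Y a b + c n * (bil (E n) Y X a b + bil (E n) X Y a b)" for n
      unfolding expand[OF ab] using t[of n] by (simp add: c_def)
    have bil_lim: "(\<lambda>n. bil (K n) Z W a b) \<longlonglongrightarrow> bil K0 Z W a b"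
      if "\<And>p q. p < k \<Longrightarrow> q < k \<Longrightarrow> (\<lambda>n. K n p q) \<longlonglongrightarrow> K0 p q" for K K0 Z W
      unfolding bil_def by (intro tendsto_sum tendsto_mult tendsto_const that) auto
    have "(\<lambda>n. bil (E n) X X a b + bil (\<lambda>p q. M n $$ (p, q)) Y Y a b + c n * (bil (E n) Y X a b + bil (E n) X Y a b))
      \<longlonglongrightarrow> bil (\<lambda>p q. - G $$ (p, q) / V) X X a b + bil (\<lambda>p q. of_bool (p = q)) Y Y a b
        + of_real 0 * (bil (\<lambda>p q. - G $$ (p, q) / V) Y X a b + bil (\<lambda>p q. - G $$ (p, q) / V) X Y a b)"
      unfolding c_def by (intro tendsto_add tendsto_mult tendsto_of_real t_lim bil_lim E_lim M_lim)
    moreover have "bil (\<lambda>p q. - G $$ (p, q) / V) X X a b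
        = - (\<Sum>p<k. \<Sum>q<k. X $$ (a, p) * (mat_adjoint Y * Y) $$ (p, q) * cnj (X $$ (b, q))) / of_real (v\<^sup>2)"
      unfolding bil_def G_def[symmetric] V_def[symmetric] sum_negf[symmetric] sum_divide_distrib
      by (intro sum.cong refl) simp
    ultimately show ?thesis unfolding eq using bil_one[OF Y Y ab] by (simp add: curvature_term_def)
  qed
  show ?thesis using Q QQ limit by blast
qed

section \<open>Critical points\<close>

definition frame_op :: "nat \<Rightarrow> nat \<Rightarrow> (nat \<Rightarrow> complex mat) \<Rightarrow> complex mat" where
  "frame_op m d Q = mat d d (\<lambda>(a, b). \<Sum>i<m. (Q i * mat_adjoint (Q i)) $$ (a, b))"

lemma frame_op_carrier [simp]: "frame_op m d Q \<in> carrier_mat d d"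
  and frame_op_dim [simp]: "dim_row (frame_op m d Q) = d" "dim_col (frame_op m d Q) = d"
  and frame_op_index: "a < d \<Longrightarrow> b < d \<Longrightarrow>
    frame_op m d Q $$ (a, b) = (\<Sum>i<m. (Q i * mat_adjoint (Q i)) $$ (a, b))"
  by (auto simp: frame_op_def)

definition tight_family :: "nat \<Rightarrow> nat \<Rightarrow> (nat \<Rightarrow> nat) \<Rightarrow> (nat \<Rightarrow> real) \<Rightarrow> (nat \<Rightarrow> complex mat) \<Rightarrow> bool" where
  "tight_family m d k v Q \<longleftrightarrow> (\<forall>i<m. Q i \<in> carrier_mat d (k i) \<and>
     mat_adjoint (Q i) * Q i = of_real ((v i)\<^sup>2) \<cdot>\<^sub>m 1\<^sub>m (k i))"

definition entry_close :: "nat \<Rightarrow> real \<Rightarrow> complex mat \<Rightarrow> complex mat \<Rightarrow> bool" where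
  "entry_close d \<epsilon> A B \<longleftrightarrow> (\<forall>a<d. \<forall>b<d. cmod (A $$ (a, b) - B $$ (a, b)) < \<epsilon>)"

text \<open>The local minimality of \<open>(V, V\<^sup>#)\<close> in the coordinates in which \<open>S\<^sub>V\<close> is the diagonal matrix of \<open>w\<close>;
  \<open>F\<close> plays the role of \<open>S\<^sub>V\<^sup>-\<^sup>1\<close>.\<close>

definition diagonal_local_min :: "nat \<Rightarrow> nat \<Rightarrow> (nat \<Rightarrow> nat) \<Rightarrow> (nat \<Rightarrow> real) \<Rightarrow> (nat \<Rightarrow> real) \<Rightarrow> bool" where
  "diagonal_local_min m d k v w \<longleftrightarrow> (\<exists>\<epsilon>>0. \<forall>Q F. tight_family m d k v Q \<longrightarrow> F \<in> carrier_mat d d \<longrightarrow>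
     frame_op m d Q * F = 1\<^sub>m d \<longrightarrow> entry_close d \<epsilon> (frame_op m d Q) (real_diag d w) \<longrightarrow>
     entry_close d \<epsilon> F (real_diag d (\<lambda>a. 1 / w a)) \<longrightarrow>
     energy (real_diag d w) (real_diag d (\<lambda>a. 1 / w a)) \<le> energy (frame_op m d Q) F)"

lemma entry_close_eventually:
  assumes "\<And>a b. a < d \<Longrightarrow> b < d \<Longrightarrow> (\<lambda>n. A n $$ (a, b)) \<longlonglongrightarrow> B $$ (a, b)" "\<epsilon> > 0"
  shows "\<forall>\<^sub>F n in sequentially. entry_close d \<epsilon> (A n) B"
proof -
  have "\<forall>\<^sub>F n in sequentially. \<forall>p\<in>{..<d} \<times> {..<d}. cmod (A n $$ p - B $$ p) < \<epsilon>"
  proof (rule eventually_ball_finite)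
    show "\<forall>p\<in>{..<d} \<times> {..<d}. \<forall>\<^sub>F n in sequentially. cmod (A n $$ p - B $$ p) < \<epsilon>"
      using assms by (auto simp: dist_norm[symmetric] intro: tendstoD)
  qed simp
  then show ?thesis by eventually_elim (auto simp: entry_close_def)
qed

text \<open>Half the derivative of \<open>x\<^sup>2 + x\<^sup>-\<^sup>2\<close>.\<close>

definition potential_slope :: "real \<Rightarrow> real" where
  "potential_slope x = x - 1 / x ^ 3"

lemma potential_slope_strict_mono: "0 < x \<Longrightarrow> x < y \<Longrightarrow> potential_slope x < potential_slope y"
proof -
  assume "0 < x" "x < y"
  then have "1 / y ^ 3 < 1 / x ^ 3" by (intro divide_strict_left_mono power_strict_mono) auto
  then show ?thesis using \<open>x < y\<close> by (simp add: potential_slope_def)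
qed

lemma potential_slope_less_iff: "0 < x \<Longrightarrow> 0 < y \<Longrightarrow> potential_slope x < potential_slope y \<longleftrightarrow> x < y"
  using potential_slope_strict_mono[of x y] potential_slope_strict_mono[of y x]
  by (cases x y rule: linorder_cases) auto

text \<open>Along \<open>Q n\<close> the energy difference divided by \<open>\<tau> n\<close> is
  eventually nonnegative, and by \<open>energy_derivative\<close> it converges to twice the sum.
  What enters is the velocity \<open>B\<close> on the scale \<open>\<tau>\<close>: the first
  variation takes \<open>\<tau> = t\<close>, the second \<open>\<tau> = t^2\<close>.\<close>

lemma local_min_variation:
  assumes min: "diagonal_local_min m d k v w" and w: "\<And>a. a < d \<Longrightarrow> w a > 0"
    and Q: "\<And>n. tight_family m d k v (Q n)"
    and \<tau>: "\<And>n. \<tau> n > 0" "\<tau> \<longlonglongrightarrow> 0"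
    and deriv: "\<And>a b. a < d \<Longrightarrow> b < d \<Longrightarrow>
      (\<lambda>n. (frame_op m d (Q n) $$ (a, b) - real_diag d w $$ (a, b)) / of_real (\<tau> n)) \<longlonglongrightarrow> B a b"
  shows "(\<Sum>a<d. potential_slope (w a) * Re (B a a)) \<ge> 0"
proof -
  let ?L = "real_diag d w" and ?L' = "real_diag d (\<lambda>a. 1 / w a)"
  define S where "S n = frame_op m d (Q n)" for n
  have S_lim: "(\<lambda>n. S n $$ (a, b)) \<longlonglongrightarrow> ?L $$ (a, b)" if "a < d" "b < d" for a b
  proof -
    have "(\<lambda>n. of_real (\<tau> n) * ((S n $$ (a, b) - ?L $$ (a, b)) / of_real (\<tau> n)) + ?L $$ (a, b))
        \<longlonglongrightarrow> of_real 0 * B a b + ?L $$ (a, b)"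
      unfolding S_def using that by (intro tendsto_add tendsto_mult tendsto_of_real \<tau> deriv tendsto_const)
    moreover have "of_real (\<tau> n) * ((S n $$ (a, b) - ?L $$ (a, b)) / of_real (\<tau> n)) + ?L $$ (a, b)
        = S n $$ (a, b)" for n using \<tau>(1)[of n] by simp
    ultimately show ?thesis by simp
  qed
  have "?L * ?L' = 1\<^sub>m d"
  proof (rule eq_matI)
    fix a b assume "a < dim_row (1\<^sub>m d :: complex mat)" "b < dim_col (1\<^sub>m d :: complex mat)"
    then have ab: "a < d" "b < d" by auto
    have "(?L * ?L') $$ (a, b) = (\<Sum>c<d. ?L $$ (a, c) * ?L' $$ (c, b))"
      by (rule index_mult_mat_sum[OF real_diag_carrier real_diag_carrier ab])
    also have "\<dots> = ?L $$ (a, a) * ?L' $$ (a, b)" using ab by (subst sum_eq_single[of a]) auto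
    finally show "(?L * ?L') $$ (a, b) = 1\<^sub>m d $$ (a, b)" using ab w[OF ab(1)] w[OF ab(2)] by simp
  qed auto
  from tendsto_inverse_mat[OF _ real_diag_carrier S_lim real_diag_carrier this]
  obtain F where F: "\<And>n. F n \<in> carrier_mat d d" "\<forall>\<^sub>F n in sequentially. S n * F n = 1\<^sub>m d"
    "\<And>a b. a < d \<Longrightarrow> b < d \<Longrightarrow> (\<lambda>n. F n $$ (a, b)) \<longlonglongrightarrow> ?L' $$ (a, b)"
    unfolding S_def by auto
  obtain \<epsilon> where \<epsilon>: "\<epsilon> > 0" "\<And>Q F. tight_family m d k v Q \<Longrightarrow> F \<in> carrier_mat d d \<Longrightarrow>
     frame_op m d Q * F = 1\<^sub>m d \<Longrightarrow> entry_close d \<epsilon> (frame_op m d Q) ?L \<Longrightarrow> entry_close d \<epsilon> F ?L' \<Longrightarrow>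
     energy ?L ?L' \<le> energy (frame_op m d Q) F"
    using min unfolding diagonal_local_min_def by blast
  have "\<forall>\<^sub>F n in sequentially. S n * F n = 1\<^sub>m d \<and> entry_close d \<epsilon> (S n) ?L \<and> entry_close d \<epsilon> (F n) ?L'"
    by (intro eventually_conj F(2) entry_close_eventually[OF S_lim \<epsilon>(1)] entry_close_eventually[OF F(3) \<epsilon>(1)])
  \<comment> \<open>Inverses and closeness hold from some \<open>N\<close> on; the sequences are
    shifted by it, because \<open>energy_derivative\<close> asks for an inverse at every
    index.\<close>
  then obtain N where N: "\<And>n. n \<ge> N \<Longrightarrow> S n * F n = 1\<^sub>m d \<and> entry_close d \<epsilon> (S n) ?L \<and> entry_close d \<epsilon> (F n) ?L'"
    unfolding eventually_sequentially by blast
  have "(\<lambda>n. (energy (S (n + N)) (F (n + N)) - energy ?L ?L') / \<tau> (n + N))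
      \<longlonglongrightarrow> 2 * (\<Sum>a<d. (w a - 1 / w a ^ 3) * Re (B a a))"
  proof (rule energy_derivative[where B = B])
    show "(\<lambda>n. \<tau> (n + N)) \<longlonglongrightarrow> 0" by (rule LIMSEQ_ignore_initial_segment[OF \<tau>(2)])
    show "(\<lambda>n. F (n + N) $$ (a, b)) \<longlonglongrightarrow> ?L' $$ (a, b)" if "a < d" "b < d" for a b
      by (rule LIMSEQ_ignore_initial_segment[OF F(3)[OF that]])
    show "(\<lambda>n. (S (n + N) $$ (a, b) - ?L $$ (a, b)) / of_real (\<tau> (n + N))) \<longlonglongrightarrow> B a b"
      if "a < d" "b < d" for a b
      using LIMSEQ_ignore_initial_segment[OF deriv[OF that], of N] by (simp add: S_def)
  qed (use w F(1) \<tau>(1) N in \<open>auto simp: S_def\<close>)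
  moreover have "(energy (S (n + N)) (F (n + N)) - energy ?L ?L') / \<tau> (n + N) \<ge> 0" for n
    using N[of "n + N"] \<epsilon>(2)[OF Q F(1)] \<tau>(1)[of "n + N"] by (simp add: S_def)
  ultimately have "2 * (\<Sum>a<d. (w a - 1 / w a ^ 3) * Re (B a a)) \<ge> 0"
    by (meson LIMSEQ_le_const)
  then show ?thesis by (simp add: potential_slope_def)
qed

lemma tight_family_perturbation:
  assumes v: "\<And>i. i < m \<Longrightarrow> v i > 0" and X: "tight_family m d k v X"
    and Y: "\<And>i. i < m \<Longrightarrow> Y i \<in> carrier_mat d (k i)" "\<And>i. i < m \<Longrightarrow> mat_adjoint (X i) * Y i = 0\<^sub>m (k i) (k i)"
  defines "t \<equiv> \<lambda>n. 1 / real (Suc n)"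
  obtains Q where "\<And>n. tight_family m d k v (Q n)" "\<And>a b. a < d \<Longrightarrow> b < d \<Longrightarrow>
    (\<lambda>n. (frame_op m d (Q n) $$ (a, b) - frame_op m d X $$ (a, b)
        - of_real (t n) * (\<Sum>i<m. tangent_term (X i) (Y i) a b))
      / of_real ((t n)\<^sup>2))
    \<longlonglongrightarrow> (\<Sum>i<m. curvature_term (k i) (v i) (X i) (Y i) a b)"
proof -
  define P where "P i Q \<longleftrightarrow>
    (\<forall>n. Q n \<in> carrier_mat d (k i) \<and> mat_adjoint (Q n) * Q n = of_real ((v i)\<^sup>2) \<cdot>\<^sub>m 1\<^sub>m (k i)) \<and>
    (\<forall>a<d. \<forall>b<d. (\<lambda>n. ((Q n * mat_adjoint (Q n)) $$ (a, b) - (X i * mat_adjoint (X i)) $$ (a, b)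
        - of_real (t n) * tangent_term (X i) (Y i) a b) / of_real ((t n)\<^sup>2))
      \<longlonglongrightarrow> curvature_term (k i) (v i) (X i) (Y i) a b)"
    for i and Q :: "nat \<Rightarrow> complex mat"
  have "\<exists>Q. P i Q" if i: "i < m" for i
  proof -
    have "X i \<in> carrier_mat d (k i)" "mat_adjoint (X i) * X i = of_real ((v i)\<^sup>2) \<cdot>\<^sub>m 1\<^sub>m (k i)"
      using X i by (auto simp: tight_family_def)
    then show ?thesis
      unfolding P_def t_def using i Y v by (intro orthonormal_perturbation) auto
  qed
  then obtain Q where "\<And>i. i < m \<Longrightarrow> P i (Q i)" by metis
  then have Q: "\<And>i n. i < m \<Longrightarrow> Q i n \<in> carrier_mat d (k i) \<and>
      mat_adjoint (Q i n) * Q i n = of_real ((v i)\<^sup>2) \<cdot>\<^sub>m 1\<^sub>m (k i)"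
    "\<And>i a b. i < m \<Longrightarrow> a < d \<Longrightarrow> b < d \<Longrightarrow> (\<lambda>n. ((Q i n * mat_adjoint (Q i n)) $$ (a, b) - (X i * mat_adjoint (X i)) $$ (a, b)
        - of_real (t n) * tangent_term (X i) (Y i) a b) / of_real ((t n)\<^sup>2))
      \<longlonglongrightarrow> curvature_term (k i) (v i) (X i) (Y i) a b"
    unfolding P_def by blast+
  show thesis
  proof (rule that[of "\<lambda>n i. Q i n"])
    show "tight_family m d k v (\<lambda>i. Q i n)" for n using Q(1) by (simp add: tight_family_def)
    fix a b assume ab: "a < d" "b < d"
    have eq: "(frame_op m d (\<lambda>i. Q i n) $$ (a, b) - frame_op m d X $$ (a, b)
        - of_real (t n) * (\<Sum>i<m. tangent_term (X i) (Y i) a b))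
      / of_real ((t n)\<^sup>2)
      = (\<Sum>i<m. ((Q i n * mat_adjoint (Q i n)) $$ (a, b) - (X i * mat_adjoint (X i)) $$ (a, b)
        - of_real (t n) * tangent_term (X i) (Y i) a b) / of_real ((t n)\<^sup>2))" for n
      unfolding frame_op_index[OF ab] sum_distrib_left sum_subtractf[symmetric] sum_divide_distrib ..
    show "(\<lambda>n. (frame_op m d (\<lambda>i. Q i n) $$ (a, b) - frame_op m d X $$ (a, b)
        - of_real (t n) * (\<Sum>i<m. tangent_term (X i) (Y i) a b))
      / of_real ((t n)\<^sup>2))
    \<longlonglongrightarrow> (\<Sum>i<m. curvature_term (k i) (v i) (X i) (Y i) a b)"
      unfolding eq using ab by (intro tendsto_sum Q(2)) auto
  qed
qed

lemma index_mult_adjoint: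
  assumes "Z \<in> carrier_mat d k" "W \<in> carrier_mat d k" "a < d" "b < d"
  shows "(Z * mat_adjoint W) $$ (a, b) = (\<Sum>p<k. Z $$ (a, p) * cnj (W $$ (b, p)))"
  using assms by (simp add: index_mult_mat_sum[of _ d k _ d] del: index_mult_mat(1))

lemma index_adjoint_mult:
  assumes "Z \<in> carrier_mat d k" "W \<in> carrier_mat d k" "p < k" "q < k"
  shows "(mat_adjoint Z * W) $$ (p, q) = (\<Sum>a<d. cnj (Z $$ (a, p)) * W $$ (a, q))"
  using assms by (simp add: index_mult_mat_sum[of _ k d _ k] del: index_mult_mat(1))

locale diagonal_critical_point =
  fixes m d :: nat and k :: "nat \<Rightarrow> nat" and v :: "nat \<Rightarrow> real" and w :: "nat \<Rightarrow> real"
    and X :: "nat \<Rightarrow> complex mat"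
  assumes v: "\<And>i. i < m \<Longrightarrow> v i > 0" and w: "\<And>a. a < d \<Longrightarrow> w a > 0"
    and X: "tight_family m d k v X" and op_X: "frame_op m d X = real_diag d w"
    and min: "diagonal_local_min m d k v w"
begin

lemma X_carrier: "i < m \<Longrightarrow> X i \<in> carrier_mat d (k i)"
  and X_tight: "i < m \<Longrightarrow> mat_adjoint (X i) * X i = of_real ((v i)\<^sup>2) \<cdot>\<^sub>m 1\<^sub>m (k i)"
  using X by (auto simp: tight_family_def)

text \<open>Directions with \<open>X_i^* Y_i = 0\<close> move the range of \<open>X_i\<close>
  instead of rotating the frame inside it. On the scale \<open>t\<close> the curvature carries a
  factor \<open>t\<close> and disappears in the limit.\<close>

lemma first_variation:
  assumes Y: "\<And>i. i < m \<Longrightarrow> Y i \<in> carrier_mat d (k i)" "\<And>i. i < m \<Longrightarrow> mat_adjoint (X i) * Y i = 0\<^sub>m (k i) (k i)"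
  shows "(\<Sum>a<d. potential_slope (w a) * (\<Sum>i<m. \<Sum>p<k i. Re (Y i $$ (a, p) * cnj (X i $$ (a, p))))) \<ge> 0"
proof -
  define t where "t n = 1 / real (Suc n)" for n
  have t: "t n > 0" for n by (simp add: t_def)
  have t_lim: "t \<longlonglongrightarrow> 0" unfolding t_def by (rule LIMSEQ_Suc[OF lim_1_over_n])
  define A where "A a b = (\<Sum>i<m. tangent_term (X i) (Y i) a b)" for a b
  define C where "C a b = (\<Sum>i<m. curvature_term (k i) (v i) (X i) (Y i) a b)" for a b
  obtain Q where Q: "\<And>n. tight_family m d k v (Q n)" "\<And>a b. a < d \<Longrightarrow> b < d \<Longrightarrow>
    (\<lambda>n. (frame_op m d (Q n) $$ (a, b) - frame_op m d X $$ (a, b) - of_real (t n) * A a b) / of_real ((t n)\<^sup>2))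
    \<longlonglongrightarrow> C a b"
    unfolding A_def C_def t_def using tight_family_perturbation[OF v X Y] by blast
  have "(\<Sum>a<d. potential_slope (w a) * Re (A a a)) \<ge> 0"
  proof (rule local_min_variation[where w = w and \<tau> = t and B = A, OF min w Q(1) t t_lim])
    fix a b assume ab: "a < d" "b < d"
    have "(\<lambda>n. of_real (t n) * ((frame_op m d (Q n) $$ (a, b) - frame_op m d X $$ (a, b) - of_real (t n) * A a b)
        / of_real ((t n)\<^sup>2)) + A a b) \<longlonglongrightarrow> of_real 0 * C a b + A a b"
      by (intro tendsto_add tendsto_mult tendsto_of_real t_lim Q(2)[OF ab] tendsto_const)
    moreover have "of_real (t n) * ((frame_op m d (Q n) $$ (a, b) - frame_op m d X $$ (a, b) - of_real (t n) * A a b)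
        / of_real ((t n)\<^sup>2)) + A a b
      = (frame_op m d (Q n) $$ (a, b) - real_diag d w $$ (a, b)) / of_real (t n)" for n
      using t[of n] by (simp add: op_X power2_eq_square field_simps)
    ultimately show "(\<lambda>n. (frame_op m d (Q n) $$ (a, b) - real_diag d w $$ (a, b)) / of_real (t n)) \<longlonglongrightarrow> A a b"
      by simp
  qed
  also have "(\<Sum>a<d. potential_slope (w a) * Re (A a a))
      = 2 * (\<Sum>a<d. potential_slope (w a) * (\<Sum>i<m. \<Sum>p<k i. Re (Y i $$ (a, p) * cnj (X i $$ (a, p)))))"
    (is "?lhs = 2 * ?rhs")
  proof -
    have "Re (A a a) = 2 * (\<Sum>i<m. \<Sum>p<k i. Re (Y i $$ (a, p) * cnj (X i $$ (a, p))))" if "a < d" for a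
    unfolding A_def tangent_term_def Re_sum sum_distrib_left
  proof (intro sum.cong refl)
    fix i assume "i \<in> {..<m}"
    then have i: "i < m" by simp
    show "Re ((Y i * mat_adjoint (X i)) $$ (a, a) + (X i * mat_adjoint (Y i)) $$ (a, a))
      = (\<Sum>p<k i. 2 * Re (Y i $$ (a, p) * cnj (X i $$ (a, p))))"
      unfolding index_mult_adjoint[OF Y(1)[OF i] X_carrier[OF i] that that]
        index_mult_adjoint[OF X_carrier[OF i] Y(1)[OF i] that that] sum.distrib[symmetric] Re_sum
      by (intro sum.cong refl) (simp add: algebra_simps)
  qed
    then have "?lhs = (\<Sum>a<d. 2 * (potential_slope (w a) * (\<Sum>i<m. \<Sum>p<k i. Re (Y i $$ (a, p) * cnj (X i $$ (a, p))))))"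
      by (intro sum.cong refl) (simp only: lessThan_iff mult.left_commute)
    then show ?thesis by (simp only: sum_distrib_left[where r = 2, symmetric])
  qed
  finally show ?thesis by simp
qed

text \<open>By \<open>A0\<close> the frame operator has no change of order \<open>t\<close>, so it
  moves on the scale \<open>t^2\<close> with the curvature terms as velocity. The second derivative
  of the potential therefore does not enter, only its slope.\<close>

lemma second_variation:
  assumes Y: "\<And>i. i < m \<Longrightarrow> Y i \<in> carrier_mat d (k i)" "\<And>i. i < m \<Longrightarrow> mat_adjoint (X i) * Y i = 0\<^sub>m (k i) (k i)"
    and A0: "\<And>a b. a < d \<Longrightarrow> b < d \<Longrightarrow> (\<Sum>i<m. (Y i * mat_adjoint (X i)) $$ (a, b)) = 0"
  shows "(\<Sum>a<d. potential_slope (w a) * Re (\<Sum>i<m. curvature_term (k i) (v i) (X i) (Y i) a a)) \<ge> 0"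
proof -
  define t where "t n = 1 / real (Suc n)" for n
  have t: "t n > 0" for n by (simp add: t_def)
  have t_lim: "t \<longlonglongrightarrow> 0" unfolding t_def by (rule LIMSEQ_Suc[OF lim_1_over_n])
  define A where "A a b = (\<Sum>i<m. tangent_term (X i) (Y i) a b)" for a b
  define C where "C a b = (\<Sum>i<m. curvature_term (k i) (v i) (X i) (Y i) a b)" for a b
  obtain Q where Q: "\<And>n. tight_family m d k v (Q n)" "\<And>a b. a < d \<Longrightarrow> b < d \<Longrightarrow>
    (\<lambda>n. (frame_op m d (Q n) $$ (a, b) - frame_op m d X $$ (a, b) - of_real (t n) * A a b) / of_real ((t n)\<^sup>2))
    \<longlonglongrightarrow> C a b"
    unfolding A_def C_def t_def using tight_family_perturbation[OF v X Y] by blast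
  have A: "A a b = 0" if ab: "a < d" "b < d" for a b
  proof -
    have "(\<Sum>i<m. (X i * mat_adjoint (Y i)) $$ (a, b)) = cnj (\<Sum>i<m. (Y i * mat_adjoint (X i)) $$ (b, a))"
      unfolding cnj_sum
    proof (intro sum.cong refl)
      fix i assume "i \<in> {..<m}"
      then have i: "i < m" by simp
      show "(X i * mat_adjoint (Y i)) $$ (a, b) = cnj ((Y i * mat_adjoint (X i)) $$ (b, a))"
        unfolding index_mult_adjoint[OF X_carrier[OF i] Y(1)[OF i] ab]
          index_mult_adjoint[OF Y(1)[OF i] X_carrier[OF i] ab(2,1)] by (simp add: mult.commute)
    qed
    then show ?thesis using A0 ab by (simp add: A_def tangent_term_def sum.distrib)
  qed
  have "(\<Sum>a<d. potential_slope (w a) * Re (C a a)) \<ge> 0"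
  proof (rule local_min_variation[where w = w and \<tau> = "\<lambda>n. (t n)\<^sup>2" and B = C, OF min w Q(1)])
    show "(t n)\<^sup>2 > 0" for n using t[of n] by simp
    show "(\<lambda>n. (t n)\<^sup>2) \<longlonglongrightarrow> 0" using tendsto_power[OF t_lim, of 2] by simp
    fix a b assume ab: "a < d" "b < d"
    show "(\<lambda>n. (frame_op m d (Q n) $$ (a, b) - real_diag d w $$ (a, b)) / of_real ((t n)\<^sup>2)) \<longlonglongrightarrow> C a b"
      using Q(2)[OF ab] by (simp add: A[OF ab] op_X)
  qed
  then show ?thesis by (simp add: C_def)
qed

end

lemma Re_of_real_mult: "Re (complex_of_real x * z) = x * Re z"
  by simp

lemma gram_index:
  assumes "X \<in> carrier_mat d k" "mat_adjoint X * X = of_real c \<cdot>\<^sub>m 1\<^sub>m k" "p < k" "q < k"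
  shows "(\<Sum>a<d. cnj (X $$ (a, p)) * X $$ (a, q)) = of_real c * of_bool (p = q)"
  using arg_cong[OF assms(2), of "\<lambda>M. M $$ (p, q)"] index_adjoint_mult[OF assms(1,1,3,4)] assms(3,4)
  by simp

context diagonal_critical_point
begin

definition slope_mat :: "complex mat" where
  "slope_mat = real_diag d (\<lambda>a. potential_slope (w a))"

lemma slope_mat_carrier: "slope_mat \<in> carrier_mat d d"
  by (simp add: slope_mat_def)

lemma slope_mat_mult_index:
  assumes "Z \<in> carrier_mat d n" "a < d" "b < n"
  shows "(slope_mat * Z) $$ (a, b) = of_real (potential_slope (w a)) * Z $$ (a, b)"
  unfolding index_mult_mat_sum[OF slope_mat_carrier assms]
  using assms by (subst sum_eq_single[of a]) (auto simp: slope_mat_def)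

text \<open>The first variation in the direction \<open>Y = - (v\<^sup>2 - X X\<^sup>*) D X\<close>, \<open>D\<close> the slope matrix, is a negative
  multiple of the squared norm of \<open>Y\<close>; hence \<open>Y = 0\<close>.\<close>

lemma slope_invariant:
  assumes i: "i < m"
  shows "of_real ((v i)\<^sup>2) \<cdot>\<^sub>m (slope_mat * X i) = X i * (mat_adjoint (X i) * (slope_mat * X i))"
proof -
  let ?X = "X i" and ?k = "k i"
  define V where "V = complex_of_real ((v i)\<^sup>2)"
  have V: "V \<noteq> 0" using v[OF i] by (simp add: V_def)
  note X' = X_carrier[OF i] and D = slope_mat_carrier
  define M where "M = mat_adjoint ?X * (slope_mat * ?X)"
  have DX: "slope_mat * ?X \<in> carrier_mat d ?k" using X' D by (simp add: mult_carrier_mat[of _ d d _ ?k])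
  have M: "M \<in> carrier_mat ?k ?k" using X' DX by (simp add: M_def mult_carrier_mat[of _ ?k d _ ?k])
  have XM: "?X * M \<in> carrier_mat d ?k" using X' M by (simp add: mult_carrier_mat[of _ d ?k _ ?k])
  \<comment> \<open>\<open>Z = v^2 (1 - P) D X\<close>, with \<open>P\<close> the orthogonal
    projection onto the range of \<open>X\<close>.\<close>
  define Z where "Z = V \<cdot>\<^sub>m (slope_mat * ?X) - ?X * M"
  have Z: "Z \<in> carrier_mat d ?k" unfolding Z_def by (rule minus_carrier_mat[OF XM])
  have XZ: "mat_adjoint ?X * Z = 0\<^sub>m ?k ?k"
  proof -
    have "mat_adjoint ?X * Z = V \<cdot>\<^sub>m M - (mat_adjoint ?X * ?X) * M"
      using X' DX XM M
      by (simp add: Z_def mult_minus_distrib_mat[of _ ?k d _ ?k] mult_smult_distrib[of _ ?k d _ ?k]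
          M_def[symmetric] assoc_mult_mat[of _ ?k d _ ?k _ ?k])
    also have "\<dots> = 0\<^sub>m ?k ?k" unfolding X_tight[OF i] using M
      by (simp add: mult_smult_assoc_mat[of _ ?k ?k _ ?k] V_def)
    finally show ?thesis .
  qed
  have XZ_idx: "(\<Sum>a<d. cnj (?X $$ (a, q)) * Z $$ (a, p)) = 0" if "p < ?k" "q < ?k" for p q
    using arg_cong[OF XZ, of "\<lambda>M. M $$ (q, p)"] index_adjoint_mult[OF X' Z that(2,1)] that by simp
  \<comment> \<open>\<open>Z\<close> is orthogonal to the range of \<open>X\<close>, so in its
    squared norm only the component \<open>v^2 D X\<close> counts.\<close>
  have cross: "(\<Sum>a<d. \<Sum>p<?k. Z $$ (a, p) * cnj ((?X * M) $$ (a, p))) = 0"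
  proof -
    have "(\<Sum>a<d. \<Sum>p<?k. Z $$ (a, p) * cnj ((?X * M) $$ (a, p)))
        = (\<Sum>a<d. \<Sum>p<?k. \<Sum>q<?k. cnj (M $$ (q, p)) * (cnj (?X $$ (a, q)) * Z $$ (a, p)))"
      by (intro sum.cong refl) (simp add: index_mult_mat_sum[OF X' M] sum_distrib_left ac_simps del: index_mult_mat(1))
    also have "\<dots> = (\<Sum>p<?k. \<Sum>q<?k. cnj (M $$ (q, p)) * (\<Sum>a<d. cnj (?X $$ (a, q)) * Z $$ (a, p)))"
      unfolding sum_distrib_left by (simp only: sum.swap[of _ _ "{..<d}"])
    also have "\<dots> = 0" using XZ_idx by simp
    finally show ?thesis .
  qed
  define Y where "Y j = (if j = i then - Z else 0\<^sub>m d (k j))" for j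
  have fv: "0 \<le> (\<Sum>a<d. potential_slope (w a) * (\<Sum>j<m. \<Sum>p<k j. Re (Y j $$ (a, p) * cnj (X j $$ (a, p)))))"
  proof (rule first_variation)
    fix j assume j: "j < m"
    show "Y j \<in> carrier_mat d (k j)" using Z by (simp add: Y_def)
    show "mat_adjoint (X j) * Y j = 0\<^sub>m (k j) (k j)"
    proof (cases "j = i")
      case True
      then show ?thesis using XZ X' Z by (auto simp: Y_def mult_minus_distrib_mat intro!: eq_matI)
    next
      case False
      then show ?thesis using X_carrier[OF j] by (simp add: Y_def)
    qed
  qed
  have *: "(\<Sum>j<m. \<Sum>p<k j. Re (Y j $$ (a, p) * cnj (X j $$ (a, p))))
      = - (\<Sum>p<?k. Re (Z $$ (a, p) * cnj (?X $$ (a, p))))" if "a < d" for a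
  proof -
    have "(\<Sum>j<m. \<Sum>p<k j. Re (Y j $$ (a, p) * cnj (X j $$ (a, p))))
        = (\<Sum>p<?k. Re (Y i $$ (a, p) * cnj (X i $$ (a, p))))"
      using i that by (intro sum_eq_single[where f = "\<lambda>j. \<Sum>p<k j. Re (Y j $$ (a, p) * cnj (X j $$ (a, p)))"])
        (auto simp: Y_def)
    also have "\<dots> = (\<Sum>p<?k. - Re (Z $$ (a, p) * cnj (?X $$ (a, p))))"
      using Z that by (intro sum.cong refl) (simp add: Y_def)
    finally show ?thesis by (simp only: sum_negf)
  qed
  have le: "(\<Sum>a<d. potential_slope (w a) * (\<Sum>p<?k. Re (Z $$ (a, p) * cnj (?X $$ (a, p))))) \<le> 0"
  proof -
    have "0 \<le> (\<Sum>a<d. s a * g a) \<Longrightarrow> (\<And>a. a < d \<Longrightarrow> g a = - h a) \<Longrightarrow> (\<Sum>a<d. s a * h a) \<le> 0"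
      for s g h :: "nat \<Rightarrow> real" by (simp add: sum_negf)
    from this[OF fv *] show ?thesis .
  qed
  \<comment> \<open>The squared norm of \<open>Z\<close> is \<open>v^2\<close> times the expression
    just shown to be nonpositive by the first variation.\<close>
  have norm_eq: "(\<Sum>a<d. \<Sum>p<?k. (cmod (Z $$ (a, p)))\<^sup>2)
      = (v i)\<^sup>2 * (\<Sum>a<d. potential_slope (w a) * (\<Sum>p<?k. Re (Z $$ (a, p) * cnj (?X $$ (a, p)))))"
  proof -
    have "(\<Sum>a<d. \<Sum>p<?k. Z $$ (a, p) * cnj (Z $$ (a, p)))
        = (\<Sum>a<d. \<Sum>p<?k. Z $$ (a, p) * cnj (V * (of_real (potential_slope (w a)) * ?X $$ (a, p)) - (?X * M) $$ (a, p)))"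
    proof (intro sum.cong refl)
      fix a p assume "a \<in> {..<d}" "p \<in> {..<?k}"
      then have ap: "a < d" "p < ?k" by auto
      have "Z $$ (a, p) = V * (of_real (potential_slope (w a)) * ?X $$ (a, p)) - (?X * M) $$ (a, p)"
        using ap carrier_matD[OF X'] carrier_matD[OF M] carrier_matD[OF D]
        by (simp add: Z_def slope_mat_mult_index[OF X' ap, symmetric] del: index_mult_mat(1))
      then show "Z $$ (a, p) * cnj (Z $$ (a, p)) = Z $$ (a, p) *
          cnj (V * (of_real (potential_slope (w a)) * ?X $$ (a, p)) - (?X * M) $$ (a, p))" by simp
    qed
    also have "\<dots> = (\<Sum>a<d. \<Sum>p<?k. V * of_real (potential_slope (w a)) * (Z $$ (a, p) * cnj (?X $$ (a, p))))
        - (\<Sum>a<d. \<Sum>p<?k. Z $$ (a, p) * cnj ((?X * M) $$ (a, p)))"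
      unfolding sum_subtractf[symmetric] by (intro sum.cong refl) (simp add: V_def algebra_simps)
    finally have "(\<Sum>a<d. \<Sum>p<?k. Z $$ (a, p) * cnj (Z $$ (a, p)))
        = (\<Sum>a<d. \<Sum>p<?k. V * of_real (potential_slope (w a)) * (Z $$ (a, p) * cnj (?X $$ (a, p))))"
      by (simp only: cross diff_zero)
    then have "Re (\<Sum>a<d. \<Sum>p<?k. Z $$ (a, p) * cnj (Z $$ (a, p)))
        = Re (\<Sum>a<d. \<Sum>p<?k. V * of_real (potential_slope (w a)) * (Z $$ (a, p) * cnj (?X $$ (a, p))))" by simp
    moreover have "Re (Z $$ (a, p) * cnj (Z $$ (a, p))) = (cmod (Z $$ (a, p)))\<^sup>2" for a p
      by (simp add: complex_norm_square[symmetric] del: of_real_power)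
    moreover have "Re (V * of_real (potential_slope (w a)) * (Z $$ (a, p) * cnj (?X $$ (a, p))))
        = (v i)\<^sup>2 * (potential_slope (w a) * Re (Z $$ (a, p) * cnj (?X $$ (a, p))))" for a p
      unfolding V_def of_real_mult[symmetric] Re_of_real_mult by simp
    ultimately show ?thesis by (simp only: Re_sum sum_distrib_left)
  qed
  have "(\<Sum>a<d. \<Sum>p<?k. (cmod (Z $$ (a, p)))\<^sup>2) \<le> 0"
    unfolding norm_eq using le by (simp add: mult_nonneg_nonpos)
  moreover have "(\<Sum>a<d. \<Sum>p<?k. (cmod (Z $$ (a, p)))\<^sup>2) \<ge> 0" by (intro sum_nonneg) auto
  ultimately have "(\<Sum>a<d. \<Sum>p<?k. (cmod (Z $$ (a, p)))\<^sup>2) = 0" by linarith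
  then have Z0: "Z $$ (a, p) = 0" if "a < d" "p < ?k" for a p
    using that by (simp add: sum_nonneg_eq_0_iff sum_nonneg)
  show ?thesis
  proof (rule eq_matI)
    fix a p assume "a < dim_row (?X * (mat_adjoint ?X * (slope_mat * ?X)))" "p < dim_col (?X * (mat_adjoint ?X * (slope_mat * ?X)))"
    then have "a < d" "p < ?k" using X' D by auto
    then show "(of_real ((v i)\<^sup>2) \<cdot>\<^sub>m (slope_mat * ?X)) $$ (a, p) = (?X * (mat_adjoint ?X * (slope_mat * ?X))) $$ (a, p)"
      using Z0[of a p] carrier_matD[OF X'] carrier_matD[OF M] carrier_matD[OF D]
      by (simp add: Z_def V_def M_def[symmetric] del: index_mult_mat(1))
  qed (use X' D in auto)
qed

text \<open>\<open>slope_invariant\<close> reads \<open>v^2 D X = X M\<close> with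
  \<open>M = X^* D X\<close>. If \<open>q\<close> diagonalizes \<open>M\<close>, the columns of
  \<open>X q\<close> are eigenvectors of \<open>D\<close>, each supported on rows of one slope; the
  slope is injective on positive reals, so these rows share one eigenvalue \<open>w a\<close>.
  Decreasing eigenvalues of \<open>M\<close> give decreasing \<open>mu\<close>.\<close>

lemma eigenframe:
  assumes i: "i < m"
  shows "\<exists>q mu. unitary (k i) q \<and> (\<forall>b c. b \<le> c \<longrightarrow> c < k i \<longrightarrow> mu c \<le> mu b) \<and> (\<forall>b<k i. mu b > 0) \<and>
    (\<forall>a<d. \<forall>b<k i. (X i * q) $$ (a, b) \<noteq> 0 \<longrightarrow> w a = mu b)"
proof -
  let ?X = "X i" and ?k = "k i"
  define V where "V = complex_of_real ((v i)\<^sup>2)"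
  have V: "V \<noteq> 0" using v[OF i] by (simp add: V_def)
  note X' = X_carrier[OF i] and D = slope_mat_carrier
  note mc = mult_carrier_mat[of _ d d _ ?k] mult_carrier_mat[of _ ?k d _ ?k] mult_carrier_mat[of _ d ?k _ ?k]
    mult_carrier_mat[of _ ?k ?k _ ?k]
  define M where "M = mat_adjoint ?X * (slope_mat * ?X)"
  have M: "M \<in> carrier_mat ?k ?k" using X' D by (simp add: M_def mc)
  have D_herm: "mat_adjoint slope_mat = slope_mat"
    by (rule eq_matI) (auto simp: slope_mat_def)
  have "mat_adjoint M = M" using X' D
    by (simp add: M_def adjoint_mult[of _ ?k d _ ?k] adjoint_mult[of _ d d _ ?k] mc D_herm
        assoc_mult_mat[of _ ?k d _ d _ ?k])
  note diag = hermitian_diagonalization[OF M this]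
  define l where "l = eig_desc M"
  obtain q where q: "unitary ?k q" "mat_adjoint q * M * q = real_diag ?k (\<lambda>b. l ! b)"
    using diag(3)[of l] by (auto simp: l_def)
  note q' = unitaryD[OF q(1)]
  define Xh where "Xh = ?X * q"
  have Xh: "Xh \<in> carrier_mat d ?k" using X' q' by (simp add: Xh_def mc)
  have "V \<cdot>\<^sub>m (slope_mat * Xh) = (V \<cdot>\<^sub>m (slope_mat * ?X)) * q"
    using X' D q'(1) by (simp add: Xh_def mult_smult_assoc_mat[of _ d ?k _ ?k] assoc_mult_mat[of _ d d _ ?k _ ?k] mc)
  also have "\<dots> = (?X * M) * q" using slope_invariant[OF i] by (simp add: V_def M_def)
  also have "\<dots> = ?X * ((q * mat_adjoint q) * (M * q))"
    using X' M q' by (simp add: assoc_mult_mat[of _ d ?k _ ?k _ ?k] mc)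
  also have "\<dots> = Xh * (mat_adjoint q * M * q)"
    using X' M q'(1) by (simp add: Xh_def assoc_mult_mat[of _ d ?k _ ?k _ ?k] assoc_mult_mat[of _ ?k ?k _ ?k _ ?k] mc)
  finally have eq: "V \<cdot>\<^sub>m (slope_mat * Xh) = Xh * real_diag ?k (\<lambda>b. l ! b)" unfolding q(2) .
  have eig: "(v i)\<^sup>2 * potential_slope (w a) = l ! b"
    if ab: "a < d" "b < ?k" and nz: "Xh $$ (a, b) \<noteq> 0" for a b
  proof -
    have "V * (of_real (potential_slope (w a)) * Xh $$ (a, b)) = (V \<cdot>\<^sub>m (slope_mat * Xh)) $$ (a, b)"
      using ab Xh D by (simp add: slope_mat_mult_index[OF Xh ab] del: index_mult_mat(1))
    also have "\<dots> = (\<Sum>c<?k. Xh $$ (a, c) * real_diag ?k (\<lambda>b. l ! b) $$ (c, b))"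
      unfolding eq using ab by (simp add: index_mult_mat_sum[OF Xh real_diag_carrier] del: index_mult_mat(1))
    also have "\<dots> = Xh $$ (a, b) * of_real (l ! b)" using ab by (subst sum_eq_single[of b]) auto
    finally have "V * of_real (potential_slope (w a)) = of_real (l ! b)" using nz by simp
    then have "complex_of_real ((v i)\<^sup>2 * potential_slope (w a)) = of_real (l ! b)" by (simp add: V_def)
    then show ?thesis by (simp only: of_real_eq_iff)
  qed
  have XhXh: "mat_adjoint Xh * Xh = of_real ((v i)\<^sup>2) \<cdot>\<^sub>m 1\<^sub>m ?k"
  proof -
    have "mat_adjoint Xh * Xh = mat_adjoint q * ((mat_adjoint ?X * ?X) * q)"
      using X' q'(1) by (simp add: Xh_def adjoint_mult[of _ d ?k _ ?k] assoc_mult_mat[of _ ?k d _ ?k _ ?k]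
        assoc_mult_mat[of _ ?k ?k _ d _ ?k] mc)
    then show ?thesis unfolding X_tight[OF i] using q'
      by (simp add: mult_smult_assoc_mat[of _ ?k ?k _ ?k] mult_smult_distrib[of _ ?k ?k _ ?k])
  qed
  \<comment> \<open>Read off at any row where the column is nonzero; there is one, as the column has
    norm \<open>v i > 0\<close>.\<close>
  define mu where "mu b = w (SOME a. a < d \<and> Xh $$ (a, b) \<noteq> 0)" for b
  have mu_ex: "\<exists>a<d. Xh $$ (a, b) \<noteq> 0 \<and> mu b = w a" if b: "b < ?k" for b
  proof -
    have "\<exists>a. a < d \<and> Xh $$ (a, b) \<noteq> 0"
    proof (rule ccontr)
      assume "\<not> ?thesis"
      then have "(\<Sum>a<d. cnj (Xh $$ (a, b)) * Xh $$ (a, b)) = 0" by (intro sum.neutral) auto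
      then show False using gram_index[OF Xh XhXh b b] v[OF i] by simp
    qed
    from someI_ex[OF this] show ?thesis unfolding mu_def by blast
  qed
  have mu_slope: "(v i)\<^sup>2 * potential_slope (mu b) = l ! b" if "b < ?k" for b
    using mu_ex[OF that] eig that by metis
  have mu_pos: "mu b > 0" if "b < ?k" for b using mu_ex[OF that] w by metis
  have "w a = mu b" if "a < d" "b < ?k" "Xh $$ (a, b) \<noteq> 0" for a b
  proof -
    have "potential_slope (w a) = potential_slope (mu b)"
      using eig[OF that] mu_slope[OF that(2)] v[OF i] by (metis mult_cancel_left less_irrefl zero_less_power)
    then show ?thesis using potential_slope_less_iff[OF w[OF that(1)] mu_pos[OF that(2)]]
      potential_slope_less_iff[OF mu_pos[OF that(2)] w[OF that(1)]] by linarith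
  qed
  moreover have "mu c \<le> mu b" if "b \<le> c" "c < ?k" for b c
  proof -
    have "l ! c \<le> l ! b"
      using sorted_wrt_nth_less[OF diag(2), of b c] diag(1) that by (cases "b = c") (auto simp: l_def)
    then have "potential_slope (mu c) \<le> potential_slope (mu b)"
      using mu_slope[of b] mu_slope[of c] that v[OF i] by (metis le_less_trans mult_le_cancel_left_pos zero_less_power)
    then show ?thesis using potential_slope_less_iff[OF mu_pos[of b] mu_pos[of c]] that by linarith
  qed
  ultimately show ?thesis using q(1) mu_pos unfolding Xh_def by blast
qed

end

locale diagonal_eigenframe = diagonal_critical_point +
  fixes mu :: "nat \<Rightarrow> nat \<Rightarrow> real"
  assumes mu_pos: "\<And>i b. i < m \<Longrightarrow> b < k i \<Longrightarrow> mu i b > 0"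
    and eigen: "\<And>i a b. i < m \<Longrightarrow> a < d \<Longrightarrow> b < k i \<Longrightarrow> X i $$ (a, b) \<noteq> 0 \<Longrightarrow> w a = mu i b"
begin

text \<open>In a direction lowering eigenvalues the second variation is
  \<open>\<Sum> (f'(w\<^sub>a) - f'(\<mu>\<^sub>b)) |Y\<^sub>a\<^sub>b|\<^sup>2 \<le> 0\<close>. By duality, the conclusion is the surjectivity needed to
  solve for a pencil certificate near \<open>z = 0\<close>.\<close>

lemma rigid:
  fixes Y :: "nat \<Rightarrow> nat \<Rightarrow> nat \<Rightarrow> complex"
  assumes supp: "\<And>i a b. i < m \<Longrightarrow> a < d \<Longrightarrow> b < k i \<Longrightarrow> Y i a b \<noteq> 0 \<Longrightarrow> w a < mu i b"
    and YX: "\<And>a c. a < d \<Longrightarrow> c < d \<Longrightarrow> (\<Sum>i<m. \<Sum>b<k i. Y i a b * cnj (X i $$ (c, b))) = 0"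
    and XY: "\<And>i c b. i < m \<Longrightarrow> c < k i \<Longrightarrow> b < k i \<Longrightarrow> (\<Sum>a<d. cnj (X i $$ (a, c)) * Y i a b) = 0"
  shows "\<forall>i<m. \<forall>a<d. \<forall>b<k i. Y i a b = 0"
proof -
  define W where "W i = mat d (k i) (\<lambda>(a, b). Y i a b)" for i
  have W: "W i \<in> carrier_mat d (k i)" for i by (simp add: W_def)
  have W_idx: "W i $$ (a, b) = Y i a b" if "a < d" "b < k i" for i a b using that by (simp add: W_def)
  have N_idx: "(mat_adjoint (W i) * W i) $$ (p, q) = (\<Sum>a<d. cnj (Y i a p) * Y i a q)"
    if "p < k i" "q < k i" for i p q
    unfolding index_adjoint_mult[OF W W that] using that by (intro sum.cong refl) (simp add: W_idx)
  have sv: "(\<Sum>a<d. potential_slope (w a) * Re (\<Sum>i<m. curvature_term (k i) (v i) (X i) (W i) a a)) \<ge> 0"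
  proof (rule second_variation)
    show "mat_adjoint (X i) * W i = 0\<^sub>m (k i) (k i)" if i: "i < m" for i
    proof (rule eq_matI)
      fix c b assume "c < dim_row (0\<^sub>m (k i) (k i) :: complex mat)" "b < dim_col (0\<^sub>m (k i) (k i) :: complex mat)"
      then have cb: "c < k i" "b < k i" by auto
      show "(mat_adjoint (X i) * W i) $$ (c, b) = 0\<^sub>m (k i) (k i) $$ (c, b)"
        using XY[OF i cb] cb unfolding index_adjoint_mult[OF X_carrier[OF i] W cb] by (simp add: W_idx)
    qed (use X_carrier[OF i] W in auto)
    show "(\<Sum>i<m. (W i * mat_adjoint (X i)) $$ (a, b)) = 0" if ab: "a < d" "b < d" for a b
    proof -
      have "(\<Sum>i<m. (W i * mat_adjoint (X i)) $$ (a, b)) = (\<Sum>i<m. \<Sum>p<k i. Y i a p * cnj (X i $$ (b, p)))"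
        using ab by (intro sum.cong refl) (simp add: index_mult_adjoint[OF W X_carrier] W_idx del: index_mult_mat(1))
      then show ?thesis using YX[OF ab] by simp
    qed
  qed (rule W)
  have term_eq: "(\<Sum>a<d. of_real (potential_slope (w a)) * curvature_term (k i) (v i) (X i) (W i) a a)
    = of_real (\<Sum>a<d. \<Sum>b<k i. (potential_slope (w a) - potential_slope (mu i b)) * (cmod (Y i a b))\<^sup>2)"
    if i: "i < m" for i
  proof -
    let ?s = "\<lambda>x. complex_of_real (potential_slope x)" and ?N = "mat_adjoint (W i) * W i"
    \<comment> \<open>On the support of \<open>X i $$ (a, p)\<close> the slope at \<open>w a\<close>
      equals the slope at \<open>mu i p\<close>, which is constant in \<open>a\<close>; then
      \<open>X^* X = v^2\<close> collapses the double sum to its diagonal.\<close>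
    have "(\<Sum>a<d. ?s (w a) * (\<Sum>p<k i. \<Sum>q<k i. X i $$ (a, p) * ?N $$ (p, q) * cnj (X i $$ (a, q))))
      = (\<Sum>a<d. \<Sum>p<k i. \<Sum>q<k i. ?s (mu i p) * ?N $$ (p, q) * (cnj (X i $$ (a, q)) * X i $$ (a, p)))"
      unfolding sum_distrib_left
    proof (intro sum.cong refl)
      fix a p q assume "a \<in> {..<d}" "p \<in> {..<k i}"
      then show "?s (w a) * (X i $$ (a, p) * ?N $$ (p, q) * cnj (X i $$ (a, q)))
        = ?s (mu i p) * ?N $$ (p, q) * (cnj (X i $$ (a, q)) * X i $$ (a, p))"
        using eigen[OF i, of a p] by (cases "X i $$ (a, p) = 0") simp_all
    qed
    also have "\<dots> = (\<Sum>p<k i. \<Sum>q<k i. ?s (mu i p) * ?N $$ (p, q) * (\<Sum>a<d. cnj (X i $$ (a, q)) * X i $$ (a, p)))"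
      unfolding sum_distrib_left by (simp only: sum.swap[of _ _ "{..<d}"])
    also have "\<dots> = (\<Sum>p<k i. \<Sum>q<k i. ?s (mu i p) * ?N $$ (p, q) * (of_real ((v i)\<^sup>2) * of_bool (q = p)))"
      using gram_index[OF X_carrier[OF i] X_tight[OF i]] by (intro sum.cong refl) simp
    also have "\<dots> = (\<Sum>p<k i. of_real ((v i)\<^sup>2) * (?s (mu i p) * ?N $$ (p, p)))"
    proof (intro sum.cong refl)
      fix p assume "p \<in> {..<k i}"
      then have "(\<Sum>q<k i. (of_real ((v i)\<^sup>2) * (?s (mu i p) * ?N $$ (p, q))) * of_bool (q = p))
          = of_real ((v i)\<^sup>2) * (?s (mu i p) * ?N $$ (p, p))" by (intro sum_of_bool_eq_mult(2)) auto
      then show "(\<Sum>q<k i. ?s (mu i p) * ?N $$ (p, q) * (of_real ((v i)\<^sup>2) * of_bool (q = p)))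
          = of_real ((v i)\<^sup>2) * (?s (mu i p) * ?N $$ (p, p))" by (simp only: ac_simps)
    qed
    finally have "(\<Sum>a<d. ?s (w a) * (\<Sum>p<k i. \<Sum>q<k i. X i $$ (a, p) * ?N $$ (p, q) * cnj (X i $$ (a, q)))) / of_real ((v i)\<^sup>2)
      = (\<Sum>p<k i. ?s (mu i p) * ?N $$ (p, p))"
      using v[OF i] by (simp only: sum_distrib_left[symmetric]) simp
    also have "\<dots> = (\<Sum>p<k i. \<Sum>a<d. ?s (mu i p) * of_real ((cmod (Y i a p))\<^sup>2))"
      by (intro sum.cong refl)
        (simp add: N_idx sum_distrib_left complex_norm_square mult.commute del: index_mult_mat(1) of_real_power)
    finally have 1: "(\<Sum>a<d. ?s (w a) * (\<Sum>p<k i. \<Sum>q<k i. X i $$ (a, p) * ?N $$ (p, q) * cnj (X i $$ (a, q)))) / of_real ((v i)\<^sup>2)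
      = (\<Sum>a<d. \<Sum>p<k i. ?s (mu i p) * of_real ((cmod (Y i a p))\<^sup>2))" by (simp only: sum.swap[of _ "{..<d}"])
    have 2: "(\<Sum>a<d. ?s (w a) * (W i * mat_adjoint (W i)) $$ (a, a)) = (\<Sum>a<d. \<Sum>b<k i. ?s (w a) * of_real ((cmod (Y i a b))\<^sup>2))"
      by (intro sum.cong refl)
        (simp add: index_mult_adjoint[OF W W] W_idx sum_distrib_left complex_norm_square del: index_mult_mat(1) of_real_power)
    have "(\<Sum>a<d. ?s (w a) * curvature_term (k i) (v i) (X i) (W i) a a)
      = (\<Sum>a<d. ?s (w a) * (W i * mat_adjoint (W i)) $$ (a, a))
       - (\<Sum>a<d. ?s (w a) * (\<Sum>p<k i. \<Sum>q<k i. X i $$ (a, p) * ?N $$ (p, q) * cnj (X i $$ (a, q)))) / of_real ((v i)\<^sup>2)"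
    proof -
      have "(\<Sum>a<d. s a * (f a - g a / c)) = (\<Sum>a<d. s a * f a) - (\<Sum>a<d. s a * g a) / c"
        for s f g :: "nat \<Rightarrow> complex" and c
        by (simp add: right_diff_distrib sum_subtractf sum_divide_distrib)
      then show ?thesis unfolding curvature_term_def .
    qed
    also have "\<dots> = of_real (\<Sum>a<d. \<Sum>b<k i. (potential_slope (w a) - potential_slope (mu i b)) * (cmod (Y i a b))\<^sup>2)"
      unfolding 1 2 sum_subtractf[symmetric] of_real_sum
      by (intro sum.cong refl) (simp add: left_diff_distrib)
    finally show ?thesis .
  qed
  \<comment> \<open>A nonzero \<open>Y i a b\<close> occurs only with \<open>w a < mu i b\<close>,
    where strict monotonicity of the slope makes the factor negative.\<close>
  have nonpos: "(potential_slope (w a) - potential_slope (mu i b)) * (cmod (Y i a b))\<^sup>2 \<le> 0"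
    if "i < m" "a < d" "b < k i" for i a b
    using supp[OF that] potential_slope_less_iff[OF w[OF that(2)] mu_pos[OF that(1,3)]]
    by (cases "Y i a b = 0") (auto intro: mult_nonpos_nonneg)
  have "(\<Sum>i<m. \<Sum>a<d. \<Sum>b<k i. (potential_slope (w a) - potential_slope (mu i b)) * (cmod (Y i a b))\<^sup>2) \<ge> 0"
  proof -
    have "0 \<le> (\<Sum>a<d. potential_slope (w a) * Re (\<Sum>i<m. curvature_term (k i) (v i) (X i) (W i) a a))" by (rule sv)
    also have "\<dots> = Re (\<Sum>a<d. \<Sum>i<m. of_real (potential_slope (w a)) * curvature_term (k i) (v i) (X i) (W i) a a)"
      by (simp only: Re_sum sum_distrib_left Re_of_real_mult)
    also have "(\<Sum>a<d. \<Sum>i<m. of_real (potential_slope (w a)) * curvature_term (k i) (v i) (X i) (W i) a a) = (\<Sum>i<m. \<Sum>a<d. of_real (potential_slope (w a)) * curvature_term (k i) (v i) (X i) (W i) a a)"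
      by (rule sum.swap)
    also have "\<dots> = (\<Sum>i<m. of_real (\<Sum>a<d. \<Sum>b<k i. (potential_slope (w a) - potential_slope (mu i b)) * (cmod (Y i a b))\<^sup>2))"
      by (intro sum.cong refl term_eq) simp
    finally show ?thesis by simp
  qed
  then have "(\<Sum>i<m. \<Sum>a<d. \<Sum>b<k i. - ((potential_slope (w a) - potential_slope (mu i b)) * (cmod (Y i a b))\<^sup>2)) \<le> 0"
    by (simp add: sum_negf)
  moreover have "(\<Sum>i<m. \<Sum>a<d. \<Sum>b<k i. - ((potential_slope (w a) - potential_slope (mu i b)) * (cmod (Y i a b))\<^sup>2)) \<ge> 0"
    by (intro sum_nonneg) (use nonpos in auto)
  ultimately have zero: "(\<Sum>i<m. \<Sum>a<d. \<Sum>b<k i. - ((potential_slope (w a) - potential_slope (mu i b)) * (cmod (Y i a b))\<^sup>2)) = 0"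
    by linarith
  show ?thesis
  proof (intro allI impI)
    fix i a b assume iab: "i < m" "a < d" "b < k i"
    define f where "f i a b = - ((potential_slope (w a) - potential_slope (mu i b)) * (cmod (Y i a b))\<^sup>2)" for i a b
    have f: "f i a b \<ge> 0" if "i < m" "a < d" "b < k i" for i a b using nonpos[OF that] by (simp add: f_def)
    have "(\<Sum>i<m. \<Sum>a<d. \<Sum>b<k i. f i a b) = 0" using zero by (simp only: f_def)
    then have "(\<Sum>a<d. \<Sum>b<k i. f i a b) = 0"
      using iab f by (subst (asm) sum_nonneg_eq_0_iff) (auto intro!: sum_nonneg)
    then have "(\<Sum>b<k i. f i a b) = 0"
      using iab f by (subst (asm) sum_nonneg_eq_0_iff) (auto intro!: sum_nonneg)
    then have "f i a b = 0"
      using iab f by (subst (asm) sum_nonneg_eq_0_iff) auto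
    then show "Y i a b = 0"
      using supp[OF iab] potential_slope_less_iff[OF w[OF iab(2)] mu_pos[OF iab(1,3)]]
      by (auto simp: f_def)
  qed
qed

end

section \<open>Unitary certificates\<close>

lemma det_1_inverse:
  fixes A :: "complex mat"
  assumes "A \<in> carrier_mat n n" "det A = 1"
  shows "adj_mat A \<in> carrier_mat n n" "A * adj_mat A = 1\<^sub>m n" "adj_mat A * A = 1\<^sub>m n"
proof -
  have "1 \<cdot>\<^sub>m 1\<^sub>m n = (1\<^sub>m n :: complex mat)" by (rule eq_matI) auto
  then show "adj_mat A \<in> carrier_mat n n" "A * adj_mat A = 1\<^sub>m n" "adj_mat A * A = 1\<^sub>m n"
    using adj_mat[OF assms(1)] assms(2) by simp_all
qed

text \<open>Take \<open>u = G^* r\<close> and \<open>h = H r'\<close> with triangular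
  \<open>r\<close> and \<open>r'\<close> from Gram-Schmidt. Entry \<open>(a, b)\<close> of
  \<open>u^* Z h\<close> combines only the entries \<open>(c, e)\<close> of \<open>T = G Z H\<close>
  with \<open>c \<le> a\<close> and \<open>e \<le> b\<close>. For these
  \<open>w c \<le> w a < mu i b \<le> mu i e\<close>, so they vanish too. The same two orderings
  make \<open>G\<close> upper and \<open>H\<close> lower triangular, with determinant
  \<open>1\<close>.\<close>

lemma unipotent_certificate_orthonormalize:
  fixes Z :: "nat \<Rightarrow> complex mat"
  assumes w_mono: "\<And>a c. a \<le> c \<Longrightarrow> c < d \<Longrightarrow> w a \<le> w c"
    and mu_anti: "\<And>i b c. i < m \<Longrightarrow> b \<le> c \<Longrightarrow> c < k i \<Longrightarrow> mu i c \<le> mu i b"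
    and Z: "\<And>i. i < m \<Longrightarrow> Z i \<in> carrier_mat d (k i)"
    and cert: "\<And>i a b. i < m \<Longrightarrow> a < d \<Longrightarrow> b < k i \<Longrightarrow> w a < mu i b \<Longrightarrow>
      (\<Sum>p<d. \<Sum>s<k i. unipotent w y a p * Z i $$ (p, s) * unipotent (mu i) (y' i) s b) = 0"
  shows "\<exists>u h. unitary d u \<and> (\<forall>i<m. unitary (k i) (h i)) \<and>
    (\<forall>i<m. \<forall>a<d. \<forall>b<k i. w a < mu i b \<longrightarrow> (mat_adjoint u * (Z i * h i)) $$ (a, b) = 0)"
proof -
  define G where "G = mat d d (\<lambda>(a, p). unipotent w y a p)"
  have G: "G \<in> carrier_mat d d" by (simp add: G_def)
  have "upper_triangular G"
    using w_mono by (auto simp: G_def upper_triangular_def unipotent_def) (meson less_imp_le not_less)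
  from det_upper_triangular[OF this G] have "det G = 1"
    unfolding prod_list_diag_prod by (simp add: G_def unipotent_def)
  note G' = det_1_inverse[OF G this]
  have "mat_adjoint (adj_mat G) * mat_adjoint G = 1\<^sub>m d"
    using adjoint_mult[OF G G'(1)] G'(2) by simp
  from orthonormalize_columns[OF carrier_adjoint[OF G] carrier_adjoint[OF G'(1)] this]
  obtain r where r: "r \<in> carrier_mat d d" "\<And>p j. p < d \<Longrightarrow> j < p \<Longrightarrow> r $$ (p, j) = 0"
    "unitary d (mat_adjoint G * r)" by metis
  define u where "u = mat_adjoint G * r"
  have u_adj: "mat_adjoint u = mat_adjoint r * G"
    unfolding u_def using adjoint_mult[OF carrier_adjoint[OF G] r(1)] by simp
  have "\<exists>h. unitary (k i) h \<and> (\<forall>a<d. \<forall>b<k i. w a < mu i b \<longrightarrow> (mat_adjoint u * (Z i * h)) $$ (a, b) = 0)"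
    if i: "i < m" for i
  proof -
    let ?k = "k i"
    note mc = mult_carrier_mat[of _ d d _ ?k] mult_carrier_mat[of _ d ?k _ ?k] mult_carrier_mat[of _ ?k ?k _ ?k]
    define H where "H = mat ?k ?k (\<lambda>(a, p). unipotent (mu i) (y' i) a p)"
    have H: "H \<in> carrier_mat ?k ?k" by (simp add: H_def)
    have "H $$ (p, q) = 0" if "p < q" "q < ?k" for p q
      using mu_anti[OF i, of p q] that by (auto simp: H_def unipotent_def)
    from det_lower_triangular[OF this H] have "det H = 1"
      unfolding prod_list_diag_prod by (simp add: H_def unipotent_def)
    note H' = det_1_inverse[OF H this]
    from orthonormalize_columns[OF H H'(1) H'(3)]
    obtain r' where r': "r' \<in> carrier_mat ?k ?k" "\<And>p j. p < ?k \<Longrightarrow> j < p \<Longrightarrow> r' $$ (p, j) = 0"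
      "unitary ?k (H * r')" by metis
    define T where "T = G * (Z i * H)"
    have T: "T \<in> carrier_mat d ?k" using G Z[OF i] H by (simp add: T_def mc)
    have T_idx: "T $$ (c, e) = (\<Sum>p<d. \<Sum>s<?k. unipotent w y c p * Z i $$ (p, s) * unipotent (mu i) (y' i) s e)"
      if "c < d" "e < ?k" for c e
      unfolding T_def using that G Z[OF i] H
      by (simp add: index_mult_mat_sum[of _ d d _ ?k] index_mult_mat_sum[of _ d ?k _ ?k] mc del: index_mult_mat(1))
        (simp add: G_def H_def sum_distrib_left mult.assoc)
    have "(mat_adjoint u * (Z i * (H * r'))) $$ (a, b) = 0" if ab: "a < d" "b < ?k" "w a < mu i b" for a b
    proof -
      have "mat_adjoint u * (Z i * (H * r')) = mat_adjoint r * (T * r')"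
        unfolding u_adj T_def using r(1) G Z[OF i] H r'(1)
        by (simp add: assoc_mult_mat[of _ d d _ d _ ?k] assoc_mult_mat[of _ d d _ ?k _ ?k]
          assoc_mult_mat[of _ d ?k _ ?k _ ?k] mc)
      then have "(mat_adjoint u * (Z i * (H * r'))) $$ (a, b)
          = (\<Sum>c<d. cnj (r $$ (c, a)) * (\<Sum>e<?k. T $$ (c, e) * r' $$ (e, b)))"
        using ab r(1) T r'(1)
        by (simp add: index_mult_mat_sum[of _ d d _ ?k] index_mult_mat_sum[of _ d ?k _ ?k] mc del: index_mult_mat(1))
      also have "\<dots> = 0"
      proof (intro sum.neutral ballI)
        fix c assume "c \<in> {..<d}"
        then have c: "c < d" by simp
        show "cnj (r $$ (c, a)) * (\<Sum>e<?k. T $$ (c, e) * r' $$ (e, b)) = 0"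
        proof (cases "a < c")
          case True
          then show ?thesis using r(2)[OF c] by simp
        next
          case False
          have "T $$ (c, e) * r' $$ (e, b) = 0" if e: "e < ?k" for e
          proof (cases "b < e")
            case True
            then show ?thesis using r'(2)[OF e] by simp
          next
            case F: False
            have "w c < mu i e" using w_mono[of c a] mu_anti[OF i, of e b] False F ab by linarith
            then show ?thesis using T_idx[OF c e] cert[OF i c e] by simp
          qed
          then have "(\<Sum>e<?k. T $$ (c, e) * r' $$ (e, b)) = 0" by (intro sum.neutral) auto
          then show ?thesis by simp
        qed
      qed
      finally show ?thesis .
    qed
    then show ?thesis using r'(3) by blast
  qed
  then obtain h where "\<And>i. i < m \<Longrightarrow> unitary (k i) (h i) \<and>
    (\<forall>a<d. \<forall>b<k i. w a < mu i b \<longrightarrow> (mat_adjoint u * (Z i * h i)) $$ (a, b) = 0)" by metis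
  then show ?thesis using r(3) unfolding u_def[symmetric] by blast
qed

lemma finite_index_convergent_subsequence:
  fixes s :: "nat \<Rightarrow> 'x \<Rightarrow> complex"
  assumes "finite K" "\<And>n x. x \<in> K \<Longrightarrow> cmod (s n x) \<le> 1"
  shows "\<exists>\<phi> l. strict_mono \<phi> \<and> (\<forall>x\<in>K. (\<lambda>n. s (\<phi> n) x) \<longlonglongrightarrow> l x)"
  using assms
proof (induction K rule: finite_induct)
  case empty
  show ?case by (intro exI[of _ id]) (auto simp: strict_mono_def)
next
  case (insert x K)
  then obtain \<phi> :: "nat \<Rightarrow> nat" and l where \<phi>: "strict_mono \<phi>" "\<forall>x\<in>K. (\<lambda>n. s (\<phi> n) x) \<longlonglongrightarrow> l x" by blast
  have "\<forall>n. cmod (s (\<phi> n) x) \<le> 1" using insert.prems by simp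
  from Bolzano_Weierstrass_complex_disc[OF this] obtain \<psi> :: "nat \<Rightarrow> nat" and z where \<psi>: "strict_mono \<psi>"
    "\<forall>e>0. \<exists>N. \<forall>n\<ge>N. cmod (s (\<phi> (\<psi> n)) x - z) < e" by blast
  have "(\<lambda>n. s (\<phi> (\<psi> n)) x) \<longlonglongrightarrow> z" using \<psi>(2) by (simp add: LIMSEQ_iff)
  moreover have "(\<lambda>n. s (\<phi> (\<psi> n)) y) \<longlonglongrightarrow> l y" if "y \<in> K" for y
    using LIMSEQ_subseq_LIMSEQ[OF \<phi>(2)[rule_format, OF that] \<psi>(1)] by (simp add: comp_def)
  ultimately have "\<forall>y\<in>insert x K. (\<lambda>n. s ((\<phi> \<circ> \<psi>) n) y) \<longlonglongrightarrow> (l(x := z)) y"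
    using insert.hyps by auto
  then show ?case using strict_mono_o[OF \<phi>(1) \<psi>(1)] by blast
qed

lemma unitary_index:
  assumes "unitary n U" "p < n" "q < n"
  shows "(\<Sum>a<n. cnj (U $$ (a, p)) * U $$ (a, q)) = of_bool (p = q)"
proof -
  have "of_real 1 \<cdot>\<^sub>m 1\<^sub>m n = (1\<^sub>m n :: complex mat)" by (rule eq_matI) auto
  then show ?thesis
    using gram_index[of U n n 1, OF _ _ assms(2,3)] unitaryD[OF assms(1)] by simp
qed

lemma unitary_cmod_le:
  assumes "unitary n U" "a < n" "b < n"
  shows "cmod (U $$ (a, b)) \<le> 1"
proof -
  have "complex_of_real (\<Sum>a<n. (cmod (U $$ (a, b)))\<^sup>2) = 1"
    using unitary_index[OF assms(1,3,3)]
    by (simp add: complex_norm_square mult.commute del: of_real_power)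
  then have "(\<Sum>a<n. (cmod (U $$ (a, b)))\<^sup>2) = 1" by (simp only: of_real_eq_1_iff)
  moreover have "(cmod (U $$ (a, b)))\<^sup>2 \<le> (\<Sum>a<n. (cmod (U $$ (a, b)))\<^sup>2)"
    using assms(2) by (intro member_le_sum[where f = "\<lambda>a. (cmod (U $$ (a, b)))\<^sup>2"]) auto
  ultimately have "(cmod (U $$ (a, b)))\<^sup>2 \<le> 1\<^sup>2" by simp
  then show ?thesis by (rule power2_le_imp_le) simp
qed

text \<open>Entries of unitary matrices are bounded, so a subsequence of the certificates converges;
  unitarity and the vanishing conditions are closed. Unipotent certificates may be unbounded, which
  is why they are orthonormalized before this limit.\<close>

lemma unitary_certificate_limit:
  fixes Z :: "nat \<Rightarrow> nat \<Rightarrow> complex mat"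
  assumes Z: "\<And>n i. i < m \<Longrightarrow> Z n i \<in> carrier_mat d (k i)" and Z0: "\<And>i. i < m \<Longrightarrow> Z0 i \<in> carrier_mat d (k i)"
    and Z_lim: "\<And>i a b. i < m \<Longrightarrow> a < d \<Longrightarrow> b < k i \<Longrightarrow> (\<lambda>n. Z n i $$ (a, b)) \<longlonglongrightarrow> Z0 i $$ (a, b)"
    and cert: "\<And>n. \<exists>u h. unitary d u \<and> (\<forall>i<m. unitary (k i) (h i)) \<and>
      (\<forall>i<m. \<forall>a<d. \<forall>b<k i. bad i a b \<longrightarrow> (mat_adjoint u * (Z n i * h i)) $$ (a, b) = 0)"
  shows "\<exists>u h. unitary d u \<and> (\<forall>i<m. unitary (k i) (h i)) \<and>
      (\<forall>i<m. \<forall>a<d. \<forall>b<k i. bad i a b \<longrightarrow> (mat_adjoint u * (Z0 i * h i)) $$ (a, b) = 0)"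
proof -
  have entry: "(mat_adjoint u * (W * h)) $$ (a, b) = (\<Sum>p<d. \<Sum>s<k i. cnj (u $$ (p, a)) * W $$ (p, s) * h $$ (s, b))"
    if "i < m" "u \<in> carrier_mat d d" "W \<in> carrier_mat d (k i)" "h \<in> carrier_mat (k i) (k i)" "a < d" "b < k i" for u W h i a b
    using that by (simp add: index_mult_mat_sum[of _ d d _ "k i"] index_mult_mat_sum[of _ d "k i" _ "k i"]
      mult_carrier_mat[of _ d "k i" _ "k i"] sum_distrib_left mult.assoc del: index_mult_mat(1))
  obtain u h where uh: "\<And>n. unitary d (u n)" "\<And>n i. i < m \<Longrightarrow> unitary (k i) (h n i)"
    "\<And>n i a b. i < m \<Longrightarrow> a < d \<Longrightarrow> b < k i \<Longrightarrow> bad i a b \<Longrightarrow> (mat_adjoint (u n) * (Z n i * h n i)) $$ (a, b) = 0"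
    using cert by metis
  note u_carr = unitaryD(1)[OF uh(1)] and h_carr = unitaryD(1)[OF uh(2)]
  define K where "K = ({..<d} \<times> {..<d}) <+> (SIGMA i:{..<m}. {..<k i} \<times> {..<k i})"
  define s where "s n x = (case x of Inl p \<Rightarrow> u n $$ p | Inr (i, p) \<Rightarrow> h n i $$ p)" for n x
  have "finite K" by (simp add: K_def)
  moreover have "cmod (s n x) \<le> 1" if "x \<in> K" for n x
    using that unitary_cmod_le[OF uh(1)] unitary_cmod_le[OF uh(2)] by (auto simp: K_def s_def)
  ultimately obtain \<phi> l where \<phi>: "strict_mono \<phi>" "\<And>x. x \<in> K \<Longrightarrow> (\<lambda>n. s (\<phi> n) x) \<longlonglongrightarrow> l x"
    using finite_index_convergent_subsequence[of K s] by blast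
  have u_lim: "(\<lambda>n. u (\<phi> n) $$ (a, b)) \<longlonglongrightarrow> l (Inl (a, b))" if "a < d" "b < d" for a b
  proof -
    have "Inl (a, b) \<in> K" using that by (auto simp: K_def)
    from \<phi>(2)[OF this] show ?thesis by (simp add: s_def)
  qed
  have h_lim: "(\<lambda>n. h (\<phi> n) i $$ (a, b)) \<longlonglongrightarrow> l (Inr (i, a, b))" if "i < m" "a < k i" "b < k i" for i a b
  proof -
    have "Inr (i, a, b) \<in> K" using that by (auto simp: K_def)
    from \<phi>(2)[OF this] show ?thesis by (simp add: s_def)
  qed
  define u0 where "u0 = mat d d (\<lambda>(a, b). l (Inl (a, b)))"
  define h0 where "h0 i = mat (k i) (k i) (\<lambda>(a, b). l (Inr (i, a, b)))" for i
  have unitary_lim: "unitary n U0"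
    if U: "\<And>j. unitary n (U j)" and U0: "U0 \<in> carrier_mat n n"
      and lim: "\<And>a b. a < n \<Longrightarrow> b < n \<Longrightarrow> (\<lambda>j. U j $$ (a, b)) \<longlonglongrightarrow> U0 $$ (a, b)" for n U U0
    unfolding unitary_def
  proof (intro conjI U0 eq_matI)
    fix p q assume "p < dim_row (1\<^sub>m n :: complex mat)" "q < dim_col (1\<^sub>m n :: complex mat)"
    then have pq: "p < n" "q < n" by auto
    have "(\<lambda>j. \<Sum>a<n. cnj (U j $$ (a, p)) * U j $$ (a, q)) \<longlonglongrightarrow> (\<Sum>a<n. cnj (U0 $$ (a, p)) * U0 $$ (a, q))"
      using pq by (intro tendsto_sum tendsto_mult tendsto_cnj lim) auto
    then have "(\<lambda>_. of_bool (p = q)) \<longlonglongrightarrow> (\<Sum>a<n. cnj (U0 $$ (a, p)) * U0 $$ (a, q))"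
      by (simp only: unitary_index[OF U pq])
    then have "(\<Sum>a<n. cnj (U0 $$ (a, p)) * U0 $$ (a, q)) = of_bool (p = q)"
      by (rule LIMSEQ_unique[OF _ tendsto_const])
    then show "(mat_adjoint U0 * U0) $$ (p, q) = 1\<^sub>m n $$ (p, q)"
      unfolding index_adjoint_mult[OF U0 U0 pq] using pq by simp
  qed (use U0 in auto)
  have u0: "unitary d u0"
    by (rule unitary_lim[of d "\<lambda>n. u (\<phi> n)"]) (use uh(1) u_lim in \<open>auto simp: u0_def\<close>)
  have h0: "unitary (k i) (h0 i)" if "i < m" for i
    by (rule unitary_lim[of "k i" "\<lambda>n. h (\<phi> n) i"]) (use uh(2) h_lim that in \<open>auto simp: h0_def\<close>)
  have "(mat_adjoint u0 * (Z0 i * h0 i)) $$ (a, b) = 0" if iab: "i < m" "a < d" "b < k i" "bad i a b" for i a b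
  proof -
    have "(\<lambda>n. \<Sum>p<d. \<Sum>s<k i. cnj (u (\<phi> n) $$ (p, a)) * Z (\<phi> n) i $$ (p, s) * h (\<phi> n) i $$ (s, b))
      \<longlonglongrightarrow> (\<Sum>p<d. \<Sum>s<k i. cnj (l (Inl (p, a))) * Z0 i $$ (p, s) * l (Inr (i, s, b)))"
    proof (intro tendsto_sum tendsto_mult tendsto_cnj)
      fix p q assume "p \<in> {..<d}" "q \<in> {..<k i}"
      then show "(\<lambda>n. u (\<phi> n) $$ (p, a)) \<longlonglongrightarrow> l (Inl (p, a))"
        "(\<lambda>n. h (\<phi> n) i $$ (q, b)) \<longlonglongrightarrow> l (Inr (i, q, b))"
        "(\<lambda>n. Z (\<phi> n) i $$ (p, q)) \<longlonglongrightarrow> Z0 i $$ (p, q)"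
        using iab u_lim h_lim LIMSEQ_subseq_LIMSEQ[OF Z_lim[of i p q] \<phi>(1)] by (auto simp: comp_def)
    qed
    moreover have "(\<Sum>p<d. \<Sum>s<k i. cnj (u (\<phi> n) $$ (p, a)) * Z (\<phi> n) i $$ (p, s) * h (\<phi> n) i $$ (s, b)) = 0" for n
      using uh(3)[OF iab, of "\<phi> n"] entry[OF iab(1) u_carr Z[OF iab(1)] h_carr[OF iab(1)] iab(2,3)] by simp
    ultimately have "(\<Sum>p<d. \<Sum>s<k i. cnj (l (Inl (p, a))) * Z0 i $$ (p, s) * l (Inr (i, s, b))) = 0"
      by (simp add: LIMSEQ_const_iff)
    then show ?thesis
      using entry[OF iab(1) unitaryD(1)[OF u0] Z0[OF iab(1)] unitaryD(1)[OF h0[OF iab(1)]] iab(2,3)] iab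
      by (simp add: u0_def h0_def)
  qed
  then show ?thesis using u0 h0 by blast
qed

context diagonal_eigenframe
begin

text \<open>The pencil runs from \<open>X\<close> at \<open>z = 0\<close> to \<open>X'\<close> at
  \<open>z = 1\<close>; its intermediate members need not be tight.\<close>

lemma unitary_certificate:
  assumes w_mono: "\<And>a c. a \<le> c \<Longrightarrow> c < d \<Longrightarrow> w a \<le> w c"
    and mu_anti: "\<And>i b c. i < m \<Longrightarrow> b \<le> c \<Longrightarrow> c < k i \<Longrightarrow> mu i c \<le> mu i b"
    and X': "\<And>i. i < m \<Longrightarrow> X' i \<in> carrier_mat d (k i)"
  shows "\<exists>u h. unitary d u \<and> (\<forall>i<m. unitary (k i) (h i)) \<and>
    (\<forall>i<m. \<forall>a<d. \<forall>b<k i. w a < mu i b \<longrightarrow> (mat_adjoint u * (X' i * h i)) $$ (a, b) = 0)"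
proof -
  define D where "D i a b = X' i $$ (a, b) - X i $$ (a, b)" for i a b
  let ?cert = "pencil_certificate m d k w mu (\<lambda>i a b. X i $$ (a, b)) D"
  have "\<exists>\<epsilon>>0. \<forall>z. cmod z < \<epsilon> \<longrightarrow> (\<exists>y. ?cert z y)"
    by (rule unipotent_certificate_near_zero[OF eigen rigid])
  then have cofinite: "finite (- {z. \<exists>y. ?cert z y})" by (rule unipotent_certificate_cofinite)
  \<comment> \<open>The point \<open>z = 1\<close> may itself belong to the finite exceptional set;
    this sequence of distinct points tends to \<open>1\<close> and leaves that set after finitely
    many terms.\<close>
  define z where "z n = 1 + complex_of_real (1 / real (Suc n))" for n
  have "inj z" by (auto simp: inj_def z_def)
  then have "finite (z -` (- {z. \<exists>y. ?cert z y}))" using finite_vimageI cofinite by blast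
  then obtain N where N: "\<forall>n\<in>z -` (- {z. \<exists>y. ?cert z y}). n < N"
    using finite_nat_set_iff_bounded by blast
  then have ex: "\<exists>y. ?cert (z (n + N)) y" for n by fastforce
  have z_lim: "(\<lambda>n. z (n + N)) \<longlonglongrightarrow> 1"
  proof -
    have "(\<lambda>n. 1 + complex_of_real (1 / real (Suc n))) \<longlonglongrightarrow> 1 + complex_of_real 0"
      by (intro tendsto_add tendsto_const tendsto_of_real LIMSEQ_Suc[OF lim_1_over_n])
    then show ?thesis by (intro LIMSEQ_ignore_initial_segment) (simp add: z_def)
  qed
  define Z where "Z n i = mat d (k i) (\<lambda>(a, b). X i $$ (a, b) + z (n + N) * D i a b)" for n i
  show ?thesis
  proof (rule unitary_certificate_limit[where Z = Z])
    show "Z n i \<in> carrier_mat d (k i)" for n i by (simp add: Z_def)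
    show "(\<lambda>n. Z n i $$ (a, b)) \<longlonglongrightarrow> X' i $$ (a, b)" if "i < m" "a < d" "b < k i" for i a b
    proof -
      have "(\<lambda>n. X i $$ (a, b) + z (n + N) * D i a b) \<longlonglongrightarrow> X i $$ (a, b) + 1 * D i a b"
        by (intro tendsto_intros z_lim)
      then show ?thesis using that by (simp add: Z_def D_def)
    qed
    fix n
    obtain y where y: "?cert (z (n + N)) y" using ex by blast
    show "\<exists>u h. unitary d u \<and> (\<forall>i<m. unitary (k i) (h i)) \<and>
      (\<forall>i<m. \<forall>a<d. \<forall>b<k i. w a < mu i b \<longrightarrow> (mat_adjoint u * (Z n i * h i)) $$ (a, b) = 0)"
    proof (rule unipotent_certificate_orthonormalize[OF w_mono mu_anti])
      fix i a b assume iab: "i < m" "a < d" "b < k i" "w a < mu i b"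
      show "(\<Sum>p<d. \<Sum>s<k i. unipotent w (\<lambda>p s. y (Inl (p, s))) a p * Z n i $$ (p, s)
          * unipotent (mu i) (\<lambda>p s. y (Inr (i, p, s))) s b) = 0"
        using y iab unfolding pencil_certificate_def by (simp add: Z_def)
    qed (simp_all add: Z_def)
  qed (rule X')
qed

end

section \<open>The lower bound for the energy\<close>

text \<open>Tangent line inequality for the convex function \<open>t^{-2}\<close>. Multiplied by
  \<open>t^2 w^3\<close>, the gap is \<open>(w - t)^2 (w + 2 t)\<close>.\<close>

lemma inverse_square_tangent:
  fixes t w :: real
  assumes "t > 0" "w > 0"
  shows "1 / t\<^sup>2 \<ge> 1 / w\<^sup>2 - 2 * (t - w) / w ^ 3"
proof -
  have "t\<^sup>2 * (w - 2 * (t - w)) \<le> w ^ 3"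
  proof -
    have "0 \<le> (w - t)\<^sup>2 * (w + 2 * t)" using assms by simp
    also have "\<dots> = w ^ 3 - t\<^sup>2 * (w - 2 * (t - w))"
      by (simp add: power2_eq_square power3_eq_cube algebra_simps)
    finally show ?thesis by simp
  qed
  then have "(w - 2 * (t - w)) / w ^ 3 \<le> (w ^ 3 / t\<^sup>2) / w ^ 3"
    using assms by (intro divide_right_mono) (simp_all add: le_divide_eq mult.commute)
  moreover have "1 / w\<^sup>2 - 2 * (t - w) / w ^ 3 = (w - 2 * (t - w)) / w ^ 3"
    using assms by (simp add: power2_eq_square power3_eq_cube field_simps)
  ultimately show ?thesis using assms by simp
qed

section \<open>Traces, energy and frame operators under unitary changes of basis\<close>

lemma mtrace_unitary_conjugate:
  assumes U: "unitary n U" and A: "A \<in> carrier_mat n n"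
  shows "mtrace (mat_adjoint U * A * U) = mtrace A"
proof -
  note U' = unitaryD[OF U]
  note mc = mult_carrier_mat[of _ n n _ n]
  have "mtrace (mat_adjoint U * A * U) = mtrace (U * (mat_adjoint U * A))"
    using U'(1) A by (intro mtrace_mult_commute) (simp_all add: mc)
  also have "U * (mat_adjoint U * A) = (U * mat_adjoint U) * A"
    using U'(1) A by (simp add: assoc_mult_mat[of _ n n _ n _ n])
  finally show ?thesis using U'(3) A by simp
qed

lemma unitary_conjugate_mult:
  assumes U: "unitary n U" and A: "A \<in> carrier_mat n n" and B: "B \<in> carrier_mat n n"
  shows "(mat_adjoint U * A * U) * (mat_adjoint U * B * U) = mat_adjoint U * (A * B) * U"
proof -
  note U' = unitaryD[OF U]
  note as = assoc_mult_mat[of _ n n _ n _ n] mult_carrier_mat[of _ n n _ n]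
  have "(mat_adjoint U * A * U) * (mat_adjoint U * B * U) = mat_adjoint U * (A * ((U * mat_adjoint U) * (B * U)))"
    using U'(1) A B by (simp add: as)
  also have "\<dots> = mat_adjoint U * (A * (B * U))" using U'(1,3) B by (simp add: as(2))
  finally show ?thesis using U'(1) A B by (simp add: as)
qed

lemma energy_unitary_conjugate:
  assumes U: "unitary n U" and A: "A \<in> carrier_mat n n" and B: "B \<in> carrier_mat n n"
  shows "energy (mat_adjoint U * A * U) (mat_adjoint U * B * U) = energy A B"
  using A B by (simp add: energy_def unitary_conjugate_mult[OF U] mtrace_unitary_conjugate[OF U] mult_carrier_mat[of _ n n _ n])

lemma trace_square_hermitian:
  assumes A: "A \<in> carrier_mat n n" and herm: "mat_adjoint A = A"
  shows "mtrace (A * A) = of_real (\<Sum>a<n. \<Sum>b<n. (cmod (A $$ (a, b)))\<^sup>2)"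
proof -
  have "A $$ (a, b) * A $$ (b, a) = of_real ((cmod (A $$ (a, b)))\<^sup>2)" if "a < n" "b < n" for a b
    using arg_cong[OF herm, of "\<lambda>M. M $$ (b, a)"] that A by (simp add: complex_norm_square del: of_real_power)
  then show ?thesis unfolding mtrace_mult[OF A A] of_real_sum by (intro sum.cong refl) auto
qed

lemma hermitian_inverse:
  fixes A B :: "complex mat"
  assumes A: "A \<in> carrier_mat n n" and B: "B \<in> carrier_mat n n" and AB: "A * B = 1\<^sub>m n" and herm: "mat_adjoint A = A"
  shows "mat_adjoint B = B"
proof -
  have BA: "mat_adjoint B * A = 1\<^sub>m n" using adjoint_mult[OF A B] AB herm by simp
  have "mat_adjoint B = mat_adjoint B * (A * B)" using AB B by simp
  also have "\<dots> = (mat_adjoint B * A) * B" using A B by (simp add: assoc_mult_mat[of _ n n _ n _ n])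
  finally show ?thesis using BA B by simp
qed

lemma frame_op_hermitian:
  assumes "\<And>i. i < m \<Longrightarrow> Q i \<in> carrier_mat d (k i)"
  shows "mat_adjoint (frame_op m d Q) = frame_op m d Q"
proof (rule eq_matI)
  fix a b assume "a < dim_row (frame_op m d Q)" "b < dim_col (frame_op m d Q)"
  then have ab: "a < d" "b < d" by auto
  have "cnj ((Q i * mat_adjoint (Q i)) $$ (b, a)) = (Q i * mat_adjoint (Q i)) $$ (a, b)" if "i < m" for i
    unfolding index_mult_adjoint[OF assms[OF that] assms[OF that] ab]
      index_mult_adjoint[OF assms[OF that] assms[OF that] ab(2,1)] by (simp add: mult.commute)
  then show "mat_adjoint (frame_op m d Q) $$ (a, b) = frame_op m d Q $$ (a, b)"
    using ab by (simp add: frame_op_index)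
qed auto

lemma frame_op_form_nonneg:
  assumes Q: "\<And>i. i < m \<Longrightarrow> Q i \<in> carrier_mat d (k i)"
  shows "Re (\<Sum>p<d. \<Sum>q<d. cnj (x p) * frame_op m d Q $$ (p, q) * x q) \<ge> 0"
proof -
  have "(\<Sum>p<d. \<Sum>q<d. cnj (x p) * frame_op m d Q $$ (p, q) * x q)
      = (\<Sum>p<d. \<Sum>q<d. \<Sum>i<m. \<Sum>b<k i. cnj (x p) * (Q i $$ (p, b) * cnj (Q i $$ (q, b))) * x q)"
    by (intro sum.cong refl)
      (simp add: frame_op_index index_mult_adjoint[OF Q Q] sum_distrib_left sum_distrib_right del: index_mult_mat(1))
  also have "\<dots> = (\<Sum>i<m. \<Sum>p<d. \<Sum>q<d. \<Sum>b<k i. cnj (x p) * (Q i $$ (p, b) * cnj (Q i $$ (q, b))) * x q)"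
    by (simp only: sum.swap[of _ "{..<m}"])
  also have "\<dots> = (\<Sum>i<m. form d (\<lambda>p q. \<Sum>l<k i. cnj (mat_adjoint (Q i) $$ (l, p)) * mat_adjoint (Q i) $$ (l, q)) x x)"
  proof (intro sum.cong refl)
    fix i assume "i \<in> {..<m}"
    then have "Q i \<in> carrier_mat d (k i)" using Q by simp
    then show "(\<Sum>p<d. \<Sum>q<d. \<Sum>b<k i. cnj (x p) * (Q i $$ (p, b) * cnj (Q i $$ (q, b))) * x q)
      = form d (\<lambda>p q. \<Sum>l<k i. cnj (mat_adjoint (Q i) $$ (l, p)) * mat_adjoint (Q i) $$ (l, q)) x x"
      unfolding form_def sum_distrib_left sum_distrib_right by (intro sum.cong refl) auto
  qed
  also have "\<dots> = of_real (\<Sum>i<m. \<Sum>l<k i. (cmod (\<Sum>q<d. mat_adjoint (Q i) $$ (l, q) * x q))\<^sup>2)"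
    unfolding of_real_sum
    using Q by (intro sum.cong refl) (simp add: form_gram[OF carrier_adjoint] del: index_adjoint)
  finally show ?thesis by (simp add: sum_nonneg)
qed

text \<open>The nonnegative form of the frame operator \<open>T\<close>, taken at the vector
  \<open>F e_a - s e_a\<close>, has the value \<open>F_aa - 2 s + s^2 T_aa\<close>. Nonnegativity
  for all real \<open>s\<close> forces \<open>T_aa > 0\<close>, and \<open>s = 1 / T_aa\<close>
  gives the bound.\<close>

lemma inverse_diagonal_bound:
  assumes Q: "\<And>i. i < m \<Longrightarrow> Q i \<in> carrier_mat d (k i)" and F: "F \<in> carrier_mat d d"
    and TF: "frame_op m d Q * F = 1\<^sub>m d" and a: "a < d"
  shows "Re (frame_op m d Q $$ (a, a)) > 0" "1 / Re (frame_op m d Q $$ (a, a)) \<le> Re (F $$ (a, a))"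
proof -
  let ?T = "frame_op m d Q"
  define t where "t = Re (?T $$ (a, a))"
  have sym: "?T $$ (p, q) = cnj (?T $$ (q, p))" if "p < d" "q < d" for p q
    using arg_cong[where f = "\<lambda>M. M $$ (p, q)", OF frame_op_hermitian[of m Q d k, OF Q]] that by simp
  have Taa: "?T $$ (a, a) = of_real t" using sym[OF a a] by (simp add: t_def complex_eq_iff)
  have TF_idx: "(\<Sum>q<d. ?T $$ (p, q) * F $$ (q, a)) = of_bool (p = a)" if "p < d" for p
    using arg_cong[OF TF, of "\<lambda>M. M $$ (p, a)"] index_mult_mat_sum[OF frame_op_carrier F that a] that a by simp
  have quad: "Re (F $$ (a, a)) - 2 * s + s\<^sup>2 * t \<ge> 0" for s :: real
  proof -
    define x where "x q = F $$ (q, a) - of_real s * of_bool (q = a)" for q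
    have Tx: "(\<Sum>q<d. ?T $$ (p, q) * x q) = of_bool (p = a) - of_real s * ?T $$ (p, a)" if "p < d" for p
    proof -
      have "(\<Sum>q<d. ?T $$ (p, q) * x q) = (\<Sum>q<d. ?T $$ (p, q) * F $$ (q, a)) - of_real s * (\<Sum>q<d. ?T $$ (p, q) * of_bool (q = a))"
        unfolding x_def sum_distrib_left sum_subtractf[symmetric] by (intro sum.cong refl) (simp add: algebra_simps)
      also have "(\<Sum>q<d. ?T $$ (p, q) * of_bool (q = a)) = ?T $$ (p, a)"
        using a by (intro sum_of_bool_eq_mult(2)) auto
      finally show ?thesis using TF_idx[OF that] by simp
    qed
    have "(\<Sum>p<d. \<Sum>q<d. cnj (x p) * ?T $$ (p, q) * x q) = (\<Sum>p<d. cnj (x p) * (of_bool (p = a) - of_real s * ?T $$ (p, a)))"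
    proof (intro sum.cong refl)
      fix p assume "p \<in> {..<d}"
      then have "(\<Sum>q<d. ?T $$ (p, q) * x q) = of_bool (p = a) - of_real s * ?T $$ (p, a)" using Tx by simp
      then show "(\<Sum>q<d. cnj (x p) * ?T $$ (p, q) * x q) = cnj (x p) * (of_bool (p = a) - of_real s * ?T $$ (p, a))"
        by (simp only: mult.assoc sum_distrib_left[symmetric])
    qed
    also have "\<dots> = (\<Sum>p<d. cnj (x p) * of_bool (p = a)) - of_real s * (\<Sum>p<d. cnj (x p) * ?T $$ (p, a))"
      unfolding sum_distrib_left sum_subtractf[symmetric] by (intro sum.cong refl) (simp add: algebra_simps)
    also have "(\<Sum>p<d. cnj (x p) * of_bool (p = a)) = cnj (x a)" using a by (intro sum_of_bool_eq_mult(2)) auto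
    also have "(\<Sum>p<d. cnj (x p) * ?T $$ (p, a)) = cnj (\<Sum>p<d. ?T $$ (a, p) * x p)"
      unfolding cnj_sum
    proof (intro sum.cong refl)
      fix p assume "p \<in> {..<d}"
      then have "?T $$ (p, a) = cnj (?T $$ (a, p))" using sym[of p a] a by simp
      then show "cnj (x p) * ?T $$ (p, a) = cnj (?T $$ (a, p) * x p)" by simp
    qed
    also have "\<dots> = 1 - of_real s * of_real t" unfolding Tx[OF a] Taa by simp
    finally have eq: "(\<Sum>p<d. \<Sum>q<d. cnj (x p) * ?T $$ (p, q) * x q)
        = cnj (x a) - of_real s * (1 - of_real s * of_real t)" .
    have "Re (\<Sum>p<d. \<Sum>q<d. cnj (x p) * ?T $$ (p, q) * x q) = Re (F $$ (a, a)) - 2 * s + s\<^sup>2 * t"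
      unfolding eq by (simp add: x_def algebra_simps power2_eq_square)
    then show ?thesis using frame_op_form_nonneg[of m Q d k x, OF Q] by (simp only:)
  qed
  show t: "Re (?T $$ (a, a)) > 0"
  proof (rule ccontr)
    assume "\<not> ?thesis"
    then have "t \<le> 0" by (simp add: t_def)
    \<comment> \<open>\<open>2 * s\<close> exceeds the absolute value of
      \<open>Re (F $$ (a, a))\<close>, so with \<open>t \<le> 0\<close> the quadratic expression
      would be negative.\<close>
    define s where "s = (\<bar>Re (F $$ (a, a))\<bar> + 1) / 2"
    have "s\<^sup>2 * t \<le> 0" using \<open>t \<le> 0\<close> by (simp add: mult_nonneg_nonpos)
    moreover have "2 * s = \<bar>Re (F $$ (a, a))\<bar> + 1" by (simp add: s_def)
    ultimately show False using quad[of s] abs_ge_self[of "Re (F $$ (a, a))"] by linarith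
  qed
  then show "1 / Re (?T $$ (a, a)) \<le> Re (F $$ (a, a))"
    using quad[of "1 / t"] by (simp add: t_def[symmetric] power2_eq_square)
qed

lemma frame_op_conjugate:
  assumes Q: "\<And>i. i < m \<Longrightarrow> Q i \<in> carrier_mat d (k i)" and A: "A \<in> carrier_mat d d"
  shows "frame_op m d (\<lambda>i. A * Q i) = A * frame_op m d Q * mat_adjoint A"
proof (rule eq_matI)
  fix a b assume "a < dim_row (A * frame_op m d Q * mat_adjoint A)" "b < dim_col (A * frame_op m d Q * mat_adjoint A)"
  then have ab: "a < d" "b < d" using A by auto
  have "(A * frame_op m d Q * mat_adjoint A) $$ (a, b)
      = (\<Sum>q<d. (\<Sum>p<d. A $$ (a, p) * (\<Sum>i<m. (Q i * mat_adjoint (Q i)) $$ (p, q))) * cnj (A $$ (b, q)))"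
    using ab A by (simp add: index_mult_mat_sum[of _ d d _ d] mult_carrier_mat[of _ d d _ d] frame_op_index del: index_mult_mat(1))
  also have "\<dots> = (\<Sum>q<d. \<Sum>p<d. \<Sum>i<m. A $$ (a, p) * (Q i * mat_adjoint (Q i)) $$ (p, q) * cnj (A $$ (b, q)))"
    by (simp only: sum_distrib_left sum_distrib_right)
  also have "\<dots> = (\<Sum>i<m. \<Sum>q<d. \<Sum>p<d. A $$ (a, p) * (Q i * mat_adjoint (Q i)) $$ (p, q) * cnj (A $$ (b, q)))"
    by (simp only: sum.swap[of _ "{..<m}"])
  also have "\<dots> = (\<Sum>i<m. (A * (Q i * mat_adjoint (Q i)) * mat_adjoint A) $$ (a, b))"
  proof (intro sum.cong refl)
    fix i assume "i \<in> {..<m}"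
    then have "Q i * mat_adjoint (Q i) \<in> carrier_mat d d"
      using Q by (intro mult_carrier_mat[of _ d "k i" _ d]) auto
    then show "(\<Sum>q<d. \<Sum>p<d. A $$ (a, p) * (Q i * mat_adjoint (Q i)) $$ (p, q) * cnj (A $$ (b, q)))
      = (A * (Q i * mat_adjoint (Q i)) * mat_adjoint A) $$ (a, b)"
      using ab A by (simp add: index_mult_mat_sum[of _ d d _ d] mult_carrier_mat[of _ d d _ d] sum_distrib_right del: index_mult_mat(1))
  qed
  also have "\<dots> = frame_op m d (\<lambda>i. A * Q i) $$ (a, b)"
    unfolding frame_op_index[OF ab]
  proof (intro sum.cong refl)
    fix i assume "i \<in> {..<m}"
    then have Qi: "Q i \<in> carrier_mat d (k i)" using Q by simp
    have "A * (Q i * mat_adjoint (Q i)) * mat_adjoint A = (A * Q i) * mat_adjoint (A * Q i)"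
      using A Qi
      by (simp add: adjoint_mult[of _ d d _ "k i"] assoc_mult_mat[of _ d d _ "k i" _ d] assoc_mult_mat[of _ d d _ d _ d]
        assoc_mult_mat[of _ d "k i" _ d _ d] mult_carrier_mat[of _ d "k i" _ d] mult_carrier_mat[of _ "k i" d _ d])
    then show "(A * (Q i * mat_adjoint (Q i)) * mat_adjoint A) $$ (a, b) = (A * Q i * mat_adjoint (A * Q i)) $$ (a, b)" by simp
  qed
  finally show "frame_op m d (\<lambda>i. A * Q i) $$ (a, b) = (A * frame_op m d Q * mat_adjoint A) $$ (a, b)" ..
qed (use A in auto)

lemma frame_op_right_unitary:
  assumes Q: "\<And>i. i < m \<Longrightarrow> Q i \<in> carrier_mat d (k i)" and h: "\<And>i. i < m \<Longrightarrow> unitary (k i) (h i)"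
  shows "frame_op m d (\<lambda>i. Q i * h i) = frame_op m d Q"
proof -
  have "(Q i * h i) * mat_adjoint (Q i * h i) = Q i * mat_adjoint (Q i)" if i: "i < m" for i
  proof -
    note h' = unitaryD[OF h[OF i]]
    have "(Q i * h i) * mat_adjoint (Q i * h i) = Q i * ((h i * mat_adjoint (h i)) * mat_adjoint (Q i))"
      using Q[OF i] h'(1)
      by (simp add: adjoint_mult[of _ d "k i" _ "k i"] assoc_mult_mat[of _ d "k i" _ "k i" _ d]
        assoc_mult_mat[of _ "k i" "k i" _ "k i" _ d] mult_carrier_mat[of _ "k i" "k i" _ d])
    then show ?thesis using h' Q[OF i] by simp
  qed
  then show ?thesis unfolding frame_op_def by (intro eq_matI) auto
qed

lemma tight_family_unitary:
  assumes Q: "tight_family m d k v Q" and U: "unitary d U" and h: "\<And>i. i < m \<Longrightarrow> unitary (k i) (h i)"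
  shows "tight_family m d k v (\<lambda>i. U * (Q i * h i))"
  unfolding tight_family_def
proof (intro allI impI conjI)
  fix i assume i: "i < m"
  let ?k = "k i"
  have Qi: "Q i \<in> carrier_mat d ?k" "mat_adjoint (Q i) * Q i = of_real ((v i)\<^sup>2) \<cdot>\<^sub>m 1\<^sub>m ?k"
    using Q i by (auto simp: tight_family_def)
  note h' = unitaryD[OF h[OF i]] and U' = unitaryD[OF U]
  note mc = mult_carrier_mat[of _ d d _ ?k] mult_carrier_mat[of _ d ?k _ ?k] mult_carrier_mat[of _ ?k ?k _ ?k]
    mult_carrier_mat[of _ ?k d _ ?k]
  have Qh: "Q i * h i \<in> carrier_mat d ?k" using Qi(1) h'(1) by (simp add: mc)
  show "U * (Q i * h i) \<in> carrier_mat d ?k" using Qh U'(1) by (simp add: mc)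
  have "mat_adjoint (U * (Q i * h i)) * (U * (Q i * h i))
      = mat_adjoint (Q i * h i) * ((mat_adjoint U * U) * (Q i * h i))"
    using Qh U'(1) by (simp add: adjoint_mult[of _ d d _ ?k] assoc_mult_mat[of _ ?k d _ d _ ?k] assoc_mult_mat[of _ d d _ d _ ?k] mc)
  also have "\<dots> = mat_adjoint (Q i * h i) * (Q i * h i)" by (simp only: U'(2) left_mult_one_mat[OF Qh])
  also have "\<dots> = mat_adjoint (h i) * ((mat_adjoint (Q i) * Q i) * h i)"
    using Qi(1) h'(1) by (simp add: adjoint_mult[of _ d ?k _ ?k] assoc_mult_mat[of _ ?k d _ ?k _ ?k] assoc_mult_mat[of _ ?k ?k _ d _ ?k] mc)
  also have "\<dots> = of_real ((v i)\<^sup>2) \<cdot>\<^sub>m 1\<^sub>m ?k"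
    unfolding Qi(2) using h' by (simp add: mult_smult_assoc_mat[of _ ?k ?k _ ?k] mult_smult_distrib[of _ ?k ?k _ ?k])
  finally show "mat_adjoint (U * (Q i * h i)) * (U * (Q i * h i)) = of_real ((v i)\<^sup>2) \<cdot>\<^sub>m 1\<^sub>m ?k" .
qed

lemma unitary_one: "unitary n (1\<^sub>m n)" by (simp add: unitary_def)

lemma unitary_adjoint: "unitary n U \<Longrightarrow> unitary n (mat_adjoint U)"
  by (simp add: unitary_def[of n "mat_adjoint U"] unitaryD)

lemma energy_real_diag:
  assumes w: "\<And>a. a < d \<Longrightarrow> w a > 0"
  shows "energy (real_diag d w) (real_diag d (\<lambda>a. 1 / w a)) = (\<Sum>a<d. (w a)\<^sup>2 + 1 / (w a)\<^sup>2)"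
proof -
  have "mtrace (real_diag d u * real_diag d u) = of_real (\<Sum>a<d. (u a)\<^sup>2)" for u
  proof -
    have "mtrace (real_diag d u * real_diag d u) = (\<Sum>a<d. \<Sum>b<d. real_diag d u $$ (a, b) * real_diag d u $$ (b, a))"
      by (rule mtrace_mult) auto
    also have "\<dots> = (\<Sum>a<d. of_real ((u a)\<^sup>2))"
    proof (intro sum.cong refl)
      fix a assume "a \<in> {..<d}"
      then show "(\<Sum>b<d. real_diag d u $$ (a, b) * real_diag d u $$ (b, a)) = of_real ((u a)\<^sup>2)"
        by (subst sum_eq_single[of a]) (auto simp: power2_eq_square)
    qed
    finally show ?thesis by simp
  qed
  then show ?thesis by (simp add: energy_def sum.distrib power_one_over)
qed

context diagonal_eigenframe
begin

text \<open>Column \<open>b\<close> of \<open>X i\<close> and of \<open>Y i\<close> has squared norm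
  \<open>(v i)^2\<close>. For \<open>X\<close> this mass lies on rows whose slope is exactly that of
  \<open>mu i b\<close>; for \<open>Y\<close> the zero pattern leaves only rows with
  \<open>w a \<ge> mu i b\<close>, whose slopes are at least as large.\<close>

lemma slope_sum_le:
  assumes Y: "tight_family m d k v Y"
    and pattern: "\<And>i a b. i < m \<Longrightarrow> a < d \<Longrightarrow> b < k i \<Longrightarrow> w a < mu i b \<Longrightarrow> Y i $$ (a, b) = 0"
  shows "(\<Sum>a<d. potential_slope (w a) * (Re (frame_op m d Y $$ (a, a)) - w a)) \<ge> 0"
proof -
  have sum_eq: "(\<Sum>a<d. potential_slope (w a) * Re (frame_op m d Z $$ (a, a)))
      = (\<Sum>i<m. \<Sum>b<k i. \<Sum>a<d. potential_slope (w a) * (cmod (Z i $$ (a, b)))\<^sup>2)"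
    if Z: "tight_family m d k v Z" for Z
  proof -
    have "Re (frame_op m d Z $$ (a, a)) = (\<Sum>i<m. \<Sum>b<k i. (cmod (Z i $$ (a, b)))\<^sup>2)" if a: "a < d" for a
    proof -
      have "(Z i * mat_adjoint (Z i)) $$ (a, a) = of_real (\<Sum>b<k i. (cmod (Z i $$ (a, b)))\<^sup>2)" if "i < m" for i
        using Z that index_mult_adjoint[of "Z i" d "k i" "Z i" a a] a
        by (simp add: tight_family_def complex_norm_square del: index_mult_mat(1) of_real_power)
      then show ?thesis unfolding frame_op_index[OF a a] Re_sum by (intro sum.cong refl) auto
    qed
    then have "(\<Sum>a<d. potential_slope (w a) * Re (frame_op m d Z $$ (a, a)))
      = (\<Sum>a<d. \<Sum>i<m. \<Sum>b<k i. potential_slope (w a) * (cmod (Z i $$ (a, b)))\<^sup>2)"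
      unfolding sum_distrib_left[symmetric] by (intro sum.cong refl) simp
    then show ?thesis by (simp only: sum.swap[of _ _ "{..<d}"])
  qed
  have norm: "(\<Sum>a<d. (cmod (Z i $$ (a, b)))\<^sup>2) = (v i)\<^sup>2" if Z: "tight_family m d k v Z" and i: "i < m" "b < k i" for Z i b
  proof -
    have "complex_of_real (\<Sum>a<d. (cmod (Z i $$ (a, b)))\<^sup>2) = of_real ((v i)\<^sup>2)"
      using gram_index[of "Z i" d "k i" "(v i)\<^sup>2" b b] Z i
      by (simp add: tight_family_def complex_norm_square mult.commute del: of_real_power)
    then show ?thesis by (simp only: of_real_eq_iff)
  qed
  have "(\<Sum>a<d. potential_slope (w a) * w a) = (\<Sum>a<d. potential_slope (w a) * Re (frame_op m d X $$ (a, a)))"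
    by (intro sum.cong refl) (simp add: op_X)
  also have "\<dots> = (\<Sum>i<m. \<Sum>b<k i. \<Sum>a<d. potential_slope (w a) * (cmod (X i $$ (a, b)))\<^sup>2)"
    by (rule sum_eq[OF X])
  also have "\<dots> = (\<Sum>i<m. \<Sum>b<k i. \<Sum>a<d. potential_slope (mu i b) * (cmod (X i $$ (a, b)))\<^sup>2)"
  proof (intro sum.cong refl)
    fix i b a assume "i \<in> {..<m}" "b \<in> {..<k i}" "a \<in> {..<d}"
    then show "potential_slope (w a) * (cmod (X i $$ (a, b)))\<^sup>2 = potential_slope (mu i b) * (cmod (X i $$ (a, b)))\<^sup>2"
      using eigen[of i a b] by (cases "X i $$ (a, b) = 0") auto
  qed
  also have "\<dots> = (\<Sum>i<m. \<Sum>b<k i. \<Sum>a<d. potential_slope (mu i b) * (cmod (Y i $$ (a, b)))\<^sup>2)"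
    unfolding sum_distrib_left[symmetric] by (intro sum.cong refl) (simp add: norm[OF X] norm[OF Y])
  also have "\<dots> \<le> (\<Sum>i<m. \<Sum>b<k i. \<Sum>a<d. potential_slope (w a) * (cmod (Y i $$ (a, b)))\<^sup>2)"
  proof (intro sum_mono)
    fix i b a assume "i \<in> {..<m}" "b \<in> {..<k i}" "a \<in> {..<d}"
    then have i: "i < m" "a < d" "b < k i" by auto
    show "potential_slope (mu i b) * (cmod (Y i $$ (a, b)))\<^sup>2 \<le> potential_slope (w a) * (cmod (Y i $$ (a, b)))\<^sup>2"
    proof (cases "w a < mu i b")
      case True
      then show ?thesis using pattern[OF i] by simp
    next
      case False
      then have "potential_slope (mu i b) \<le> potential_slope (w a)"
        using potential_slope_less_iff[OF w[OF i(2)] mu_pos[OF i(1,3)]] by linarith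
      then show ?thesis by (rule mult_right_mono) simp
    qed
  qed
  also have "\<dots> = (\<Sum>a<d. potential_slope (w a) * Re (frame_op m d Y $$ (a, a)))" by (rule sum_eq[OF Y, symmetric])
  finally show ?thesis by (simp add: right_diff_distrib sum_subtractf)
qed

text \<open>The quadratic part of the potential is expanded exactly at the diagonal matrix of
  \<open>w\<close>, and its remainder is the squared Frobenius distance. The inverse part is only
  bounded below, through the diagonal of \<open>F'\<close> and the tangent line of
  \<open>t^{-2}\<close>. The linear terms combine to twice the slope sum, nonnegative by
  \<open>slope_sum_le\<close>.\<close>

lemma energy_lower_bound:
  assumes w_mono: "\<And>a c. a \<le> c \<Longrightarrow> c < d \<Longrightarrow> w a \<le> w c"
    and mu_anti: "\<And>i b c. i < m \<Longrightarrow> b \<le> c \<Longrightarrow> c < k i \<Longrightarrow> mu i c \<le> mu i b"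
    and X': "tight_family m d k v X'" and F: "F \<in> carrier_mat d d" "frame_op m d X' * F = 1\<^sub>m d"
  shows "\<exists>u. unitary d u \<and>
    (\<Sum>a<d. \<Sum>b<d. (cmod ((mat_adjoint u * frame_op m d X' * u) $$ (a, b) - real_diag d w $$ (a, b)))\<^sup>2)
      \<le> energy (frame_op m d X') F - energy (real_diag d w) (real_diag d (\<lambda>a. 1 / w a))"
proof -
  have X'_carr: "X' i \<in> carrier_mat d (k i)" if "i < m" for i using X' that by (simp add: tight_family_def)
  obtain u h where u: "unitary d u" and h: "\<And>i. i < m \<Longrightarrow> unitary (k i) (h i)"
    and pattern: "\<And>i a b. i < m \<Longrightarrow> a < d \<Longrightarrow> b < k i \<Longrightarrow> w a < mu i b \<Longrightarrow>
      (mat_adjoint u * (X' i * h i)) $$ (a, b) = 0"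
    using unitary_certificate[OF w_mono mu_anti X'_carr] by blast
  note u' = unitaryD[OF u]
  define Y where "Y i = mat_adjoint u * (X' i * h i)" for i
  have Y: "tight_family m d k v Y" unfolding Y_def by (rule tight_family_unitary[OF X' unitary_adjoint[OF u] h])
  have Y_carr: "Y i \<in> carrier_mat d (k i)" if "i < m" for i using Y that by (simp add: tight_family_def)
  define T where "T = mat_adjoint u * frame_op m d X' * u"
  define F' where "F' = mat_adjoint u * F * u"
  have T: "T \<in> carrier_mat d d" and F': "F' \<in> carrier_mat d d"
    using u'(1) F(1) by (simp_all add: T_def F'_def mult_carrier_mat[of _ d d _ d])
  have Xh_carr: "X' i * h i \<in> carrier_mat d (k i)" if "i < m" for i
    using X'_carr[OF that] unitaryD(1)[OF h[OF that]] by (simp add: mult_carrier_mat[of _ d "k i" _ "k i"])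
  have op_Y: "frame_op m d Y = T"
    unfolding Y_def T_def using frame_op_conjugate[of m "\<lambda>i. X' i * h i" d k "mat_adjoint u", OF Xh_carr carrier_adjoint[OF u'(1)]]
      frame_op_right_unitary[of m X' d k h, OF X'_carr h] by simp
  have TF: "T * F' = 1\<^sub>m d"
    unfolding T_def F'_def unitary_conjugate_mult[OF u frame_op_carrier F(1)] F(2) using u' by simp
  have T_herm: "mat_adjoint T = T" using frame_op_hermitian[of m Y d k, OF Y_carr] by (simp add: op_Y)
  have F'_herm: "mat_adjoint F' = F'" by (rule hermitian_inverse[OF T F' TF T_herm])
  define t where "t a = Re (T $$ (a, a))" for a
  have t: "t a > 0" "1 / t a \<le> Re (F' $$ (a, a))" if "a < d" for a
    using inverse_diagonal_bound[of m Y d k F' a, OF Y_carr F' _ that] TF by (simp_all add: op_Y t_def)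
  have T_diag: "T $$ (a, a) = of_real (t a)" if "a < d" for a
    using arg_cong[OF T_herm, of "\<lambda>M. M $$ (a, a)"] that T by (simp add: t_def complex_eq_iff)
  have en: "energy (frame_op m d X') F = (\<Sum>a<d. \<Sum>b<d. (cmod (T $$ (a, b)))\<^sup>2) + (\<Sum>a<d. \<Sum>b<d. (cmod (F' $$ (a, b)))\<^sup>2)"
  proof -
    have "energy (frame_op m d X') F = energy T F'"
      unfolding T_def F'_def by (rule energy_unitary_conjugate[OF u frame_op_carrier F(1), symmetric])
    then show ?thesis
      by (simp add: energy_def trace_square_hermitian[OF T T_herm] trace_square_hermitian[OF F' F'_herm])
  qed
  \<comment> \<open>Off-diagonal entries of \<open>F'\<close> are dropped, and each diagonal one is
    at least \<open>1 / t a\<close>.\<close>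
  have F'_ge: "(\<Sum>a<d. 1 / (t a)\<^sup>2) \<le> (\<Sum>a<d. \<Sum>b<d. (cmod (F' $$ (a, b)))\<^sup>2)"
  proof (rule sum_mono)
    fix a assume "a \<in> {..<d}"
    then have a: "a < d" by simp
    have "1 / (t a)\<^sup>2 = (1 / t a)\<^sup>2" by (simp add: power_one_over)
    also have "\<dots> \<le> (Re (F' $$ (a, a)))\<^sup>2" using t[OF a] by (intro power_mono) auto
    also have "\<dots> \<le> (cmod (F' $$ (a, a)))\<^sup>2" using abs_Re_le_cmod[of "F' $$ (a, a)"] by (simp add: power2_le_iff_abs_le)
    also have "\<dots> \<le> (\<Sum>b<d. (cmod (F' $$ (a, b)))\<^sup>2)"
      using a by (intro member_le_sum[where f = "\<lambda>b. (cmod (F' $$ (a, b)))\<^sup>2"]) auto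
    finally show "1 / (t a)\<^sup>2 \<le> (\<Sum>b<d. (cmod (F' $$ (a, b)))\<^sup>2)" .
  qed
  \<comment> \<open>Off the diagonal the two squared moduli agree; on it
    \<open>t^2 - (t - w)^2 = 2 w t - w^2\<close>.\<close>
  have dist: "(\<Sum>a<d. \<Sum>b<d. (cmod (T $$ (a, b) - real_diag d w $$ (a, b)))\<^sup>2)
      = (\<Sum>a<d. \<Sum>b<d. (cmod (T $$ (a, b)))\<^sup>2) - (\<Sum>a<d. 2 * w a * t a - (w a)\<^sup>2)"
    unfolding sum_subtractf[symmetric]
  proof (intro sum.cong refl)
    fix a assume "a \<in> {..<d}"
    then have a: "a < d" by simp
    have "(\<Sum>b<d. (cmod (T $$ (a, b)))\<^sup>2 - (cmod (T $$ (a, b) - real_diag d w $$ (a, b)))\<^sup>2)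
        = (cmod (T $$ (a, a)))\<^sup>2 - (cmod (T $$ (a, a) - real_diag d w $$ (a, a)))\<^sup>2"
      using a by (intro sum_eq_single[where f = "\<lambda>b. (cmod (T $$ (a, b)))\<^sup>2 - (cmod (T $$ (a, b) - real_diag d w $$ (a, b)))\<^sup>2"]) auto
    also have "\<dots> = (t a)\<^sup>2 - (t a - w a)\<^sup>2"
      using a by (simp add: T_diag of_real_diff[symmetric] del: of_real_diff)
    also have "\<dots> = 2 * w a * t a - (w a)\<^sup>2" by (simp add: power2_eq_square algebra_simps)
    finally show "(\<Sum>b<d. (cmod (T $$ (a, b) - real_diag d w $$ (a, b)))\<^sup>2)
        = (\<Sum>b<d. (cmod (T $$ (a, b)))\<^sup>2) - (2 * w a * t a - (w a)\<^sup>2)"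
      by (simp add: sum_subtractf)
  qed
  have "0 \<le> 2 * (\<Sum>a<d. potential_slope (w a) * (t a - w a))"
    using slope_sum_le[OF Y] pattern by (simp add: op_Y t_def Y_def)
  also have "\<dots> \<le> (\<Sum>a<d. (2 * w a * t a - (w a)\<^sup>2) + 1 / (t a)\<^sup>2 - ((w a)\<^sup>2 + 1 / (w a)\<^sup>2))"
    unfolding sum_distrib_left
  proof (rule sum_mono)
    fix a assume "a \<in> {..<d}"
    then have a: "a < d" by simp
    have "2 * (potential_slope (w a) * (t a - w a)) = 2 * w a * t a - 2 * (w a)\<^sup>2 - 2 * (t a - w a) / w a ^ 3"
      by (simp add: potential_slope_def power2_eq_square algebra_simps diff_divide_distrib)
    then show "2 * (potential_slope (w a) * (t a - w a)) \<le> (2 * w a * t a - (w a)\<^sup>2) + 1 / (t a)\<^sup>2 - ((w a)\<^sup>2 + 1 / (w a)\<^sup>2)"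
      using inverse_square_tangent[OF t(1)[OF a] w[OF a]] by linarith
  qed
  finally have "(\<Sum>a<d. (w a)\<^sup>2 + 1 / (w a)\<^sup>2) \<le> (\<Sum>a<d. 2 * w a * t a - (w a)\<^sup>2) + (\<Sum>a<d. 1 / (t a)\<^sup>2)"
    by (simp only: sum_subtractf sum.distrib)
  moreover have en0: "energy (real_diag d w) (real_diag d (\<lambda>a. 1 / w a)) = (\<Sum>a<d. (w a)\<^sup>2 + 1 / (w a)\<^sup>2)"
    by (rule energy_real_diag) (rule w)
  ultimately have "(\<Sum>a<d. \<Sum>b<d. (cmod (T $$ (a, b) - real_diag d w $$ (a, b)))\<^sup>2)
      \<le> energy (frame_op m d X') F - energy (real_diag d w) (real_diag d (\<lambda>a. 1 / w a))"
    unfolding dist en en0 using F'_ge by linarith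
  then show ?thesis using u unfolding T_def by blast
qed

end

section \<open>Dual systems\<close>

text \<open>A sesquilinear map whose value at \<open>V, V\<close> is \<open>S_V\<close> and for
  which duality is the value \<open>1\<close> at \<open>W, V\<close>; the algebra of duals reduces
  to its linearity and symmetry.\<close>

definition cross_op :: "nat \<Rightarrow> nat \<Rightarrow> (nat \<Rightarrow> complex mat) \<Rightarrow> (nat \<Rightarrow> complex mat) \<Rightarrow> complex mat" where
  "cross_op m d V W = mat d d (\<lambda>(a, b). \<Sum>i<m. (mat_adjoint (V i) * W i) $$ (a, b))"

text \<open>Unlike \<open>systems\<close>, this ignores the indices from \<open>m\<close> on, so it
  is stable under pointwise operations such as \<open>\<lambda>i. V i * A\<close>.\<close>

definition shaped :: "nat \<Rightarrow> (nat \<Rightarrow> nat) \<Rightarrow> nat \<Rightarrow> (nat \<Rightarrow> complex mat) \<Rightarrow> bool" where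
  "shaped m k d V \<longleftrightarrow> (\<forall>i<m. V i \<in> carrier_mat (k i) d)"

lemma cross_op_carrier [simp]: "cross_op m d V W \<in> carrier_mat d d"
  and cross_op_dim [simp]: "dim_row (cross_op m d V W) = d" "dim_col (cross_op m d V W) = d"
  by (auto simp: cross_op_def)

lemma cross_op_index:
  assumes "shaped m k d V" "shaped m k d W" "a < d" "b < d"
  shows "cross_op m d V W $$ (a, b) = (\<Sum>i<m. \<Sum>l<k i. cnj (V i $$ (l, a)) * W i $$ (l, b))"
proof -
  have "cross_op m d V W $$ (a, b) = (\<Sum>i<m. (mat_adjoint (V i) * W i) $$ (a, b))"
    using assms(3,4) by (simp add: cross_op_def)
  also have "\<dots> = (\<Sum>i<m. \<Sum>l<k i. cnj (V i $$ (l, a)) * W i $$ (l, b))"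
    using assms by (intro sum.cong refl index_adjoint_mult) (auto simp: shaped_def)
  finally show ?thesis .
qed

lemma cross_op_cong:
  "(\<And>i. i < m \<Longrightarrow> V i = V' i) \<Longrightarrow> (\<And>i. i < m \<Longrightarrow> W i = W' i) \<Longrightarrow> cross_op m d V W = cross_op m d V' W'"
  unfolding cross_op_def by (intro eq_matI) auto

lemma cross_op_adjoint:
  assumes "shaped m k d V" "shaped m k d W"
  shows "mat_adjoint (cross_op m d V W) = cross_op m d W V"
  by (rule eq_matI) (auto simp: cross_op_index[OF assms] cross_op_index[OF assms(2,1)] mult.commute)

lemma cross_op_add:
  assumes "shaped m k d V" "shaped m k d W" "shaped m k d W'"
  shows "cross_op m d V (\<lambda>i. W i + c \<cdot>\<^sub>m W' i) = cross_op m d V W + c \<cdot>\<^sub>m cross_op m d V W'"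
proof -
  have sh: "shaped m k d (\<lambda>i. W i + c \<cdot>\<^sub>m W' i)" using assms by (simp add: shaped_def)
  show ?thesis
  proof (rule eq_matI)
    fix a b assume "a < dim_row (cross_op m d V W + c \<cdot>\<^sub>m cross_op m d V W')"
      "b < dim_col (cross_op m d V W + c \<cdot>\<^sub>m cross_op m d V W')"
    then have ab: "a < d" "b < d" by auto
    have "(\<Sum>i<m. \<Sum>l<k i. cnj (V i $$ (l, a)) * (W i + c \<cdot>\<^sub>m W' i) $$ (l, b))
      = (\<Sum>i<m. \<Sum>l<k i. cnj (V i $$ (l, a)) * W i $$ (l, b)) + c * (\<Sum>i<m. \<Sum>l<k i. cnj (V i $$ (l, a)) * W' i $$ (l, b))"
      unfolding sum_distrib_left sum.distrib[symmetric]
    proof (intro sum.cong refl)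
      fix i l assume "i \<in> {..<m}" "l \<in> {..<k i}"
      then have "(W i + c \<cdot>\<^sub>m W' i) $$ (l, b) = W i $$ (l, b) + c * W' i $$ (l, b)"
        using assms ab by (auto simp: shaped_def)
      then show "cnj (V i $$ (l, a)) * (W i + c \<cdot>\<^sub>m W' i) $$ (l, b)
        = cnj (V i $$ (l, a)) * W i $$ (l, b) + c * (cnj (V i $$ (l, a)) * W' i $$ (l, b))"
        by (simp add: algebra_simps)
    qed
    then show "cross_op m d V (\<lambda>i. W i + c \<cdot>\<^sub>m W' i) $$ (a, b) = (cross_op m d V W + c \<cdot>\<^sub>m cross_op m d V W') $$ (a, b)"
      using ab by (simp add: cross_op_index[OF assms(1) sh] cross_op_index[OF assms(1,2)] cross_op_index[OF assms(1,3)])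
  qed auto
qed

lemma cross_op_mult_right:
  assumes V: "shaped m k d V" and W: "shaped m k d W" and A: "A \<in> carrier_mat d d"
  shows "cross_op m d V (\<lambda>i. W i * A) = cross_op m d V W * A"
proof -
  have sh: "shaped m k d (\<lambda>i. W i * A)" using W A by (simp add: shaped_def mult_carrier_mat[of _ _ d _ d])
  show ?thesis
  proof (rule eq_matI)
    fix a b assume "a < dim_row (cross_op m d V W * A)" "b < dim_col (cross_op m d V W * A)"
    then have ab: "a < d" "b < d" using A by auto
    have "cross_op m d V (\<lambda>i. W i * A) $$ (a, b) = (\<Sum>i<m. \<Sum>l<k i. \<Sum>c<d. cnj (V i $$ (l, a)) * W i $$ (l, c) * A $$ (c, b))"
      unfolding cross_op_index[OF V sh ab]
    proof (intro sum.cong refl)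
      fix i l assume "i \<in> {..<m}" "l \<in> {..<k i}"
      then have "(W i * A) $$ (l, b) = (\<Sum>c<d. W i $$ (l, c) * A $$ (c, b))"
        using W A ab by (intro index_mult_mat_sum[of _ "k i"]) (auto simp: shaped_def)
      then show "cnj (V i $$ (l, a)) * (W i * A) $$ (l, b) = (\<Sum>c<d. cnj (V i $$ (l, a)) * W i $$ (l, c) * A $$ (c, b))"
        by (simp only: sum_distrib_left mult.assoc)
    qed
    also have "\<dots> = (\<Sum>c<d. \<Sum>i<m. \<Sum>l<k i. cnj (V i $$ (l, a)) * W i $$ (l, c) * A $$ (c, b))"
      by (simp only: sum.swap[of _ "{..<d}"])
    also have "\<dots> = (\<Sum>c<d. cross_op m d V W $$ (a, c) * A $$ (c, b))"
      using ab by (intro sum.cong refl) (simp add: cross_op_index[OF V W] sum_distrib_right)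
    also have "\<dots> = (cross_op m d V W * A) $$ (a, b)"
      by (rule index_mult_mat_sum[OF cross_op_carrier A ab, symmetric])
    finally show "cross_op m d V (\<lambda>i. W i * A) $$ (a, b) = (cross_op m d V W * A) $$ (a, b)" .
  qed (use A in auto)
qed

lemma rs_op_cross_op: "rs_op m d V = cross_op m d V V"
  by (simp add: rs_op_def cross_op_def)

lemma is_dual_cross_op: "is_dual m d V W \<longleftrightarrow> cross_op m d W V = 1\<^sub>m d"
  by (simp add: is_dual_def cross_op_def)

lemma cross_op_frame_op: "cross_op m d V V = frame_op m d (\<lambda>i. mat_adjoint (V i))"
  by (simp add: cross_op_def frame_op_def)

lemma systems_shaped: "V \<in> systems m k d \<Longrightarrow> shaped m k d V"
  by (auto simp: systems_def shaped_def)

section \<open>Determinants, inverses and the spectral norm\<close>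

lemma det_nonzero_of_inverse:
  fixes S F :: "complex mat"
  assumes "S \<in> carrier_mat d d" "F \<in> carrier_mat d d" "S * F = 1\<^sub>m d"
  shows "det S \<noteq> 0"
  using det_mult[OF assms(1,2)] assms(3) by auto

lemma mat_inverse_of_det_nonzero:
  fixes S :: "complex mat"
  assumes S: "S \<in> carrier_mat d d" and "det S \<noteq> 0"
  shows "the (mat_inverse S) \<in> carrier_mat d d" "S * the (mat_inverse S) = 1\<^sub>m d" "the (mat_inverse S) * S = 1\<^sub>m d"
proof -
  have "mat_inverse S \<noteq> None"
    using mat_inverse(1)[OF S, of "()"] det_non_zero_imp_unit[OF assms, of "()"] by blast
  then obtain F where "mat_inverse S = Some F" by blast
  from mat_inverse(2)[OF S this] this
  show "the (mat_inverse S) \<in> carrier_mat d d" "S * the (mat_inverse S) = 1\<^sub>m d" "the (mat_inverse S) * S = 1\<^sub>m d"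
    by auto
qed

lemma invertible_mat_iff_det:
  fixes S :: "complex mat"
  assumes S: "S \<in> carrier_mat d d"
  shows "invertible_mat S \<longleftrightarrow> det S \<noteq> 0"
proof
  assume "invertible_mat S"
  then obtain B where B: "S * B = 1\<^sub>m d" "B * S = 1\<^sub>m (dim_row B)"
    using S by (auto simp: invertible_mat_def inverts_mat_def)
  have "dim_col B = d" using arg_cong[OF B(1), of dim_col] by simp
  moreover have "dim_row B = d" using arg_cong[OF B(2), of dim_col] S by simp
  ultimately show "det S \<noteq> 0" using det_nonzero_of_inverse[OF S _ B(1)] by blast
next
  assume "det S \<noteq> 0"
  from mat_inverse_of_det_nonzero[OF S this] show "invertible_mat S"
    using S by (auto simp: invertible_mat_def inverts_mat_def)
qed

lemma inverse_unique:
  fixes S F G :: "complex mat"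
  assumes "S \<in> carrier_mat d d" "F \<in> carrier_mat d d" "G \<in> carrier_mat d d" "S * F = 1\<^sub>m d" "G * S = 1\<^sub>m d"
  shows "F = G"
proof -
  have "F = (G * S) * F" using assms by simp
  also have "\<dots> = G * (S * F)" using assms(1-3) by (simp add: assoc_mult_mat[of _ d d _ d _ d])
  finally show ?thesis using assms by simp
qed

text \<open>A kernel vector \<open>x\<close> of \<open>S_W\<close> satisfies
  \<open>0 = <x, S_W x>\<close>, which is the sum of the squared norms of the \<open>W_i x\<close>.
  Hence all \<open>W_i x\<close> vanish, and duality gives \<open>x = 0\<close>. So every system
  dual to \<open>V\<close> is automatically a reconstruction system.\<close>

lemma cross_op_det_nonzero_of_dual:
  assumes V: "shaped m k d V" and W: "shaped m k d W" and dual: "cross_op m d V W = 1\<^sub>m d"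
  shows "det (cross_op m d W W) \<noteq> 0"
proof
  assume "det (cross_op m d W W) = 0"
  then obtain x where x: "x \<in> carrier_vec d" "x \<noteq> 0\<^sub>v d" "cross_op m d W W *\<^sub>v x = 0\<^sub>v d"
    using det_0_iff_vec_prod_zero_field[OF cross_op_carrier] by blast
  define y where "y i l = (\<Sum>b<d. W i $$ (l, b) * x $ b)" for i l
  have mult_x: "(\<Sum>b<d. cross_op m d U W $$ (a, b) * x $ b) = (\<Sum>i<m. \<Sum>l<k i. cnj (U i $$ (l, a)) * y i l)"
    if U: "shaped m k d U" and a: "a < d" for U a
  proof -
    have "(\<Sum>b<d. cross_op m d U W $$ (a, b) * x $ b)
        = (\<Sum>b<d. \<Sum>i<m. \<Sum>l<k i. cnj (U i $$ (l, a)) * W i $$ (l, b) * x $ b)"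
      using a by (intro sum.cong refl) (simp add: cross_op_index[OF U W] sum_distrib_right)
    also have "\<dots> = (\<Sum>i<m. \<Sum>l<k i. \<Sum>b<d. cnj (U i $$ (l, a)) * W i $$ (l, b) * x $ b)"
      by (simp only: sum.swap[of _ _ "{..<d}"])
    finally show ?thesis by (simp only: y_def sum_distrib_left mult.assoc)
  qed
  have mult_vec: "(A *\<^sub>v x) $ a = (\<Sum>b<d. A $$ (a, b) * x $ b)" if "A \<in> carrier_mat d d" "a < d" for A a
    using that x(1) by (auto simp: scalar_prod_def atLeast0LessThan intro!: sum.cong)
  have "(\<Sum>i<m. \<Sum>l<k i. cnj (W i $$ (l, a)) * y i l) = 0" if "a < d" for a
    using mult_x[OF W that] mult_vec[OF cross_op_carrier that, of m W W] x(3) that by simp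
  then have "0 = (\<Sum>a<d. cnj (x $ a) * (\<Sum>i<m. \<Sum>l<k i. cnj (W i $$ (l, a)) * y i l))" by simp
  also have "\<dots> = (\<Sum>i<m. \<Sum>l<k i. \<Sum>a<d. cnj (x $ a) * (cnj (W i $$ (l, a)) * y i l))"
    unfolding sum_distrib_left by (simp only: sum.swap[of _ _ "{..<d}"])
  also have "\<dots> = (\<Sum>i<m. \<Sum>l<k i. cnj (y i l) * y i l)"
  proof (intro sum.cong refl)
    fix i l
    show "(\<Sum>a<d. cnj (x $ a) * (cnj (W i $$ (l, a)) * y i l)) = cnj (y i l) * y i l"
      unfolding y_def[of i l] cnj_sum sum_distrib_right by (intro sum.cong refl) simp
  qed
  also have "\<dots> = of_real (\<Sum>i<m. \<Sum>l<k i. (cmod (y i l))\<^sup>2)"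
    by (simp add: complex_norm_square mult.commute del: of_real_power)
  finally have "complex_of_real (\<Sum>i<m. \<Sum>l<k i. (cmod (y i l))\<^sup>2) = 0" by (rule sym)
  then have "(\<Sum>i<m. \<Sum>l<k i. (cmod (y i l))\<^sup>2) = 0" by (simp only: of_real_eq_0_iff)
  then have "\<forall>i<m. (\<Sum>l<k i. (cmod (y i l))\<^sup>2) = 0"
    by (subst (asm) sum_nonneg_eq_0_iff) (auto intro: sum_nonneg)
  then have y0: "y i l = 0" if "i < m" "l < k i" for i l
    using that by (auto simp: sum_nonneg_eq_0_iff)
  have "x $ a = 0" if a: "a < d" for a
  proof -
    have "x $ a = (\<Sum>b<d. of_bool (a = b) * x $ b)"
      using a by (subst sum_of_bool_eq_mult(1)) auto
    also have "\<dots> = (\<Sum>b<d. cross_op m d V W $$ (a, b) * x $ b)"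
      unfolding dual using a by (intro sum.cong refl) auto
    also have "\<dots> = 0" unfolding mult_x[OF V a] using y0 by (intro sum.neutral ballI) auto
    finally show ?thesis .
  qed
  then have "x = 0\<^sub>v d" using x(1) by (intro eq_vecI) auto
  then show False using x(2) by simp
qed

text \<open>A crude bound, good enough because \<open>d_S\<close> only has to be small when the
  entries of the difference are.\<close>

lemma spec_norm_le:
  assumes A: "A \<in> carrier_mat d d"
  shows "spec_norm A \<le> (\<Sum>a<d. \<Sum>b<d. cmod (A $$ (a, b)))"
  unfolding spec_norm_def
proof (rule cSup_least)
  have "vnorm (0\<^sub>v (dim_col A)) \<le> 1" by (simp add: vnorm_def)
  then show "{vnorm (A *\<^sub>v x) |x. x \<in> carrier_vec (dim_col A) \<and> vnorm x \<le> 1} \<noteq> {}"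
    using zero_carrier_vec by blast
  fix r assume "r \<in> {vnorm (A *\<^sub>v x) |x. x \<in> carrier_vec (dim_col A) \<and> vnorm x \<le> 1}"
  then obtain x where x: "x \<in> carrier_vec d" "vnorm x \<le> 1" and r: "r = vnorm (A *\<^sub>v x)" using A by auto
  have x1: "cmod (x $ b) \<le> 1" if "b < d" for b
  proof -
    have "(cmod (x $ b))\<^sup>2 \<le> (\<Sum>i<d. (cmod (x $ i))\<^sup>2)"
      using that by (intro member_le_sum[where f = "\<lambda>i. (cmod (x $ i))\<^sup>2"]) auto
    also have "\<dots> \<le> 1" using x by (simp add: vnorm_def)
    finally have "(cmod (x $ b))\<^sup>2 \<le> 1\<^sup>2" by simp
    then show ?thesis by (rule power2_le_imp_le) simp
  qed
  have "(\<Sum>a<d. (cmod ((A *\<^sub>v x) $ a))\<^sup>2) \<le> (\<Sum>a<d. cmod ((A *\<^sub>v x) $ a))\<^sup>2"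
  proof -
    have "(\<Sum>a\<in>I. (g a)\<^sup>2) \<le> (\<Sum>a\<in>I. g a)\<^sup>2" if "finite I" "\<And>a. g a \<ge> (0::real)" for I :: "nat set" and g
      using that
    proof (induction I rule: finite_induct)
      case (insert i I)
      have "(g i + (\<Sum>a\<in>I. g a))\<^sup>2 = (g i)\<^sup>2 + (\<Sum>a\<in>I. g a)\<^sup>2 + 2 * g i * (\<Sum>a\<in>I. g a)" by (rule power2_sum)
      moreover have "2 * g i * (\<Sum>a\<in>I. g a) \<ge> 0" using insert.prems by (simp add: sum_nonneg)
      ultimately show ?case using insert by simp
    qed simp
    then show ?thesis by simp
  qed
  then have "r \<le> (\<Sum>a<d. cmod ((A *\<^sub>v x) $ a))"
    unfolding r vnorm_def using A by (intro real_le_lsqrt) (auto intro!: sum_nonneg)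
  also have "\<dots> \<le> (\<Sum>a<d. \<Sum>b<d. cmod (A $$ (a, b)))"
  proof (rule sum_mono)
    fix a assume "a \<in> {..<d}"
    then have "(A *\<^sub>v x) $ a = (\<Sum>b<d. A $$ (a, b) * x $ b)"
      using A x(1) by (auto simp: scalar_prod_def atLeast0LessThan intro!: sum.cong)
    also have "cmod \<dots> \<le> (\<Sum>b<d. cmod (A $$ (a, b)))"
      using x1 by (intro sum_norm_le) (simp add: norm_mult mult_left_le)
    finally show "cmod ((A *\<^sub>v x) $ a) \<le> (\<Sum>b<d. cmod (A $$ (a, b)))" by simp
  qed
  finally show "r \<le> (\<Sum>a<d. \<Sum>b<d. cmod (A $$ (a, b)))" .
qed

lemma FP_energy: "FP m d V W = energy (rs_op m d V) (rs_op m d W)"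
  by (simp add: FP_def energy_def)

section \<open>Duals of a fixed reconstruction system\<close>

locale reconstruction_system =
  fixes m d :: nat and k :: "nat \<Rightarrow> nat" and V :: "nat \<Rightarrow> complex mat"
  assumes V: "V \<in> RS m k d"
begin

definition S :: "complex mat" where "S = rs_op m d V"

definition S_inv :: "complex mat" where "S_inv = the (mat_inverse S)"

lemma V_systems: "V \<in> systems m k d" using V by (simp add: RS_def)

lemma V_shaped: "shaped m k d V" by (rule systems_shaped[OF V_systems])

lemma S_carrier [simp]: "S \<in> carrier_mat d d" by (simp add: S_def rs_op_cross_op)

lemma S_det: "det S \<noteq> 0"
  using V by (simp add: RS_def S_def invertible_mat_iff_det[of _ d] rs_op_cross_op)

lemma S_inv: "S_inv \<in> carrier_mat d d" "S * S_inv = 1\<^sub>m d" "S_inv * S = 1\<^sub>m d"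
  unfolding S_inv_def using mat_inverse_of_det_nonzero[OF S_carrier S_det] by auto

lemma S_hermitian: "mat_adjoint S = S"
  by (simp add: S_def rs_op_cross_op cross_op_adjoint[OF V_shaped V_shaped])

lemma S_inv_hermitian: "mat_adjoint S_inv = S_inv"
  by (rule hermitian_inverse[OF S_carrier S_inv(1,2) S_hermitian])

lemma canon_dual_eq: "canon_dual m d V = (\<lambda>i. if i < m then V i * S_inv else 0\<^sub>m 0 0)"
  unfolding canon_dual_def S_inv_def S_def ..

text \<open>For \<open>Z = W - V^#\<close> with \<open>W\<close> dual to \<open>V\<close>, this is
  the segment of duals from the canonical dual at \<open>s = 0\<close> to \<open>W\<close> at
  \<open>s = 1\<close>. The default outside the index range is the one that \<open>systems\<close>
  prescribes.\<close>

definition dual_shift :: "(nat \<Rightarrow> complex mat) \<Rightarrow> real \<Rightarrow> nat \<Rightarrow> complex mat" where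
  "dual_shift Z s = (\<lambda>i. if i < m then V i * S_inv + of_real s \<cdot>\<^sub>m Z i else 0\<^sub>m 0 0)"

lemma VS_shaped: "shaped m k d (\<lambda>i. V i * S_inv)"
  using V_shaped S_inv(1) by (simp add: shaped_def mult_carrier_mat[of _ _ d _ d])

lemma dual_shift_systems: "shaped m k d Z \<Longrightarrow> dual_shift Z s \<in> systems m k d"
  using VS_shaped by (auto simp: systems_def dual_shift_def shaped_def)

lemma cross_VS: "cross_op m d (\<lambda>i. V i * S_inv) (\<lambda>i. V i * S_inv) = S_inv"
proof -
  have "cross_op m d (\<lambda>i. V i * S_inv) V = mat_adjoint (cross_op m d V (\<lambda>i. V i * S_inv))"
    by (rule cross_op_adjoint[OF V_shaped VS_shaped, symmetric])
  also have "\<dots> = 1\<^sub>m d"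
    using S_inv by (simp add: cross_op_mult_right[OF V_shaped V_shaped S_inv(1)] S_def rs_op_cross_op[symmetric])
  finally show ?thesis
    using S_inv(1) by (simp add: cross_op_mult_right[OF VS_shaped V_shaped S_inv(1)])
qed

text \<open>The canonical dual is \<open>V\<close> multiplied by \<open>S_inv\<close>, so
  \<open>VZ\<close> makes it orthogonal to \<open>Z\<close> as well; both mixed terms vanish, and
  the shift enters the operator only through \<open>s^2\<close>.\<close>

lemma dual_shift_cross:
  assumes Z: "shaped m k d Z" and VZ: "cross_op m d V Z = 0\<^sub>m d d"
  shows "cross_op m d V (dual_shift Z s) = 1\<^sub>m d"
    and "rs_op m d (dual_shift Z s) = S_inv + of_real (s\<^sup>2) \<cdot>\<^sub>m cross_op m d Z Z"
proof -
  let ?W = "\<lambda>i. V i * S_inv + of_real s \<cdot>\<^sub>m Z i"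
  have W_eq: "cross_op m d U (dual_shift Z s) = cross_op m d U ?W" for U
    by (rule cross_op_cong) (auto simp: dual_shift_def)
  have W_sh: "shaped m k d ?W" using VS_shaped Z by (simp add: shaped_def)
  have "cross_op m d V ?W = S * S_inv + of_real s \<cdot>\<^sub>m 0\<^sub>m d d"
    unfolding cross_op_add[OF V_shaped VS_shaped Z] VZ cross_op_mult_right[OF V_shaped V_shaped S_inv(1)]
    by (simp add: S_def rs_op_cross_op)
  then show "cross_op m d V (dual_shift Z s) = 1\<^sub>m d"
    unfolding W_eq using S_inv by simp
  have ZV: "cross_op m d Z V = 0\<^sub>m d d"
    using cross_op_adjoint[OF V_shaped Z] unfolding VZ by simp
  have ZVS: "cross_op m d Z (\<lambda>i. V i * S_inv) = 0\<^sub>m d d"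
    using S_inv(1) by (simp add: cross_op_mult_right[OF Z V_shaped S_inv(1)] ZV)
  have VSZ: "cross_op m d (\<lambda>i. V i * S_inv) Z = 0\<^sub>m d d"
    using cross_op_adjoint[OF Z VS_shaped] unfolding ZVS by simp
  have "cross_op m d ?W (\<lambda>i. V i * S_inv) = mat_adjoint (cross_op m d (\<lambda>i. V i * S_inv) ?W)"
    by (rule cross_op_adjoint[OF VS_shaped W_sh, symmetric])
  also have "\<dots> = S_inv"
    unfolding cross_op_add[OF VS_shaped VS_shaped Z] VSZ cross_VS using S_inv(1) S_inv_hermitian by simp
  finally have W_VS: "cross_op m d ?W (\<lambda>i. V i * S_inv) = S_inv" .
  have "cross_op m d ?W Z = mat_adjoint (cross_op m d Z ?W)"
    by (rule cross_op_adjoint[OF Z W_sh, symmetric])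
  also have "\<dots> = of_real s \<cdot>\<^sub>m cross_op m d Z Z"
    unfolding cross_op_add[OF Z VS_shaped Z] ZVS
    by (simp add: adjoint_smult cross_op_adjoint[OF Z Z])
  finally have W_Z: "cross_op m d ?W Z = of_real s \<cdot>\<^sub>m cross_op m d Z Z" .
  have "rs_op m d (dual_shift Z s) = cross_op m d ?W ?W"
    unfolding rs_op_cross_op by (rule cross_op_cong) (auto simp: dual_shift_def)
  also have "\<dots> = S_inv + of_real (s\<^sup>2) \<cdot>\<^sub>m cross_op m d Z Z"
    unfolding cross_op_add[OF W_sh VS_shaped Z] W_VS W_Z by (simp add: smult_smult_times power2_eq_square)
  finally show "rs_op m d (dual_shift Z s) = S_inv + of_real (s\<^sup>2) \<cdot>\<^sub>m cross_op m d Z Z" .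
qed

lemma dual_shift_dual:
  assumes "shaped m k d Z" "cross_op m d V Z = 0\<^sub>m d d"
  shows "dual_shift Z s \<in> RS m k d" "is_dual m d V (dual_shift Z s)"
proof -
  have sh: "shaped m k d (dual_shift Z s)" by (rule systems_shaped[OF dual_shift_systems[OF assms(1)]])
  have "det (rs_op m d (dual_shift Z s)) \<noteq> 0"
    unfolding rs_op_cross_op by (rule cross_op_det_nonzero_of_dual[OF V_shaped sh dual_shift_cross(1)[OF assms]])
  then show "dual_shift Z s \<in> RS m k d"
    using dual_shift_systems[OF assms(1)] by (simp add: RS_def invertible_mat_iff_det[of _ d] rs_op_cross_op)
  show "is_dual m d V (dual_shift Z s)"
    unfolding is_dual_cross_op using cross_op_adjoint[OF V_shaped sh] dual_shift_cross(1)[OF assms, of s] by simp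
qed

definition dual_gap :: "(nat \<Rightarrow> complex mat) \<Rightarrow> nat \<Rightarrow> complex mat" where
  "dual_gap W i = W i - V i * S_inv"

lemma dual_gap:
  assumes W: "W \<in> systems m k d" "is_dual m d V W"
  shows "shaped m k d (dual_gap W)" "cross_op m d V (dual_gap W) = 0\<^sub>m d d" "dual_shift (dual_gap W) 1 = W"
proof -
  note W_sh = systems_shaped[OF W(1)]
  show "shaped m k d (dual_gap W)"
    using W_sh VS_shaped by (auto simp: shaped_def dual_gap_def intro: minus_carrier_mat)
  have VW: "cross_op m d V W = 1\<^sub>m d"
    using W(2) cross_op_adjoint[OF W_sh V_shaped] by (simp add: is_dual_cross_op)
  have "cross_op m d V (dual_gap W) = cross_op m d V (\<lambda>i. W i + (-1) \<cdot>\<^sub>m (V i * S_inv))"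
    using W_sh VS_shaped by (intro cross_op_cong refl eq_matI) (auto simp: dual_gap_def shaped_def)
  also have "\<dots> = 1\<^sub>m d + (-1) \<cdot>\<^sub>m (S * S_inv)"
    unfolding cross_op_add[OF V_shaped W_sh VS_shaped] VW cross_op_mult_right[OF V_shaped V_shaped S_inv(1)]
    by (simp add: S_def rs_op_cross_op)
  also have "\<dots> = 0\<^sub>m d d" unfolding S_inv(2) by (rule eq_matI) auto
  finally show "cross_op m d V (dual_gap W) = 0\<^sub>m d d" .
  show "dual_shift (dual_gap W) 1 = W"
  proof
    fix i show "dual_shift (dual_gap W) 1 i = W i"
    proof (cases "i < m")
      case True
      then have "W i \<in> carrier_mat (k i) d" "V i * S_inv \<in> carrier_mat (k i) d"
        using W_sh VS_shaped by (auto simp: shaped_def)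
      moreover have "B + of_real 1 \<cdot>\<^sub>m (A - B) = A" if "A \<in> carrier_mat (k i) d" "B \<in> carrier_mat (k i) d"
        for A B :: "complex mat" using that by (intro eq_matI) auto
      ultimately show ?thesis using True by (simp only: dual_shift_def dual_gap_def if_True)
    next
      case False
      then show ?thesis using W(1) by (simp add: dual_shift_def systems_def)
    qed
  qed
qed

text \<open>Here \<open>\<alpha>\<close> is the real part of the trace of \<open>S_inv\<close> times
  \<open>cross_op m d Z Z\<close>, and \<open>\<beta>\<close> is the trace of the square of the
  latter. Both are nonnegative, so for \<open>s \<ge> 0\<close> the potential does not decrease
  along the segment.\<close>

lemma energy_dual_shift:
  assumes Z: "shaped m k d Z" "cross_op m d V Z = 0\<^sub>m d d"
  obtains \<alpha> \<beta> where "\<alpha> \<ge> 0" "\<beta> = (\<Sum>a<d. \<Sum>b<d. (cmod (cross_op m d Z Z $$ (a, b)))\<^sup>2)"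
    "\<And>s. FP m d V (dual_shift Z s) = energy S S_inv + 2 * s\<^sup>2 * \<alpha> + (s\<^sup>2)\<^sup>2 * \<beta>"
proof -
  define B where "B = cross_op m d Z Z"
  have B: "B \<in> carrier_mat d d" "mat_adjoint B = B" using cross_op_adjoint[OF Z(1,1)] by (simp_all add: B_def)
  define \<alpha> where "\<alpha> = Re (\<Sum>a<d. \<Sum>b<d. S_inv $$ (a, b) * B $$ (b, a))"
  define \<beta> where "\<beta> = (\<Sum>a<d. \<Sum>b<d. (cmod (B $$ (a, b)))\<^sup>2)"
  \<comment> \<open>\<open>\<alpha>\<close> is a sum of values of the form of \<open>S_inv\<close>
    at the conjugated rows of \<open>Z\<close>, and \<open>S_inv\<close> is the operator of the
    canonical dual, hence its form is nonnegative.\<close>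
  have "\<alpha> = (\<Sum>i<m. \<Sum>l<k i. Re (\<Sum>a<d. \<Sum>b<d. cnj (cnj (Z i $$ (l, a))) * S_inv $$ (a, b) * cnj (Z i $$ (l, b))))"
  proof -
    have "(\<Sum>a<d. \<Sum>b<d. S_inv $$ (a, b) * B $$ (b, a))
      = (\<Sum>a<d. \<Sum>b<d. \<Sum>i<m. \<Sum>l<k i. cnj (cnj (Z i $$ (l, a))) * S_inv $$ (a, b) * cnj (Z i $$ (l, b)))"
      by (intro sum.cong refl) (simp add: B_def cross_op_index[OF Z(1,1)] sum_distrib_left ac_simps)
    also have "\<dots> = (\<Sum>i<m. \<Sum>a<d. \<Sum>b<d. \<Sum>l<k i. cnj (cnj (Z i $$ (l, a))) * S_inv $$ (a, b) * cnj (Z i $$ (l, b)))"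
      by (simp only: sum.swap[of _ "{..<m}"])
    also have "\<dots> = (\<Sum>i<m. \<Sum>l<k i. \<Sum>a<d. \<Sum>b<d. cnj (cnj (Z i $$ (l, a))) * S_inv $$ (a, b) * cnj (Z i $$ (l, b)))"
      by (rule sum.cong[OF refl]) (simp only: sum.swap[of _ "{..<k _}"])
    finally show ?thesis by (simp only: \<alpha>_def Re_sum)
  qed
  also have "\<dots> \<ge> 0"
  proof (intro sum_nonneg)
    fix i l
    have eq: "frame_op m d (\<lambda>i. mat_adjoint (V i * S_inv)) = S_inv"
      unfolding cross_op_frame_op[symmetric] by (rule cross_VS)
    have sh: "mat_adjoint (V i * S_inv) \<in> carrier_mat d (k i)" if "i < m" for i
      using VS_shaped that by (auto simp: shaped_def)
    show "Re (\<Sum>a<d. \<Sum>b<d. cnj (cnj (Z i $$ (l, a))) * S_inv $$ (a, b) * cnj (Z i $$ (l, b))) \<ge> 0"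
      using frame_op_form_nonneg[of m "\<lambda>i. mat_adjoint (V i * S_inv)" d k "\<lambda>b. cnj (Z i $$ (l, b))", OF sh]
      by (simp only: eq)
  qed
  finally have \<alpha>: "\<alpha> \<ge> 0" .
  have "FP m d V (dual_shift Z s) = energy S S_inv + 2 * s\<^sup>2 * \<alpha> + (s\<^sup>2)\<^sup>2 * \<beta>" for s
  proof -
    let ?c = "complex_of_real (s\<^sup>2)"
    have BB: "mtrace (B * B) = of_real \<beta>" unfolding \<beta>_def by (rule trace_square_hermitian[OF B])
    have SB: "S_inv + ?c \<cdot>\<^sub>m B \<in> carrier_mat d d" using B(1) S_inv(1) by simp
    have "mtrace ((S_inv + ?c \<cdot>\<^sub>m B) * (S_inv + ?c \<cdot>\<^sub>m B))
      = (\<Sum>a<d. \<Sum>b<d. S_inv $$ (a, b) * S_inv $$ (b, a) + ?c * (S_inv $$ (a, b) * B $$ (b, a))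
          + ?c * (B $$ (a, b) * S_inv $$ (b, a)) + ?c\<^sup>2 * (B $$ (a, b) * B $$ (b, a)))"
      unfolding mtrace_mult[OF SB SB] using B(1) S_inv(1)
      by (intro sum.cong refl) (auto simp: algebra_simps power2_eq_square)
    also have "\<dots> = mtrace (S_inv * S_inv) + ?c * (\<Sum>a<d. \<Sum>b<d. S_inv $$ (a, b) * B $$ (b, a))
        + ?c * (\<Sum>a<d. \<Sum>b<d. B $$ (a, b) * S_inv $$ (b, a)) + ?c\<^sup>2 * mtrace (B * B)"
      unfolding mtrace_mult[OF S_inv(1,1)] mtrace_mult[OF B(1,1)] by (simp only: sum.distrib sum_distrib_left)
    also have "(\<Sum>a<d. \<Sum>b<d. B $$ (a, b) * S_inv $$ (b, a)) = (\<Sum>a<d. \<Sum>b<d. S_inv $$ (a, b) * B $$ (b, a))"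
      by (subst sum.swap) (simp only: mult.commute)
    finally have "Re (mtrace ((S_inv + ?c \<cdot>\<^sub>m B) * (S_inv + ?c \<cdot>\<^sub>m B)))
      = Re (mtrace (S_inv * S_inv)) + s\<^sup>2 * \<alpha> + s\<^sup>2 * \<alpha> + (s\<^sup>2)\<^sup>2 * \<beta>"
      by (simp only: plus_complex.sel Re_of_real_mult of_real_power[symmetric] BB Re_complex_of_real \<alpha>_def)
    then show ?thesis
      unfolding FP_energy dual_shift_cross(2)[OF Z] energy_def B_def[symmetric] S_def[symmetric] by simp
  qed
  then show ?thesis using that[of \<alpha> \<beta>] \<alpha> by (simp add: \<beta>_def B_def)
qed

lemma cross_op_eq_0_imp:
  assumes Z: "shaped m k d Z" and "(\<Sum>a<d. \<Sum>b<d. (cmod (cross_op m d Z Z $$ (a, b)))\<^sup>2) = 0"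
  shows "i < m \<Longrightarrow> Z i = 0\<^sub>m (k i) d"
proof -
  have zero: "cross_op m d Z Z $$ (a, a) = 0" if a: "a < d" for a
  proof -
    have "\<forall>a<d. (\<Sum>b<d. (cmod (cross_op m d Z Z $$ (a, b)))\<^sup>2) = 0"
      using assms(2) by (subst (asm) sum_nonneg_eq_0_iff) (auto intro: sum_nonneg)
    then have "(\<Sum>b<d. (cmod (cross_op m d Z Z $$ (a, b)))\<^sup>2) = 0" using a by blast
    then show ?thesis using a by (subst (asm) sum_nonneg_eq_0_iff) auto
  qed
  assume i: "i < m"
  have "Z i $$ (l, a) = 0" if l: "l < k i" and a: "a < d" for l a
  proof -
    have "cross_op m d Z Z $$ (a, a) = of_real (\<Sum>i<m. \<Sum>l<k i. (cmod (Z i $$ (l, a)))\<^sup>2)"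
      unfolding cross_op_index[OF Z Z a a] by (simp add: complex_norm_square mult.commute del: of_real_power)
    then have "(\<Sum>i<m. \<Sum>l<k i. (cmod (Z i $$ (l, a)))\<^sup>2) = 0"
      unfolding zero[OF a] by (subst (asm) eq_commute) (simp only: of_real_eq_0_iff)
    then have "(\<Sum>l<k i. (cmod (Z i $$ (l, a)))\<^sup>2) = 0"
      using i by (subst (asm) sum_nonneg_eq_0_iff) (auto intro: sum_nonneg)
    then show ?thesis using l by (subst (asm) sum_nonneg_eq_0_iff) auto
  qed
  then show "Z i = 0\<^sub>m (k i) d" using Z i by (intro eq_matI) (auto simp: shaped_def)
qed

lemma canon_dual_shift: "canon_dual m d V = dual_shift (\<lambda>i. 0\<^sub>m (k i) d) 0"
  unfolding canon_dual_eq dual_shift_def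
proof
  fix i
  have "V i * S_inv + 0\<^sub>m (k i) d = V i * S_inv" if "i < m"
    using that VS_shaped by (intro right_add_zero_mat) (auto simp: shaped_def)
  then show "(if i < m then V i * S_inv else 0\<^sub>m 0 0) = (if i < m then V i * S_inv + of_real 0 \<cdot>\<^sub>m 0\<^sub>m (k i) d else 0\<^sub>m 0 0)"
    by simp
qed

lemma canon_dual_dual:
  shows "canon_dual m d V \<in> RS m k d" "is_dual m d V (canon_dual m d V)" "rs_op m d (canon_dual m d V) = S_inv"
    "FP m d V (canon_dual m d V) = energy S S_inv"
proof -
  let ?Z = "\<lambda>i. 0\<^sub>m (k i) d :: complex mat"
  have Z: "shaped m k d ?Z" by (simp add: shaped_def)
  have VZ: "cross_op m d V ?Z = 0\<^sub>m d d"
  proof (rule eq_matI)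
    fix a b assume "a < dim_row (0\<^sub>m d d :: complex mat)" "b < dim_col (0\<^sub>m d d :: complex mat)"
    then have "a < d" "b < d" by auto
    then show "cross_op m d V ?Z $$ (a, b) = 0\<^sub>m d d $$ (a, b)"
      unfolding cross_op_index[OF V_shaped Z \<open>a < d\<close> \<open>b < d\<close>] by simp
  qed auto
  show "canon_dual m d V \<in> RS m k d" "is_dual m d V (canon_dual m d V)"
    unfolding canon_dual_shift by (rule dual_shift_dual[OF Z VZ])+
  show op: "rs_op m d (canon_dual m d V) = S_inv"
    unfolding canon_dual_shift dual_shift_cross(2)[OF Z VZ] using S_inv(1) by (intro eq_matI) auto
  show "FP m d V (canon_dual m d V) = energy S S_inv"
    unfolding FP_energy op S_def ..
qed

text \<open>The value \<open>s = 1\<close> in \<open>energy_dual_shift\<close>: the excess is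
  \<open>2 * \<alpha> + \<beta>\<close>, and \<open>\<beta> = 0\<close> already forces
  \<open>W - V^# = 0\<close>.\<close>

lemma FP_ge_canonical:
  assumes W: "W \<in> RS m k d" "is_dual m d V W"
  shows "energy S S_inv \<le> FP m d V W" "FP m d V W = energy S S_inv \<Longrightarrow> W = canon_dual m d V"
proof -
  have W_sys: "W \<in> systems m k d" using W(1) by (simp add: RS_def)
  note gap = dual_gap[OF W_sys W(2)]
  obtain \<alpha> \<beta> where ab: "\<alpha> \<ge> 0" "\<beta> = (\<Sum>a<d. \<Sum>b<d. (cmod (cross_op m d (dual_gap W) (dual_gap W) $$ (a, b)))\<^sup>2)"
    "\<And>s. FP m d V (dual_shift (dual_gap W) s) = energy S S_inv + 2 * s\<^sup>2 * \<alpha> + (s\<^sup>2)\<^sup>2 * \<beta>"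
    using energy_dual_shift[OF gap(1,2)] by metis
  have \<beta>: "\<beta> \<ge> 0" unfolding ab(2) by (intro sum_nonneg) auto
  have FP: "FP m d V W = energy S S_inv + 2 * \<alpha> + \<beta>" using ab(3)[of 1] gap(3) by simp
  show "energy S S_inv \<le> FP m d V W" using FP ab(1) \<beta> by linarith
  assume "FP m d V W = energy S S_inv"
  then have "\<beta> = 0" using FP ab(1) \<beta> by linarith
  then have zero: "dual_gap W i = 0\<^sub>m (k i) d" if "i < m" for i
    using cross_op_eq_0_imp[OF gap(1) _ that] ab(2) by simp
  show "W = canon_dual m d V"
  proof
    fix i show "W i = canon_dual m d V i"
    proof (cases "i < m")
      case True
      have "W i = dual_shift (dual_gap W) 1 i" by (simp only: gap(3))
      also have "\<dots> = V i * S_inv + 0\<^sub>m (k i) d" using True zero[OF True] by (simp add: dual_shift_def)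
      also have "\<dots> = V i * S_inv"
        using True VS_shaped by (intro right_add_zero_mat) (auto simp: shaped_def)
      finally show ?thesis using True by (simp add: canon_dual_eq)
    next
      case False
      then show ?thesis using W_sys by (simp add: canon_dual_eq systems_def)
    qed
  qed
qed

end

section \<open>Minimizers of the joint potential\<close>

lemma frame_op_unitary:
  assumes Q: "\<And>i. i < m \<Longrightarrow> Q i \<in> carrier_mat d (k i)" and U: "unitary d U"
    and h: "\<And>i. i < m \<Longrightarrow> unitary (k i) (h i)"
  shows "frame_op m d (\<lambda>i. U * (Q i * h i)) = U * frame_op m d Q * mat_adjoint U"
proof -
  have "Q i * h i \<in> carrier_mat d (k i)" if "i < m" for i
    using Q[OF that] unitaryD(1)[OF h[OF that]] by (rule mult_carrier_mat)
  then have "frame_op m d (\<lambda>i. U * (Q i * h i)) = U * frame_op m d (\<lambda>i. Q i * h i) * mat_adjoint U"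
    by (rule frame_op_conjugate) (use unitaryD(1)[OF U] in auto)
  also have "frame_op m d (\<lambda>i. Q i * h i) = frame_op m d Q"
    by (rule frame_op_right_unitary[OF Q h])
  finally show ?thesis .
qed

lemma unitary_conjugate_inverse:
  assumes U: "unitary d U" and A: "A \<in> carrier_mat d d"
  shows "U * (mat_adjoint U * A * U) * mat_adjoint U = A" "mat_adjoint U * (U * A * mat_adjoint U) * U = A"
proof -
  note U' = unitaryD[OF U]
  note as = assoc_mult_mat[of _ d d _ d _ d] mult_carrier_mat[of _ d d _ d]
  have "U * (mat_adjoint U * A * U) * mat_adjoint U = (U * mat_adjoint U) * (A * (U * mat_adjoint U))"
    using U'(1) A by (simp add: as)
  then show "U * (mat_adjoint U * A * U) * mat_adjoint U = A" using U'(3) A by simp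
  have "mat_adjoint U * (U * A * mat_adjoint U) * U = (mat_adjoint U * U) * (A * (mat_adjoint U * U))"
    using U'(1) A by (simp add: as)
  then show "mat_adjoint U * (U * A * mat_adjoint U) * U = A" using U'(2) A by simp
qed

text \<open>Each of the \<open>d^2\<close> entries is a sum of \<open>d^2\<close> terms bounded by
  \<open>e\<close>, since unitary entries have modulus at most \<open>1\<close>. This carries an
  entrywise neighbourhood in the eigenbasis over to the pseudometric \<open>d_S\<close>.\<close>

lemma spec_norm_unitary_conjugate_le:
  assumes U: "unitary d U" and A: "A \<in> carrier_mat d d" and B: "B \<in> carrier_mat d d" and close: "entry_close d e A B"
  shows "spec_norm (U * A * mat_adjoint U - U * B * mat_adjoint U) \<le> real d ^ 4 * e"
proof -
  note U' = unitaryD(1)[OF U]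
  have carr: "U * C * mat_adjoint U \<in> carrier_mat d d" if "C \<in> carrier_mat d d" for C
    using U' that by (simp add: mult_carrier_mat[of _ d d _ d])
  have idx: "(U * C * mat_adjoint U) $$ (a, b) = (\<Sum>q<d. \<Sum>p<d. U $$ (a, p) * C $$ (p, q) * cnj (U $$ (b, q)))"
    if "C \<in> carrier_mat d d" "a < d" "b < d" for C a b
    using that U' by (simp add: index_mult_mat_sum[of _ d d _ d] mult_carrier_mat[of _ d d _ d]
      sum_distrib_right del: index_mult_mat(1))
  have "spec_norm (U * A * mat_adjoint U - U * B * mat_adjoint U)
      \<le> (\<Sum>a<d. \<Sum>b<d. cmod ((U * A * mat_adjoint U - U * B * mat_adjoint U) $$ (a, b)))"
    by (rule spec_norm_le) (rule minus_carrier_mat[OF carr[OF B]])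
  also have "\<dots> \<le> (\<Sum>a<d. \<Sum>b<d. \<Sum>q<d. \<Sum>p<d. e)"
  proof (intro sum_mono)
    fix a b assume "a \<in> {..<d}" "b \<in> {..<d}"
    then have ab: "a < d" "b < d" by auto
    have "(U * A * mat_adjoint U - U * B * mat_adjoint U) $$ (a, b)
        = (U * A * mat_adjoint U) $$ (a, b) - (U * B * mat_adjoint U) $$ (a, b)"
      using ab carrier_matD[OF U'] by (intro index_minus_mat) auto
    also have "\<dots> = (\<Sum>q<d. \<Sum>p<d. U $$ (a, p) * (A $$ (p, q) - B $$ (p, q)) * cnj (U $$ (b, q)))"
      unfolding idx[OF A ab] idx[OF B ab] sum_subtractf[symmetric]
      by (intro sum.cong refl) (simp add: algebra_simps)
    finally have eq: "(U * A * mat_adjoint U - U * B * mat_adjoint U) $$ (a, b)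
        = (\<Sum>q<d. \<Sum>p<d. U $$ (a, p) * (A $$ (p, q) - B $$ (p, q)) * cnj (U $$ (b, q)))" .
    show "cmod ((U * A * mat_adjoint U - U * B * mat_adjoint U) $$ (a, b)) \<le> (\<Sum>q<d. \<Sum>p<d. e)"
      unfolding eq
    proof (intro sum_norm_le)
      fix q p assume "q \<in> {..<d}" "p \<in> {..<d}"
      then have pq: "p < d" "q < d" by auto
      have "cmod (A $$ (p, q) - B $$ (p, q)) < e" using close pq by (simp add: entry_close_def)
      moreover from this have "e \<ge> 0" using norm_ge_zero[of "A $$ (p, q) - B $$ (p, q)"] by linarith
      ultimately have "cmod (U $$ (a, p)) * cmod (A $$ (p, q) - B $$ (p, q)) * cmod (U $$ (b, q)) \<le> 1 * e * 1"
        using unitary_cmod_le[OF U ab(1) pq(1)] unitary_cmod_le[OF U ab(2) pq(2)]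
        by (intro mult_mono) auto
      then show "cmod (U $$ (a, p) * (A $$ (p, q) - B $$ (p, q)) * cnj (U $$ (b, q))) \<le> e"
        by (simp add: norm_mult)
    qed
  qed
  also have "\<dots> = real d ^ 4 * e" by (simp add: power4_eq_xxxx)
  finally show ?thesis .
qed

lemma mtrace_real_diag: "mtrace (real_diag d w) = of_real (\<Sum>a<d. w a)"
  by (simp add: mtrace_def)

section \<open>Passage between systems and tight families; spectra of their operators\<close>

lemma Pv_tight_family:
  assumes "V \<in> Pv v m k d"
  shows "tight_family m d k v (\<lambda>i. mat_adjoint (V i))"
  using assms by (auto simp: Pv_def RS_def systems_def tight_family_def)

lemma tight_family_Pv:
  assumes Q: "tight_family m d k v Q" and F: "F \<in> carrier_mat d d" "frame_op m d Q * F = 1\<^sub>m d"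
  shows "(\<lambda>i. if i < m then mat_adjoint (Q i) else 0\<^sub>m 0 0) \<in> Pv v m k d"
    "rs_op m d (\<lambda>i. if i < m then mat_adjoint (Q i) else 0\<^sub>m 0 0) = frame_op m d Q"
proof -
  let ?V = "\<lambda>i. if i < m then mat_adjoint (Q i) else 0\<^sub>m 0 0"
  show op: "rs_op m d ?V = frame_op m d Q"
    unfolding rs_op_cross_op cross_op_frame_op frame_op_def by (intro eq_matI) auto
  have "?V \<in> systems m k d" using Q by (auto simp: systems_def tight_family_def)
  moreover have "invertible_mat (frame_op m d Q)"
    using det_nonzero_of_inverse[OF frame_op_carrier F] by (simp add: invertible_mat_iff_det[of _ d])
  ultimately show "?V \<in> Pv v m k d" using Q by (simp add: Pv_def RS_def op tight_family_def)
qed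

context reconstruction_system
begin

lemma S_frame_op: "S = frame_op m d (\<lambda>i. mat_adjoint (V i))"
  by (simp add: S_def rs_op_cross_op cross_op_frame_op)

lemma V_adjoint_carrier: "i < m \<Longrightarrow> mat_adjoint (V i) \<in> carrier_mat d (k i)"
  using V_shaped by (auto simp: shaped_def)

lemma diagonalization:
  assumes l: "mset l = mset (eig_desc S)"
  obtains U where "unitary d U" "mat_adjoint U * S * U = real_diag d (\<lambda>a. l ! a)"
    "mat_adjoint U * S_inv * U = real_diag d (\<lambda>a. 1 / l ! a)" "\<And>a. a < d \<Longrightarrow> l ! a > 0"
    "energy S S_inv = energy (real_diag d (\<lambda>a. l ! a)) (real_diag d (\<lambda>a. 1 / l ! a))"
proof -
  obtain U where U: "unitary d U" "mat_adjoint U * S * U = real_diag d (\<lambda>a. l ! a)"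
    using hermitian_diagonalization(3)[OF S_carrier S_hermitian l] by blast
  note U' = unitaryD[OF U(1)]
  let ?L = "real_diag d (\<lambda>a. l ! a)" and ?F = "mat_adjoint U * S_inv * U"
  have F: "?F \<in> carrier_mat d d" using U' S_inv by (simp add: mult_carrier_mat[of _ d d _ d])
  have LF: "?L * ?F = 1\<^sub>m d"
    unfolding U(2)[symmetric] unitary_conjugate_mult[OF U(1) S_carrier S_inv(1)] S_inv(2) using U' by simp
  have op: "frame_op m d (\<lambda>i. mat_adjoint U * mat_adjoint (V i)) = ?L"
    unfolding U(2)[symmetric] S_frame_op
    using frame_op_conjugate[of m "\<lambda>i. mat_adjoint (V i)" d k "mat_adjoint U", OF V_adjoint_carrier carrier_adjoint[OF U'(1)]]
    by simp
  have carr: "mat_adjoint U * mat_adjoint (V i) \<in> carrier_mat d (k i)" if "i < m" for i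
    using carrier_adjoint[OF U'(1)] V_adjoint_carrier[OF that] by (rule mult_carrier_mat)
  have pos: "l ! a > 0" if "a < d" for a
    using inverse_diagonal_bound(1)[of m "\<lambda>i. mat_adjoint U * mat_adjoint (V i)" d k ?F a, OF carr F _ that] that LF
    by (simp add: op)
  have "?F = real_diag d (\<lambda>a. 1 / l ! a)"
  proof (rule eq_matI)
    fix a b assume "a < dim_row (real_diag d (\<lambda>a. 1 / l ! a))" "b < dim_col (real_diag d (\<lambda>a. 1 / l ! a))"
    then have ab: "a < d" "b < d" by auto
    have "of_bool (a = b) = (?L * ?F) $$ (a, b)" using ab LF by simp
    also have "\<dots> = (\<Sum>c<d. ?L $$ (a, c) * ?F $$ (c, b))" by (rule index_mult_mat_sum[OF real_diag_carrier F ab])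
    also have "\<dots> = of_real (l ! a) * ?F $$ (a, b)" using ab by (subst sum_eq_single[of a]) auto
    finally have "?F $$ (a, b) = of_bool (a = b) / of_real (l ! a)" using pos[OF ab(1)] by (simp add: field_simps)
    then show "?F $$ (a, b) = real_diag d (\<lambda>a. 1 / l ! a) $$ (a, b)" using ab by simp
  qed (use F in auto)
  moreover have "energy S S_inv = energy ?L ?F"
    unfolding U(2)[symmetric] by (rule energy_unitary_conjugate[OF U(1) S_carrier S_inv(1), symmetric])
  ultimately show ?thesis using that[OF U _ pos] by simp
qed

lemma eig_desc_pos: "x \<in> set (eig_desc S) \<Longrightarrow> x > 0"
  using hermitian_diagonalization(1)[OF S_carrier S_hermitian]
  by (metis diagonalization in_set_conv_nth)

lemma spectral_energy:
  "FP m d V (canon_dual m d V) = (\<Sum>a<d. (eig_desc S ! a)\<^sup>2 + 1 / (eig_desc S ! a)\<^sup>2)"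
proof -
  obtain U where "\<And>a. a < d \<Longrightarrow> eig_desc S ! a > 0"
    "energy S S_inv = energy (real_diag d (\<lambda>a. eig_desc S ! a)) (real_diag d (\<lambda>a. 1 / eig_desc S ! a))"
    using diagonalization[OF refl] by metis
  then show ?thesis unfolding canon_dual_dual(4) by (simp add: energy_real_diag)
qed

text \<open>The trace of \<open>S\<close> is the same for all members of \<open>Pv\<close>. This
  supplies an impossible spectrum for the case without minimizers.\<close>

lemma sum_eigenvalues:
  assumes "V \<in> Pv v m k d"
  shows "(\<Sum>a<d. eig_desc S ! a) = (\<Sum>i<m. real (k i) * (v i)\<^sup>2)"
proof -
  obtain U where U: "unitary d U" "mat_adjoint U * S * U = real_diag d (\<lambda>a. eig_desc S ! a)"
    using diagonalization[OF refl] by metis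
  have "complex_of_real (\<Sum>a<d. eig_desc S ! a) = mtrace S"
    using mtrace_unitary_conjugate[OF U(1) S_carrier] unfolding U(2) mtrace_real_diag .
  also have "\<dots> = (\<Sum>a<d. \<Sum>i<m. \<Sum>l<k i. cnj (V i $$ (l, a)) * V i $$ (l, a))"
    unfolding mtrace_def by (intro sum.cong) (auto simp: S_def rs_op_cross_op cross_op_index[OF V_shaped V_shaped])
  also have "\<dots> = (\<Sum>i<m. \<Sum>l<k i. \<Sum>a<d. cnj (V i $$ (l, a)) * V i $$ (l, a))"
    by (simp only: sum.swap[of _ _ "{..<d}"])
  also have "\<dots> = (\<Sum>i<m. \<Sum>l<k i. of_real ((v i)\<^sup>2))"
  proof (intro sum.cong refl)
    fix i l assume "i \<in> {..<m}" "l \<in> {..<k i}"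
    then have i: "i < m" and l: "l < k i" by auto
    have Q: "tight_family m d k v (\<lambda>i. mat_adjoint (V i))" by (rule Pv_tight_family[OF assms])
    have "(\<Sum>a<d. cnj (mat_adjoint (V i) $$ (a, l)) * mat_adjoint (V i) $$ (a, l)) = of_real ((v i)\<^sup>2) * of_bool (l = l)"
      using Q i l by (intro gram_index[of _ d "k i"]) (auto simp: tight_family_def)
    moreover have "mat_adjoint (V i) $$ (a, l) = cnj (V i $$ (l, a))" if "a < d" for a
      using V_shaped i l that by (auto simp: shaped_def)
    ultimately show "(\<Sum>a<d. cnj (V i $$ (l, a)) * V i $$ (l, a)) = of_real ((v i)\<^sup>2)"
      by (simp add: mult.commute)
  qed
  finally have "complex_of_real (\<Sum>a<d. eig_desc S ! a) = of_real (\<Sum>i<m. real (k i) * (v i)\<^sup>2)" by simp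
  then show ?thesis by (simp only: of_real_eq_iff)
qed

lemma dS_self: "dS m d V V \<le> 0"
proof -
  have "S - S \<in> carrier_mat d d" by (rule minus_carrier_mat[OF S_carrier])
  from spec_norm_le[OF this] show ?thesis by (simp add: dS_def S_def[symmetric] carrier_matD[OF S_carrier])
qed

text \<open>Moving \<open>W\<close> towards the canonical dual with \<open>V\<close> fixed changes
  \<open>S_W\<close> by a small multiple of \<open>B\<close>, yet strictly lowers the potential
  because \<open>2 * \<alpha> + \<beta> > 0\<close>.\<close>

lemma local_min_canonical:
  assumes VP: "V \<in> Pv v m k d" and W: "W \<in> RS m k d" "is_dual m d V W" and min: "local_dS_min v m k d V W"
  shows "W = canon_dual m d V"
proof (rule ccontr)
  assume neq: "W \<noteq> canon_dual m d V"
  have W_sys: "W \<in> systems m k d" using W(1) by (simp add: RS_def)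
  note gap = dual_gap[OF W_sys W(2)]
  define B where "B = cross_op m d (dual_gap W) (dual_gap W)"
  have B: "B \<in> carrier_mat d d" by (simp add: B_def)
  obtain \<alpha> \<beta> where ab: "\<alpha> \<ge> 0" "\<beta> = (\<Sum>a<d. \<Sum>b<d. (cmod (cross_op m d (dual_gap W) (dual_gap W) $$ (a, b)))\<^sup>2)"
    "\<And>s. FP m d V (dual_shift (dual_gap W) s) = energy S S_inv + 2 * s\<^sup>2 * \<alpha> + (s\<^sup>2)\<^sup>2 * \<beta>"
    using energy_dual_shift[OF gap(1,2)] by metis
  have FP_W: "FP m d V W = energy S S_inv + 2 * \<alpha> + \<beta>" using ab(3)[of 1] gap(3) by simp
  have \<beta>0: "\<beta> \<ge> 0" unfolding ab(2) by (intro sum_nonneg) auto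
  have pos: "2 * \<alpha> + \<beta> > 0"
    using FP_ge_canonical[OF W] neq FP_W ab(1) \<beta>0 by linarith
  obtain \<epsilon> where \<epsilon>: "\<epsilon> > 0" "\<And>V' W'. (V', W') \<in> DRS v m k d \<Longrightarrow> dS m d V V' + dS m d W W' < \<epsilon> \<Longrightarrow>
      FP m d V W \<le> FP m d V' W'"
    using min unfolding local_dS_min_def by blast
  define C where "C = (\<Sum>a<d. \<Sum>b<d. cmod (B $$ (a, b)))"
  have C: "C \<ge> 0" unfolding C_def by (intro sum_nonneg) auto
  \<comment> \<open>The shift parameter is \<open>sqrt \<sigma>\<close>, so that \<open>S_W\<close>
    is affine in \<open>\<sigma>\<close>. The choice gives
    \<open>(1 - \<sigma>) * C \<le> \<epsilon> / 2\<close>; \<open>C + 1\<close> avoids a zero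
    denominator, and \<open>max 0\<close> handles large \<open>\<epsilon>\<close>.\<close>
  define \<sigma> where "\<sigma> = max 0 (1 - \<epsilon> / (2 * (C + 1)))"
  have \<sigma>: "0 \<le> \<sigma>" "\<sigma> < 1" using \<epsilon>(1) C by (auto simp: \<sigma>_def)
  have close: "(1 - \<sigma>) * C < \<epsilon>"
  proof -
    have "(1 - \<sigma>) * C \<le> \<epsilon> / (2 * (C + 1)) * (C + 1)"
      using C \<sigma> \<epsilon>(1) by (intro mult_mono) (auto simp: \<sigma>_def)
    also have "\<dots> = \<epsilon> / 2"
    proof -
      have "\<epsilon> / (2 * x) * x = \<epsilon> / 2" if "x > 0" for x using that by simp
      from this[of "C + 1"] show ?thesis using C by linarith
    qed
    finally show ?thesis using \<epsilon>(1) by simp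
  qed
  define W' where "W' = dual_shift (dual_gap W) (sqrt \<sigma>)"
  have sq: "(sqrt \<sigma>)\<^sup>2 = \<sigma>" using \<sigma> by simp
  have op_W: "rs_op m d W = S_inv + of_real 1 \<cdot>\<^sub>m B"
    using dual_shift_cross(2)[OF gap(1,2), of 1] gap(3) by (simp add: B_def)
  have op_W': "rs_op m d W' = S_inv + of_real \<sigma> \<cdot>\<^sub>m B"
    using dual_shift_cross(2)[OF gap(1,2), of "sqrt \<sigma>"] unfolding sq by (simp add: B_def W'_def)
  have diff: "rs_op m d W - rs_op m d W' = of_real (1 - \<sigma>) \<cdot>\<^sub>m B"
    unfolding op_W op_W' using B S_inv(1) by (intro eq_matI) (auto simp: algebra_simps)
  have "dS m d W W' \<le> (\<Sum>a<d. \<Sum>b<d. cmod ((of_real (1 - \<sigma>) \<cdot>\<^sub>m B) $$ (a, b)))"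
    unfolding dS_def diff using B by (intro spec_norm_le) auto
  also have "\<dots> = (1 - \<sigma>) * C"
    unfolding C_def sum_distrib_left
  proof (intro sum.cong refl)
    fix a b assume "a \<in> {..<d}" "b \<in> {..<d}"
    then have "(of_real (1 - \<sigma>) \<cdot>\<^sub>m B) $$ (a, b) = of_real (1 - \<sigma>) * B $$ (a, b)" using B by auto
    then show "cmod ((of_real (1 - \<sigma>) \<cdot>\<^sub>m B) $$ (a, b)) = (1 - \<sigma>) * cmod (B $$ (a, b))"
      using \<sigma> by (simp only: norm_mult norm_of_real)
  qed
  finally have "dS m d V V + dS m d W W' < \<epsilon>" using close dS_self by linarith
  moreover have "(V, W') \<in> DRS v m k d"
    using VP dual_shift_dual[OF gap(1,2)] by (simp add: DRS_def W'_def)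
  ultimately have "FP m d V W \<le> FP m d V W'" using \<epsilon>(2) by blast
  then have "2 * \<alpha> + \<beta> \<le> 2 * \<sigma> * \<alpha> + \<sigma>\<^sup>2 * \<beta>"
    using ab(3)[of "sqrt \<sigma>"] unfolding FP_W W'_def sq by simp
  moreover have "2 * \<sigma> * \<alpha> \<le> \<sigma> * (2 * \<alpha>)" by simp
  moreover have "\<sigma>\<^sup>2 * \<beta> \<le> \<sigma> * \<beta>"
    using \<sigma> \<beta>0 by (intro mult_right_mono) (simp_all add: power2_eq_square mult_left_le)
  ultimately have "2 * \<alpha> + \<beta> \<le> \<sigma> * (2 * \<alpha> + \<beta>)" by (simp add: distrib_left)
  moreover have "\<sigma> * (2 * \<alpha> + \<beta>) < 1 * (2 * \<alpha> + \<beta>)" using \<sigma> pos by (intro mult_strict_right_mono) auto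
  ultimately show False by simp
qed

text \<open>A tight family near the diagonal operator is turned back by \<open>U\<close> and paired
  with its canonical dual. This is an admissible competitor for \<open>(V, V^#)\<close>, and
  \<open>energy\<close> is invariant under the conjugation.\<close>

lemma local_min_diagonal:
  assumes VP: "V \<in> Pv v m k d" and min: "local_dS_min v m k d V (canon_dual m d V)"
    and U: "unitary d U" and w: "mat_adjoint U * S * U = real_diag d w"
    "mat_adjoint U * S_inv * U = real_diag d (\<lambda>a. 1 / w a)"
  shows "diagonal_local_min m d k v w"
proof -
  let ?W = "canon_dual m d V" and ?L = "real_diag d w" and ?L' = "real_diag d (\<lambda>a. 1 / w a)"
  obtain \<epsilon> where \<epsilon>: "\<epsilon> > 0" "\<And>V' W'. (V', W') \<in> DRS v m k d \<Longrightarrow> dS m d V V' + dS m d ?W W' < \<epsilon> \<Longrightarrow>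
      FP m d V ?W \<le> FP m d V' W'"
    using min unfolding local_dS_min_def by blast
  \<comment> \<open>By \<open>spec_norm_unitary_conjugate_le\<close> each of the two distances is at
    most \<open>real d ^ 4 * e\<close>; with \<open>+ 1\<close> the denominator is positive and
    their sum stays strictly below \<open>\<epsilon>\<close>.\<close>
  define e where "e = \<epsilon> / (2 * (real d ^ 4 + 1))"
  have e: "e > 0" using \<epsilon>(1) by (simp add: e_def add_nonneg_pos)
  have e_sum: "real d ^ 4 * e + real d ^ 4 * e < \<epsilon>"
  proof -
    have "x * (\<epsilon> / (2 * x)) = \<epsilon> / 2" if "x > 0" for x using that by simp
    from this[of "real d ^ 4 + 1"] have "(real d ^ 4 + 1) * e = \<epsilon> / 2"
      unfolding e_def by (simp add: add_nonneg_pos)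
    then have "real d ^ 4 * e + e = \<epsilon> / 2" by (simp add: distrib_right)
    then show ?thesis using e by linarith
  qed
  note U' = unitaryD[OF U]
  have S_eq: "S = U * ?L * mat_adjoint U" unfolding w(1)[symmetric] unitary_conjugate_inverse(1)[OF U S_carrier] ..
  have S_inv_eq: "S_inv = U * ?L' * mat_adjoint U"
    unfolding w(2)[symmetric] unitary_conjugate_inverse(1)[OF U S_inv(1)] ..
  show ?thesis
    unfolding diagonal_local_min_def
  proof (intro exI[of _ e] conjI allI impI e)
    fix Q F
    assume Q: "tight_family m d k v Q" and F: "F \<in> carrier_mat d d" "frame_op m d Q * F = 1\<^sub>m d"
      and close: "entry_close d e (frame_op m d Q) ?L" "entry_close d e F ?L'"
    have Q_carr: "Q i \<in> carrier_mat d (k i)" if "i < m" for i using Q that by (simp add: tight_family_def)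
    have one: "unitary (k i) (1\<^sub>m (k i))" for i by (rule unitary_one)
    define Q' where "Q' i = U * (Q i * 1\<^sub>m (k i))" for i
    have Q': "tight_family m d k v Q'" unfolding Q'_def by (rule tight_family_unitary[OF Q U one])
    define T where "T = U * frame_op m d Q * mat_adjoint U"
    define T' where "T' = U * F * mat_adjoint U"
    have T: "T \<in> carrier_mat d d" "T' \<in> carrier_mat d d"
      using U' F by (simp_all add: T_def T'_def mult_carrier_mat[of _ d d _ d])
    have op_Q': "frame_op m d Q' = T"
      unfolding Q'_def T_def by (rule frame_op_unitary[OF Q_carr U one])
    have TT': "T * T' = 1\<^sub>m d"
      using unitary_conjugate_mult[OF unitary_adjoint[OF U] frame_op_carrier F(1)] F(2) U'
      by (simp add: T_def T'_def)
    define V' where "V' = (\<lambda>i. if i < m then mat_adjoint (Q' i) else 0\<^sub>m 0 0)"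
    have V': "V' \<in> Pv v m k d" "rs_op m d V' = T"
      using tight_family_Pv[OF Q' T(2)] op_Q' TT' by (simp_all add: V'_def)
    interpret V': reconstruction_system m d k V' by unfold_locales (use V'(1) in \<open>simp add: Pv_def\<close>)
    have V'S: "V'.S = T" by (simp add: V'.S_def V'(2))
    have V'S_inv: "V'.S_inv = T'"
      using inverse_unique[OF T(1) T(2) V'.S_inv(1) TT'] V'.S_inv(3) by (simp add: V'S)
    have DRS: "(V', canon_dual m d V') \<in> DRS v m k d"
      using V'(1) V'.canon_dual_dual by (simp add: DRS_def)
    have sym: "entry_close d e ?L (frame_op m d Q)" "entry_close d e ?L' F"
      using close by (auto simp: entry_close_def norm_minus_commute)
    have "dS m d V V' \<le> real d ^ 4 * e"
      unfolding dS_def S_def[symmetric] V'(2) S_eq T_def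
      by (rule spec_norm_unitary_conjugate_le[OF U _ _ sym(1)]) auto
    moreover have "dS m d ?W (canon_dual m d V') \<le> real d ^ 4 * e"
      unfolding dS_def canon_dual_dual(3) V'.canon_dual_dual(3) V'S_inv S_inv_eq T'_def
      by (rule spec_norm_unitary_conjugate_le[OF U _ _ sym(2)]) (use F in auto)
    ultimately have "FP m d V ?W \<le> FP m d V' (canon_dual m d V')"
      using \<epsilon>(2)[OF DRS] e_sum by linarith
    moreover have "FP m d V ?W = energy ?L ?L'"
      unfolding canon_dual_dual(4) w[symmetric] by (rule energy_unitary_conjugate[OF U S_carrier S_inv(1), symmetric])
    moreover have "FP m d V' (canon_dual m d V') = energy (frame_op m d Q) F"
      unfolding V'.canon_dual_dual(4) V'S V'S_inv T_def T'_def
      using energy_unitary_conjugate[OF unitary_adjoint[OF U] frame_op_carrier F(1)] by simp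
    ultimately show "energy ?L ?L' \<le> energy (frame_op m d Q) F" by simp
  qed
qed

end

text \<open>Equality makes two gaps vanish: that between \<open>W2\<close> and the canonical dual of
  \<open>V2\<close>, and the squared distance between a unitary conjugate of the operator of
  \<open>V2\<close> and the diagonal matrix of the eigenvalues of the operator of
  \<open>V\<close>.\<close>

lemma local_min_global:
  assumes v: "\<forall>i<m. v i > 0" and VW: "(V, W) \<in> DRS v m k d" and min: "local_dS_min v m k d V W"
    and VW2: "(V2, W2) \<in> DRS v m k d"
  shows "FP m d V W \<le> FP m d V2 W2"
    "FP m d V2 W2 = FP m d V W \<Longrightarrow> W2 = canon_dual m d V2 \<and> eig_desc (rs_op m d V2) = eig_desc (rs_op m d V)"
proof -
  have VP: "V \<in> Pv v m k d" and W: "W \<in> RS m k d" "is_dual m d V W"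
    and VP2: "V2 \<in> Pv v m k d" and W2: "W2 \<in> RS m k d" "is_dual m d V2 W2"
    using VW VW2 by (auto simp: DRS_def)
  interpret A: reconstruction_system m d k V by unfold_locales (use VP in \<open>simp add: Pv_def\<close>)
  interpret A2: reconstruction_system m d k V2 by unfold_locales (use VP2 in \<open>simp add: Pv_def\<close>)
  have canon: "W = canon_dual m d V" by (rule A.local_min_canonical[OF VP W min])
  \<comment> \<open>Increasing order, as \<open>energy_lower_bound\<close> wants \<open>w\<close>
    monotone.\<close>
  define l where "l = rev (eig_desc A.S)"
  define w where "w a = l ! a" for a
  have len: "length l = d" and sorted: "sorted_wrt (\<ge>) (eig_desc A.S)"
    using hermitian_diagonalization(1,2)[OF A.S_carrier A.S_hermitian] by (simp_all add: l_def)
  obtain U where U: "unitary d U" "mat_adjoint U * A.S * U = real_diag d w"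
    "mat_adjoint U * A.S_inv * U = real_diag d (\<lambda>a. 1 / w a)" "\<And>a. a < d \<Longrightarrow> w a > 0"
    "energy A.S A.S_inv = energy (real_diag d w) (real_diag d (\<lambda>a. 1 / w a))"
    using A.diagonalization[of l] unfolding w_def l_def mset_rev by blast
  have w_mono: "w a \<le> w c" if "a \<le> c" "c < d" for a c
  proof -
    have "sorted l" using sorted by (simp add: l_def sorted_wrt_rev)
    then show ?thesis using that len by (simp add: w_def sorted_nth_mono)
  qed
  have one: "unitary n (1\<^sub>m n)" for n by (rule unitary_one)
  define X where "X i = mat_adjoint U * (mat_adjoint (V i) * 1\<^sub>m (k i))" for i
  have X: "tight_family m d k v X"
    unfolding X_def by (rule tight_family_unitary[OF Pv_tight_family[OF VP] unitary_adjoint[OF U(1)] one])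
  have op_X: "frame_op m d X = real_diag d w"
  proof -
    have "frame_op m d X = mat_adjoint U * frame_op m d (\<lambda>i. mat_adjoint (V i)) * mat_adjoint (mat_adjoint U)"
      unfolding X_def by (rule frame_op_unitary[OF A.V_adjoint_carrier unitary_adjoint[OF U(1)] one])
    then show ?thesis by (simp add: A.S_frame_op[symmetric] U(2))
  qed
  have dmin: "diagonal_local_min m d k v w"
    using A.local_min_diagonal[OF VP _ U(1-3)] min by (simp add: canon)
  interpret B: diagonal_critical_point m d k v w X
    by unfold_locales (use v U(4) X op_X dmin in auto)
  define E where "E i q mu \<longleftrightarrow> unitary (k i) q \<and> (\<forall>b c. b \<le> c \<longrightarrow> c < k i \<longrightarrow> mu c \<le> mu b) \<and>
    (\<forall>b<k i. mu b > 0) \<and> (\<forall>a<d. \<forall>b<k i. (X i * q) $$ (a, b) \<noteq> 0 \<longrightarrow> w a = mu b)"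
    for i q and mu :: "nat \<Rightarrow> real"
  have "\<exists>q mu. E i q mu" if "i < m" for i using B.eigenframe[OF that] unfolding E_def .
  then obtain q mu where "\<And>i. i < m \<Longrightarrow> E i (q i) (mu i)" by metis
  then have q: "\<And>i. i < m \<Longrightarrow> unitary (k i) (q i)"
    and mu_anti: "\<And>i b c. i < m \<Longrightarrow> b \<le> c \<Longrightarrow> c < k i \<Longrightarrow> mu i c \<le> mu i b"
    and mu_pos: "\<And>i b. i < m \<Longrightarrow> b < k i \<Longrightarrow> mu i b > 0"
    and eigen: "\<And>i a b. i < m \<Longrightarrow> a < d \<Longrightarrow> b < k i \<Longrightarrow> (X i * q i) $$ (a, b) \<noteq> 0 \<Longrightarrow> w a = mu i b"
    unfolding E_def by blast+
  \<comment> \<open>Each range receives the basis of eigenvectors from \<open>eigenframe\<close>;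
    right multiplication by a unitary leaves the frame operator unchanged. The factor
    \<open>1\<^sub>m d\<close> matches the form \<open>U * (Q i * h i)\<close> of the lemmas on
    unitary changes.\<close>
  define Xh where "Xh i = 1\<^sub>m d * (X i * q i)" for i
  have Xh_eq: "Xh i = X i * q i" if "i < m" for i
    unfolding Xh_def by (rule left_mult_one_mat[OF mult_carrier_mat[OF B.X_carrier[OF that] unitaryD(1)[OF q[OF that]]]])
  have Xh: "tight_family m d k v Xh" unfolding Xh_def by (rule tight_family_unitary[OF X one q])
  have op_Xh: "frame_op m d Xh = real_diag d w"
    unfolding Xh_def using frame_op_unitary[OF B.X_carrier one q] by (simp add: op_X)
  interpret C: diagonal_eigenframe m d k v w Xh mu
    by unfold_locales (use v U(4) Xh op_Xh dmin mu_pos eigen Xh_eq in auto)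
  have op2: "frame_op m d (\<lambda>i. mat_adjoint (V2 i)) * A2.S_inv = 1\<^sub>m d"
    using A2.S_inv(2) by (simp add: A2.S_frame_op)
  obtain u where u: "unitary d u"
    "(\<Sum>a<d. \<Sum>b<d. (cmod ((mat_adjoint u * A2.S * u) $$ (a, b) - real_diag d w $$ (a, b)))\<^sup>2)
      \<le> energy A2.S A2.S_inv - energy (real_diag d w) (real_diag d (\<lambda>a. 1 / w a))"
    using C.energy_lower_bound[OF w_mono mu_anti Pv_tight_family[OF VP2] A2.S_inv(1) op2]
    unfolding A2.S_frame_op by blast
  have FP: "FP m d V W = energy (real_diag d w) (real_diag d (\<lambda>a. 1 / w a))"
    unfolding canon A.canon_dual_dual(4) by (rule U(5))
  have nonneg: "0 \<le> (\<Sum>a<d. \<Sum>b<d. (cmod ((mat_adjoint u * A2.S * u) $$ (a, b) - real_diag d w $$ (a, b)))\<^sup>2)"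
    by (intro sum_nonneg) auto
  show "FP m d V W \<le> FP m d V2 W2"
    unfolding FP using A2.FP_ge_canonical(1)[OF W2] u(2) nonneg by linarith
  assume eq: "FP m d V2 W2 = FP m d V W"
  have "FP m d V2 W2 = energy A2.S A2.S_inv"
    using eq A2.FP_ge_canonical(1)[OF W2] u(2) nonneg unfolding FP by linarith
  then have canon2: "W2 = canon_dual m d V2" by (rule A2.FP_ge_canonical(2)[OF W2])
  have zero: "(\<Sum>a<d. \<Sum>b<d. (cmod ((mat_adjoint u * A2.S * u) $$ (a, b) - real_diag d w $$ (a, b)))\<^sup>2) = 0"
    using eq \<open>FP m d V2 W2 = energy A2.S A2.S_inv\<close> u(2) nonneg unfolding FP by linarith
  have "mat_adjoint u * A2.S * u = real_diag d (\<lambda>a. l ! a)"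
  proof (rule eq_matI)
    fix a b assume "a < dim_row (real_diag d (\<lambda>a. l ! a))" "b < dim_col (real_diag d (\<lambda>a. l ! a))"
    then have ab: "a < d" "b < d" by auto
    have "(\<Sum>b<d. (cmod ((mat_adjoint u * A2.S * u) $$ (a, b) - real_diag d w $$ (a, b)))\<^sup>2) = 0"
      using zero ab by (subst (asm) sum_nonneg_eq_0_iff) (auto intro: sum_nonneg)
    then have "(cmod ((mat_adjoint u * A2.S * u) $$ (a, b) - real_diag d w $$ (a, b)))\<^sup>2 = 0"
      using ab by (subst (asm) sum_nonneg_eq_0_iff) auto
    then show "(mat_adjoint u * A2.S * u) $$ (a, b) = real_diag d (\<lambda>a. l ! a) $$ (a, b)"
      using ab by (simp add: w_def)
  qed (use unitaryD(1)[OF u(1)] in auto)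
  then have "mset (eig_desc A2.S) = mset l"
    by (rule eig_desc_unitary_conjugate[OF A2.S_carrier u(1) _ len])
  then have "eig_desc A2.S = eig_desc A.S"
    using sorted_ge_mset_unique[OF hermitian_diagonalization(2)[OF A2.S_carrier A2.S_hermitian] sorted]
    by (simp add: l_def)
  then show "W2 = canon_dual m d V2 \<and> eig_desc (rs_op m d V2) = eig_desc (rs_op m d V)"
    using canon2 by (simp add: A2.S_def A.S_def)
qed

theorem theorem6p3:
  fixes m d :: nat and k :: "nat \<Rightarrow> nat" and v :: "nat \<Rightarrow> real"
  assumes "m \<ge> 1" and "d \<ge> 1"
    and "\<forall>i<m. 1 \<le> k i \<and> k i \<le> d"
    and "\<forall>i<m. v i > 0"
    and "Pv v m k d \<noteq> {}"
  shows "\<exists>lam :: real list. length lam = d \<and> (\<forall>x\<in>set lam. x > 0) \<and> sorted_wrt (\<ge>) lam \<and>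
    (\<forall>(V, W) \<in> DRS v m k d.
       (local_dS_min v m k d V W \<longleftrightarrow> global_min v m k d V W) \<and>
       (global_min v m k d V W \<longleftrightarrow> (eig_desc (rs_op m d V) = lam \<and> W = canon_dual m d V)))"
proof -
  have global_local: "local_dS_min v m k d V W" if "global_min v m k d V W" for V W
    using that unfolding local_dS_min_def global_min_def by (intro exI[of _ 1]) auto
  show ?thesis
  proof (cases "\<exists>V W. (V, W) \<in> DRS v m k d \<and> local_dS_min v m k d V W")
    case True
    then obtain V0 W0 where V0: "(V0, W0) \<in> DRS v m k d" "local_dS_min v m k d V0 W0" by blast
    then have "V0 \<in> RS m k d" by (simp add: DRS_def Pv_def)
    then interpret V0: reconstruction_system m d k V0 by unfold_locales
    have V0_canon: "W0 = canon_dual m d V0"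
      using V0.local_min_canonical V0 by (auto simp: DRS_def)
    have V0_global: "global_min v m k d V0 W0"
      unfolding global_min_def using local_min_global(1)[OF assms(4) V0] by blast
    have main: "(local_dS_min v m k d V W \<longleftrightarrow> global_min v m k d V W) \<and>
       (global_min v m k d V W \<longleftrightarrow> (eig_desc (rs_op m d V) = eig_desc V0.S \<and> W = canon_dual m d V))"
      if VW: "(V, W) \<in> DRS v m k d" for V W
    proof (intro conjI iffI)
      assume "local_dS_min v m k d V W"
      then show "global_min v m k d V W"
        unfolding global_min_def using local_min_global(1)[OF assms(4) VW] by blast
    next
      assume "global_min v m k d V W"
      then have "FP m d V W = FP m d V0 W0"
        using V0_global VW V0(1) unfolding global_min_def by (intro antisym) auto
      then have "W = canon_dual m d V \<and> eig_desc (rs_op m d V) = eig_desc (rs_op m d V0)"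
        by (rule local_min_global(2)[OF assms(4) V0 VW])
      then show "eig_desc (rs_op m d V) = eig_desc V0.S" "W = canon_dual m d V" by (simp_all add: V0.S_def)
    next
      assume eq: "eig_desc (rs_op m d V) = eig_desc V0.S \<and> W = canon_dual m d V"
      have "V \<in> RS m k d" using VW by (simp add: DRS_def Pv_def)
      then interpret V: reconstruction_system m d k V by unfold_locales
      \<comment> \<open>For a canonical pair the potential depends only on the spectrum, by
        \<open>spectral_energy\<close>, so equal spectra give the global minimum value.\<close>
      have "FP m d V W = FP m d V0 W0"
        using eq V.spectral_energy V0.spectral_energy by (simp add: V0_canon V.S_def)
      then show "global_min v m k d V W" using V0_global by (simp add: global_min_def)
    qed (rule global_local)
    show ?thesis
      using hermitian_diagonalization(1,2)[OF V0.S_carrier V0.S_hermitian] V0.eig_desc_pos main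
      by (intro exI[of _ "eig_desc V0.S"]) auto
  next
    case False
    \<comment> \<open>Vacuous case: any list whose sum differs from the trace of every \<open>S\<^sub>V\<close> will do.\<close>
    define c where "c = 1 + (\<Sum>i<m. real (k i) * (v i)\<^sup>2)"
    have c: "c > 0" unfolding c_def by (intro add_pos_nonneg sum_nonneg) auto
    have "eig_desc (rs_op m d V) \<noteq> replicate d c" if VW: "(V, W) \<in> DRS v m k d" for V W
    proof
      assume eq: "eig_desc (rs_op m d V) = replicate d c"
      have VP: "V \<in> Pv v m k d" using VW by (simp add: DRS_def)
      then have "V \<in> RS m k d" by (simp add: Pv_def)
      then interpret V: reconstruction_system m d k V by unfold_locales
      \<comment> \<open>\<open>c - 1\<close> is the common trace of all \<open>S_V\<close>, whereas
        the constant list sums to \<open>d * c\<close>, which is at least \<open>c\<close>.\<close>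
      have "real d * c = c - 1"
        using V.sum_eigenvalues[OF VP] eq by (simp add: V.S_def c_def)
      moreover have "real d * c \<ge> 1 * c" using assms(2) c by (intro mult_right_mono) auto
      ultimately show False by simp
    qed
    moreover have "\<not> local_dS_min v m k d V W \<and> \<not> global_min v m k d V W" if "(V, W) \<in> DRS v m k d" for V W
      using False global_local that by blast
    moreover have "sorted_wrt (\<ge>) (replicate d c)" by (simp add: sorted_wrt_iff_nth_less)
    ultimately show ?thesis using c by (intro exI[of _ "replicate d c"]) auto
  qed
qed

end
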